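(* Let $\vec{c}=(c_1,\dots,c_k)$ be a composition of $n$ whose last part $c_k$ is positive. Then the simplicial complex $\Delta_{\vec{c}}$ is shellable, and there is a shelling whose spanning facets are exactly the facets $\sigma(\alpha,\vec c)$ where $\alpha$ ranges over all permutations in $\mathfrak{S}_n$ with descent composition $\vec{c}$. Hence $\Delta_{\vec{c}}$ is homotopy equivalent to a wedge of $\beta(\vec{c})$ spheres of dimension $k-2$.
   Context: A pointed composition of $n$ is a sequence $(c_1,\dots,c_k)$ of integers with $c_1,\dots,c_{k-1}\ge 1$, $c_k\ge 0$ and sum $n$; it is a composition if $c_k>0$. They are partially ordered by $\vec c\le\vec d$ iff $\vec d$ is obtained from $\vec c$ by replacing runs of consecutive entries by their sums. An ordered set partition of $[n]$ is a list $(C_1,\dots,C_m)$ of pairwise disjoint subsets of $[n]$ with union $[n]$, with $C_1,\dots,C_{m-1}$ nonempty ($C_m$ may be empty); its type is $(|C_1|,\dots,|C_m|)$. The simplicial complex $\Delta_n$ has these as faces: $(C_1,\dots,C_m)$ has dimension $m-2$, its faces are obtained by merging consecutive blocks, and $([n])$ is the empty face (equivalently, $\Delta_n$ is the order complex of the poset of nonempty subsets of $[n]$, the chain $S_1\subset\dots\subset S_{m-1}$ corresponding to $(S_1,S_2\setminus S_1,\dots,[n]\setminus S_{m-1})$). Let $\Delta_{\vec c}=\{\tau\in\Delta_n:\vec c\le\operatorname{type}(\tau)\}$; its facets are the faces of type $\vec c$. For $\alpha=\alpha_1\cdots\alpha_n\in\mathfrak S_n$ set $\sigma(\alpha,\vec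 c)=(\{\alpha_j: j\in R_1\},\dots,\{\alpha_j:j\in R_k\})$ where $R_i=[c_1+\dots+c_{i-1}+1,\,c_1+\dots+c_i]$. The descent composition of $\alpha$ with descent set $\{i:\alpha_i>\alpha_{i+1}\}=\{s_1<\dots<s_{k-1}\}$ is $(s_1,s_2-s_1,\dots,n-s_{k-1})$; $\beta(\vec c)$ is the number of permutations of $\mathfrak S_n$ with descent composition $\vec c$. A pure simplicial complex is shellable if it is a set of points or its facets can be ordered $F_1,\dots,F_m$ so that for $i\ge2$, $F_i\cap(F_1\cup\dots\cup F_{i-1})$ is pure of dimension $\dim F_i-1$; $F_i$ is spanning if this intersection is the whole boundary of $F_i$. *)

theory Defs
  imports "HOL-Analysis.Analysis" "HOL-Combinatorics.Permutations"
begin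

section \<open>Pointed compositions\<close>

definition pointed_composition :: "nat \<Rightarrow> nat list \<Rightarrow> bool" where
  "pointed_composition n c \<longleftrightarrow> c \<noteq> [] \<and> (\<forall>x \<in> set (butlast c). 1 \<le> x) \<and> sum_list c = n"

definition composition :: "nat \<Rightarrow> nat list \<Rightarrow> bool" where
  "composition n c \<longleftrightarrow> pointed_composition n c \<and> 0 < last c"

definition comp_le :: "nat list \<Rightarrow> nat list \<Rightarrow> bool" where
  "comp_le c d \<longleftrightarrow> (\<exists>runs. [] \<notin> set runs \<and> c = concat runs \<and> d = map sum_list runs)"


section \<open>Finite abstract simplicial complexes and shellability\<close>

text \<open>
  A face is the set of its vertices, and the empty face belongs to every nonvoid complex;
  dimensions are integers so that the empty face has dimension \<open>-1\<close>.
\<close>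

definition abs_complex :: "'v set set \<Rightarrow> bool" where
  "abs_complex K \<longleftrightarrow> finite K \<and> (\<forall>F \<in> K. finite F \<and> Pow F \<subseteq> K)"

definition face_dim :: "'v set \<Rightarrow> int" where
  "face_dim F = int (card F) - 1"

definition facets :: "'v set set \<Rightarrow> 'v set set" where
  "facets K = {F \<in> K. \<forall>G \<in> K. F \<subseteq> G \<longrightarrow> G = F}"

definition pure_of_dim :: "'v set set \<Rightarrow> int \<Rightarrow> bool" where
  "pure_of_dim K d \<longleftrightarrow> abs_complex K \<and> K \<noteq> {} \<and> (\<forall>F \<in> facets K. face_dim F = d)"

definition shelling_intersection :: "'v set list \<Rightarrow> nat \<Rightarrow> 'v set set" where
  "shelling_intersection Fs i = Pow (Fs ! i) \<inter> (\<Union>j<i. Pow (Fs ! j))"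

definition is_shelling :: "'v set set \<Rightarrow> 'v set list \<Rightarrow> bool" where
  "is_shelling K Fs \<longleftrightarrow> (\<exists>d. pure_of_dim K d) \<and> distinct Fs \<and> set Fs = facets K \<and>
     (\<forall>i. 0 < i \<and> i < length Fs \<longrightarrow>
        pure_of_dim (shelling_intersection Fs i) (face_dim (Fs ! i) - 1))"

text \<open>
  The first alternative is the case of a set of points.
\<close>

definition shellable :: "'v set set \<Rightarrow> bool" where
  "shellable K \<longleftrightarrow> (\<exists>d. pure_of_dim K d \<and> (d = 0 \<or> (\<exists>Fs. is_shelling K Fs)))"

text \<open>
  The boundary of a simplex consists of its proper faces. For the first facet the intersection
  is void, hence it is spanning only if it is the empty face, whose boundary is void as well.
\<close>

definition spanning_facets :: "'v set list \<Rightarrow> 'v set set" where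
  "spanning_facets Fs =
     {Fs ! i | i. i < length Fs \<and> shelling_intersection Fs i = {G. G \<subset> Fs ! i}}"

text \<open>
  Points are given by barycentric coordinates. For a finite complex only finitely many
  coordinates are not constantly zero, so the product topology is the usual topology.
\<close>

definition geom_realization :: "'v set set \<Rightarrow> ('v \<Rightarrow> real) topology" where
  "geom_realization K = subtopology (powertop_real UNIV)
     {x. (\<forall>v. 0 \<le> x v) \<and> {v. x v \<noteq> 0} \<in> K \<and> (\<Sum>v | x v \<noteq> 0. x v) = 1}"


section \<open>The complex of ordered set partitions\<close>

definition ordered_set_partition :: "nat \<Rightarrow> nat set list \<Rightarrow> bool" where
  "ordered_set_partition n C \<longleftrightarrow> C \<noteq> [] \<and> {} \<notin> set (butlast C) \<and>
     disjoint_family_on (\<lambda>i. C ! i) {..<length C} \<and> \<Union>(set C) = {1..n}"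

definition osp_type :: "nat set list \<Rightarrow> nat list" where
  "osp_type C = map card C"

text \<open>
  The vertices of \<open>(C\<^sub>1, \<dots>, C\<^sub>m)\<close> are the \<open>m - 1\<close> partial unions
  \<open>C\<^sub>1 \<union> \<dots> \<union> C\<^sub>i\<close> with \<open>1 \<le> i < m\<close>: a vertex \<open>(S, [n] - S)\<close> is encoded as the nonempty
  set \<open>S\<close>, and merging adjacent blocks removes one element of the chain. The partition is
  recovered from the chain \<open>S\<^sub>1 \<subset> \<dots> \<subset> S\<^bsub>m-1\<^esub>\<close> as
  \<open>(S\<^sub>1, S\<^sub>2 - S\<^sub>1, \<dots>, [n] - S\<^bsub>m-1\<^esub>)\<close>.
\<close>

definition osp_chain :: "nat set list \<Rightarrow> nat set set" where
  "osp_chain C = {\<Union>(set (take i C)) | i. 0 < i \<and> i < length C}"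

definition Delta :: "nat \<Rightarrow> nat set set set" where
  "Delta n = osp_chain ` {C. ordered_set_partition n C}"

definition Delta_comp :: "nat \<Rightarrow> nat list \<Rightarrow> nat set set set" where
  "Delta_comp n c = osp_chain ` {C. ordered_set_partition n C \<and> comp_le c (osp_type C)}"

lemma Delta_comp_subset: "Delta_comp n c \<subseteq> Delta n"
  by (auto simp: Delta_comp_def Delta_def)

definition perm_osp :: "(nat \<Rightarrow> nat) \<Rightarrow> nat list \<Rightarrow> nat set list" where
  "perm_osp \<alpha> c =
     map (\<lambda>i. \<alpha> ` {sum_list (take i c) + 1 .. sum_list (take (Suc i) c)}) [0..<length c]"


section \<open>Descent compositions\<close>

definition descent_set :: "nat \<Rightarrow> (nat \<Rightarrow> nat) \<Rightarrow> nat set" where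
  "descent_set n \<alpha> = {i \<in> {1..<n}. \<alpha> i > \<alpha> (Suc i)}"

definition descent_composition :: "nat \<Rightarrow> (nat \<Rightarrow> nat) \<Rightarrow> nat list" where
  "descent_composition n \<alpha> =
     (let s = sorted_list_of_set (descent_set n \<alpha>) in map2 (-) (s @ [n]) (0 # s))"

definition descent_perms :: "nat \<Rightarrow> nat list \<Rightarrow> (nat \<Rightarrow> nat) set" where
  "descent_perms n c = {\<alpha>. \<alpha> permutes {1..n} \<and> descent_composition n \<alpha> = c}"

definition beta :: "nat \<Rightarrow> nat list \<Rightarrow> nat" where
  "beta n c = card (descent_perms n c)"


section \<open>Wedges of spheres\<close>

definition quotient_topology :: "'a topology \<Rightarrow> ('a \<Rightarrow> 'b) \<Rightarrow> 'b topology" where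
  "quotient_topology X q =
     topology (\<lambda>U. U \<subseteq> q ` topspace X \<and> openin X {x \<in> topspace X. q x \<in> U})"

lemma openin_quotient_topology:
  "openin (quotient_topology X q) U \<longleftrightarrow>
     U \<subseteq> q ` topspace X \<and> openin X {x \<in> topspace X. q x \<in> U}"
proof -
  have "istopology (\<lambda>U. U \<subseteq> q ` topspace X \<and> openin X {x \<in> topspace X. q x \<in> U})"
    unfolding istopology_def
  proof (intro conjI allI impI)
    fix S T
    assume S: "S \<subseteq> q ` topspace X \<and> openin X {x \<in> topspace X. q x \<in> S}"
      and T: "T \<subseteq> q ` topspace X \<and> openin X {x \<in> topspace X. q x \<in> T}"
    have "{x \<in> topspace X. q x \<in> S \<inter> T}
        = {x \<in> topspace X. q x \<in> S} \<inter> {x \<in> topspace X. q x \<in> T}"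
      by blast
    then show "openin X {x \<in> topspace X. q x \<in> S \<inter> T}"
      using S T by auto
    show "S \<inter> T \<subseteq> q ` topspace X"
      using S by blast
  next
    fix \<K>
    assume K: "\<forall>S\<in>\<K>. S \<subseteq> q ` topspace X \<and> openin X {x \<in> topspace X. q x \<in> S}"
    have "{x \<in> topspace X. q x \<in> \<Union>\<K>} = (\<Union>S\<in>\<K>. {x \<in> topspace X. q x \<in> S})"
      by blast
    then show "openin X {x \<in> topspace X. q x \<in> \<Union>\<K>}"
      using K by auto
    show "\<Union>\<K> \<subseteq> q ` topspace X"
      using K by blast
  qed
  then show ?thesis
    by (simp add: quotient_topology_def topology_inverse')
qed

lemma topspace_quotient_topology [simp]:
  "topspace (quotient_topology X q) = q ` topspace X"
proof
  show "topspace (quotient_topology X q) \<subseteq> q ` topspace X"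
    using openin_quotient_topology[of X q "topspace (quotient_topology X q)"] by auto
  have "{x \<in> topspace X. q x \<in> q ` topspace X} = topspace X"
    by blast
  then have "openin (quotient_topology X q) (q ` topspace X)"
    by (simp add: openin_quotient_topology)
  then show "q ` topspace X \<subseteq> topspace (quotient_topology X q)"
    by (rule openin_subset)
qed

lemma quotient_map_quotient_topology: "quotient_map X (quotient_topology X q) q"
  by (simp add: quotient_map_def openin_quotient_topology)

text \<open>
  The wedge is the disjoint union with all base points \<open>p i\<close> identified to \<open>None\<close>. The wedge of
  no spaces is a point. The wedge of a single space is that space, also when it is empty.
\<close>

definition wedge ::
    "'i set \<Rightarrow> ('i \<Rightarrow> 'a topology) \<Rightarrow> ('i \<Rightarrow> 'a) \<Rightarrow> ('i \<times> 'a) option topology" where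
  "wedge I X p =
     (if I = {} then discrete_topology {None}
      else quotient_topology (sum_topology X I)
             (\<lambda>(i, x). if x = p i then None else Some (i, x)))"

text \<open>
  The sphere of dimension \<open>-1\<close>, the unit sphere in \<open>\<real>\<^sup>0\<close>, is empty.
\<close>

definition sphere_of_dim :: "int \<Rightarrow> (nat \<Rightarrow> real) topology" where
  "sphere_of_dim d = (if d < 0 then discrete_topology {} else nsphere (nat d))"

definition wedge_of_spheres :: "nat \<Rightarrow> int \<Rightarrow> (nat \<times> (nat \<Rightarrow> real)) option topology" where
  "wedge_of_spheres b d =
     wedge {..<b} (\<lambda>_. sphere_of_dim d) (\<lambda>_ j. if j = 0 then 1 else 0)"

end

theory Submission
  imports Defs
begin

text \<open>
  For a composition with positive parts, \<open>\<Delta>\<^bsub>c\<^esub>\<close> consists of the chains of subsets of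
  \<open>{1..n}\<close> whose cardinalities are proper partial sums of \<open>c\<close>. Order the maximal chains by the
  total of all elements of all their members. Call a member \<open>S\<close> of a maximal chain \<open>F\<close> a descent if
  exchanging an element of the block that ends at \<open>S\<close> for a smaller element of the next block
  is possible; the exchange yields a facet of smaller weight that contains \<open>F - {S}\<close>.
  Conversely, \<open>F\<close> has least weight among all facets that contain its descents. So \<open>F\<close> meets the earlier
  facets exactly in the faces that miss some descent, which is a shelling, and \<open>F\<close> is spanning iff
  all its members are descents, that is, iff \<open>F\<close> comes from a permutation with descent composition \<open>c\<close>.

  For the homotopy type of a shellable complex, the non-spanning facets form a contractible
  subcomplex \<open>A\<close>, because each of them retracts onto its intersection with its predecessors. The remaining
  facets are attached along their whole boundaries, which lie in \<open>A\<close>. Collapsing \<open>A\<close> to a point is a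
  homotopy equivalence since a contraction of \<open>A\<close> extends to the whole complex, and each
  spanning facet with its boundary collapsed is a sphere.
\<close>

section \<open>Shellings from weights, and chains of prescribed ranks\<close>

text \<open>A weight replaces an explicit total order because \<open>F\<close> has to be compared
  only with the facets that contain its descents; facets of equal weight may be sorted in either
  order. The homotopy part accepts any shelling, so spanning facets may be interspersed with the
  others. Omitting them leaves the remaining intersections unchanged: the only new face of a
  spanning facet is that facet itself, and all facets have equally many vertices, so a proper face
  of a facet first appears in a non-spanning one. The quotient by \<open>A\<close> is never formed.
  A map straight onto the wedge is written in barycentric coordinates, and it is a quotient map
  because its source is compact and the wedge is Hausdorff. The formulas are built on the least
  coordinate of a point, which is continuous on a simplex and vanishes exactly on the boundary. A
  composition with a single part is a separate case: the only facet is the empty face, there is no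
  contractible part to collapse, and the sphere is empty.\<close>

lemma shelling_by_weight:
  fixes K :: "'v set set" and w :: "'v set \<Rightarrow> 'w::linorder"
  assumes K: "pure_of_dim K d"
    and R_sub: "\<And>F. F \<in> facets K \<Longrightarrow> R F \<subseteq> F"
    and descend: "\<And>F v. \<lbrakk>F \<in> facets K; v \<in> R F\<rbrakk> \<Longrightarrow> \<exists>G\<in>facets K. F - {v} \<subseteq> G \<and> w G < w F"
    and ascend: "\<And>F G. \<lbrakk>F \<in> facets K; G \<in> facets K; R F \<subseteq> G; F \<noteq> G\<rbrakk> \<Longrightarrow> w F < w G"
  obtains Fs where "is_shelling K Fs" "spanning_facets Fs = {F \<in> facets K. R F = F}"
proof -
  have "finite (facets K)"
    using K by (simp add: pure_of_dim_def abs_complex_def facets_def)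
  then obtain xs where xs: "set xs = facets K" "distinct xs"
    using finite_distinct_list by metis
  define Fs where "Fs = sort_key w xs"
  have Fs: "set Fs = facets K" "distinct Fs"
    using xs by (simp_all add: Fs_def)
  have mono: "w (Fs ! i) \<le> w (Fs ! j)" if "i \<le> j" "j < length Fs" for i j
    using sorted_nth_mono[of "map w Fs" i j] that by (simp add: Fs_def)
  have facet: "Fs ! i \<in> facets K" if "i < length Fs" for i
    using that Fs(1) nth_mem by blast
  \<comment> \<open>A facet sorted earlier is no heavier, so by \<open>ascend\<close> it cannot
    contain \<open>R (Fs ! i)\<close>. A face that misses some \<open>v\<close> in it lies in a
    strictly lighter facet by \<open>descend\<close>, and that facet must come earlier.\<close>
  have inter: "shelling_intersection Fs i = {G. G \<subseteq> Fs ! i \<and> \<not> R (Fs ! i) \<subseteq> G}" if i: "i < length Fs" for i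
  proof (intro equalityI subsetI CollectI)
    fix G assume "G \<in> shelling_intersection Fs i"
    then obtain j where j: "j < i" "G \<subseteq> Fs ! i" "G \<subseteq> Fs ! j"
      by (auto simp: shelling_intersection_def)
    have "\<not> R (Fs ! i) \<subseteq> G"
    proof
      assume "R (Fs ! i) \<subseteq> G"
      moreover have "Fs ! i \<noteq> Fs ! j"
        using j(1) i Fs(2) by (simp add: nth_eq_iff_index_eq)
      ultimately have "w (Fs ! i) < w (Fs ! j)"
        using ascend[OF facet[OF i] facet[of j]] j i by auto
      then show False
        using mono[of j i] j(1) i by simp
    qed
    with j(2) show "G \<subseteq> Fs ! i \<and> \<not> R (Fs ! i) \<subseteq> G"
      by blast
  next
    fix G assume "G \<in> {G. G \<subseteq> Fs ! i \<and> \<not> R (Fs ! i) \<subseteq> G}"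
    then obtain v where v: "v \<in> R (Fs ! i)" "v \<notin> G" "G \<subseteq> Fs ! i"
      by blast
    then obtain G' where G': "G' \<in> facets K" "Fs ! i - {v} \<subseteq> G'" "w G' < w (Fs ! i)"
      using descend[OF facet[OF i]] by blast
    then obtain j where j: "j < length Fs" "G' = Fs ! j"
      using Fs(1) by (metis in_set_conv_nth)
    have "j < i"
      using mono[of i j] G'(3) j by (metis leI leD)
    then show "G \<in> shelling_intersection Fs i"
      using v G'(2) j(2) by (auto simp: shelling_intersection_def)
  qed
  have "pure_of_dim (shelling_intersection Fs i) (face_dim (Fs ! i) - 1)" if i: "0 < i" "i < length Fs" for i
  proof -
    let ?F = "Fs ! i"
    let ?J = "{G. G \<subseteq> ?F \<and> \<not> R ?F \<subseteq> G}"
    have fin: "finite ?F"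
      using facet[OF i(2)] K by (auto simp: pure_of_dim_def abs_complex_def facets_def)
    \<comment> \<open>Otherwise every facet contains \<open>R ?F\<close>, and \<open>?F\<close>
      would be lighter than the first facet.\<close>
    have "R ?F \<noteq> {}"
    proof
      assume "R ?F = {}"
      moreover have "?F \<noteq> Fs ! 0"
        using i Fs(2) by (subst nth_eq_iff_index_eq) auto
      ultimately have "w ?F < w (Fs ! 0)"
        using ascend[OF facet[OF i(2)] facet[of 0]] i by force
      then show False
        using mono[of 0 i] i by simp
    qed
    then have "{} \<in> ?J"
      by blast
    moreover have "abs_complex ?J"
      unfolding abs_complex_def using fin by (auto intro: finite_subset)
    moreover have "face_dim M = face_dim ?F - 1" if M: "M \<in> facets ?J" for M
    proof -
      have "M \<subseteq> ?F" "\<not> R ?F \<subseteq> M"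
        using M by (auto simp: facets_def)
      then obtain v where v: "v \<in> R ?F" "M \<subseteq> ?F - {v}"
        by blast
      then have "v \<in> ?F" "?F - {v} \<in> ?J"
        using R_sub[OF facet[OF i(2)]] by auto
      then have "M = ?F - {v}"
        using M v(2) by (auto simp: facets_def)
      then show ?thesis
        using fin \<open>v \<in> ?F\<close> card_gt_0_iff[of ?F] by (auto simp: face_dim_def of_nat_diff)
    qed
    ultimately show ?thesis
      unfolding inter[OF i(2)] pure_of_dim_def by blast
  qed
  then have shelling: "is_shelling K Fs"
    using K Fs by (auto simp: is_shelling_def)
  have sp: "shelling_intersection Fs i = {G. G \<subset> Fs ! i} \<longleftrightarrow> R (Fs ! i) = Fs ! i" if i: "i < length Fs" for i
  proof
    assume "shelling_intersection Fs i = {G. G \<subset> Fs ! i}"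
    \<comment> \<open>\<open>R (Fs ! i)\<close> is a face outside the intersection; if the
      intersection is the whole boundary, this face cannot be proper.\<close>
    moreover have "R (Fs ! i) \<notin> shelling_intersection Fs i"
      using inter[OF i] by simp
    ultimately show "R (Fs ! i) = Fs ! i"
      using R_sub[OF facet[OF i]] by blast
  next
    assume "R (Fs ! i) = Fs ! i"
    then show "shelling_intersection Fs i = {G. G \<subset> Fs ! i}"
      using inter[OF i] by auto
  qed
  have "spanning_facets Fs = {Fs ! i | i. i < length Fs \<and> R (Fs ! i) = Fs ! i}"
    unfolding spanning_facets_def by (intro Collect_cong iff_exI conj_cong refl sp)
  also have "\<dots> = {F \<in> facets K. R F = F}"
    unfolding Fs(1)[symmetric] by (auto simp: in_set_conv_nth)
  finally have "spanning_facets Fs = {F \<in> facets K. R F = F}" .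
  with shelling show thesis
    by (rule that)
qed

section \<open>Order complexes of rank-selected Boolean lattices\<close>

definition rank_chains :: "nat \<Rightarrow> nat set \<Rightarrow> nat set set set" where
  "rank_chains n R =
     {F. (\<forall>S\<in>F. S \<subseteq> {1..n} \<and> card S \<in> R) \<and> (\<forall>S\<in>F. \<forall>T\<in>F. S \<subseteq> T \<or> T \<subseteq> S)}"

lemma rank_chainsD:
  assumes "F \<in> rank_chains n R" "S \<in> F"
  shows "S \<subseteq> {1..n}" "card S \<in> R" "T \<in> F \<Longrightarrow> S \<subseteq> T \<or> T \<subseteq> S"
proof -
  have F: "(\<forall>S\<in>F. S \<subseteq> {1..n} \<and> card S \<in> R) \<and> (\<forall>S\<in>F. \<forall>T\<in>F. S \<subseteq> T \<or> T \<subseteq> S)"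
    using assms(1) by (simp only: rank_chains_def mem_Collect_eq)
  note S = bspec[OF conjunct1[OF F] assms(2)]
  show "S \<subseteq> {1..n}"
    by (rule conjunct1[OF S])
  show "card S \<in> R"
    by (rule conjunct2[OF S])
  show "S \<subseteq> T \<or> T \<subseteq> S" if "T \<in> F"
    by (rule bspec[OF bspec[OF conjunct2[OF F] assms(2)] that])
qed

lemma rank_chains_card_le:
  assumes "F \<in> rank_chains n R" "S \<in> F" "T \<in> F" "card S \<le> card T"
  shows "S \<subseteq> T"
proof -
  have "finite S" "S \<subseteq> T \<or> T \<subseteq> S"
    using assms finite_subset[of S "{1..n}"] by (auto simp: rank_chains_def)
  then show ?thesis
    using assms(4) card_seteq[of S T] by blast
qed

lemma rank_chains_inj_on_card:
  assumes "F \<in> rank_chains n R"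
  shows "inj_on card F"
proof (rule inj_onI)
  fix S T assume "S \<in> F" "T \<in> F" "card S = card T"
  then show "S = T"
    using rank_chains_card_le[OF assms, of S T] rank_chains_card_le[OF assms, of T S] by simp
qed

lemma abs_complex_rank_chains: "abs_complex (rank_chains n R)"
proof -
  have sub: "rank_chains n R \<subseteq> Pow (Pow {1..n})"
    by (auto simp: rank_chains_def)
  then have "finite F" if "F \<in> rank_chains n R" for F
    using that by (meson PowD finite_Pow_iff finite_atLeastAtMost finite_subset subsetD)
  moreover have "finite (rank_chains n R)"
    using sub by (rule finite_subset) simp
  moreover have "Pow F \<subseteq> rank_chains n R" if "F \<in> rank_chains n R" for F
  proof
    fix G assume "G \<in> Pow F"
    then have "\<And>S. S \<in> G \<Longrightarrow> S \<in> F"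
      by auto
    then show "G \<in> rank_chains n R"
      using that by (simp add: rank_chains_def)
  qed
  ultimately show ?thesis
    unfolding abs_complex_def by blast
qed

lemma finite_rank_chain:
  assumes "F \<in> rank_chains n R"
  shows "finite F" "S \<in> F \<Longrightarrow> finite S"
proof -
  show "finite F"
    using assms abs_complex_rank_chains[of n R] by (simp add: abs_complex_def)
  show "finite S" if "S \<in> F"
    using assms that finite_subset[of S "{1..n}"] by (simp add: rank_chains_def)
qed

text \<open>A missing rank can be filled between the largest member below it and the smallest member
  above it.\<close>

lemma rank_chain_extend:
  assumes F: "F \<in> rank_chains n R" and r: "r \<in> R" "r \<notin> card ` F" and R: "R \<subseteq> {1..<n}"
  obtains V where "insert V F \<in> rank_chains n R" "V \<notin> F"
proof -
  have r0: "0 < r" "r < n"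
    using r R by auto
  have chain: "S \<subseteq> T \<or> T \<subseteq> S" if "S \<in> F" "T \<in> F" for S T
    using rank_chainsD[OF F] that by blast
  have sub: "S \<subseteq> {1..n}" if "S \<in> F" for S
    using rank_chainsD[OF F] that by blast
  \<comment> \<open>The sets \<open>{}\<close> and \<open>{1..n}\<close> act as sentinels when no
    member lies below or above; their cardinalities are on the right side of \<open>r\<close>
    because \<open>0 < r < n\<close>.\<close>
  let ?B = "insert {} {S\<in>F. card S < r}" and ?C = "insert {1..n} {S\<in>F. r < card S}"
  obtain L where L: "L \<in> ?B" "\<forall>S\<in>?B. L \<subseteq> S \<longrightarrow> L = S"
    using finite_has_maximal[of ?B] finite_rank_chain(1)[OF F] by auto
  obtain U where U: "U \<in> ?C" "\<forall>S\<in>?C. S \<subseteq> U \<longrightarrow> U = S"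
    using finite_has_minimal[of ?C] finite_rank_chain(1)[OF F] by auto
  have L_max: "S \<subseteq> L" if "S \<in> F" "card S < r" for S
    using L that chain[of S L] by blast
  have U_min: "U \<subseteq> S" if "S \<in> F" "r < card S" for S
    using U that chain[of S U] sub by blast
  have "card L \<le> r" "r \<le> card U"
    using L(1) U(1) r0 by auto
  moreover have LU: "L \<subseteq> U"
    using L(1) U(1) sub U_min L_max rank_chains_card_le[OF F, of L U] by auto
  moreover have U_sub: "U \<subseteq> {1..n}"
    using U(1) sub by auto
  moreover have "finite U"
    using U_sub finite_subset by blast
  ultimately obtain V where V: "L \<subseteq> V" "V \<subseteq> U" "card V = r"
    using exists_subset_between[of L r U] by blast
  have "S \<subseteq> V \<or> V \<subseteq> S" if "S \<in> F" for S
  proof -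
    have "card S \<noteq> r"
      using that r(2) by auto
    then show ?thesis
      using that L_max U_min V by (metis linorder_neqE_nat order_trans)
  qed
  then have "insert V F \<in> rank_chains n R"
    using F V U_sub r(1) by (auto simp: rank_chains_def)
  moreover have "V \<notin> F"
    using V(3) r(2) by auto
  ultimately show thesis
    by (rule that)
qed

text \<open>A chain that misses a rank can be extended, and one that has all ranks cannot, because a
  chain has at most one member of each cardinality.\<close>

lemma facets_rank_chains:
  assumes "R \<subseteq> {1..<n}"
  shows "facets (rank_chains n R) = {F \<in> rank_chains n R. card ` F = R}"
proof (intro equalityI subsetI)
  fix F assume F: "F \<in> facets (rank_chains n R)"
  then have F': "F \<in> rank_chains n R"
    by (simp add: facets_def)
  moreover have "card ` F \<subseteq> R"
    using F' by (auto simp: rank_chains_def)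
  moreover have "R \<subseteq> card ` F"
  proof
    fix r assume r: "r \<in> R"
    show "r \<in> card ` F"
    proof (rule ccontr)
      assume "r \<notin> card ` F"
      then obtain V where "insert V F \<in> rank_chains n R" "V \<notin> F"
        using rank_chain_extend F' r assms by metis
      then show False
        using F by (auto simp: facets_def)
    qed
  qed
  ultimately show "F \<in> {F \<in> rank_chains n R. card ` F = R}"
    by auto
next
  fix F assume "F \<in> {F \<in> rank_chains n R. card ` F = R}"
  then have F: "F \<in> rank_chains n R" "card ` F = R"
    by auto
  have "G = F" if G: "G \<in> rank_chains n R" "F \<subseteq> G" for G
  proof (intro equalityI subsetI)
    fix T assume T: "T \<in> G"
    then have "card T \<in> card ` F"
      using G(1) F(2) by (auto simp: rank_chains_def)
    then obtain S where "S \<in> F" "card S = card T"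
      by auto
    then show "T \<in> F"
      using rank_chains_inj_on_card[OF G(1)] T G(2) by (metis inj_onD subsetD)
  qed (use G in auto)
  then show "F \<in> facets (rank_chains n R)"
    using F(1) by (auto simp: facets_def)
qed

lemma card_facet_rank_chains:
  assumes "R \<subseteq> {1..<n}" "F \<in> facets (rank_chains n R)"
  shows "card F = card R"
proof -
  have "F \<in> rank_chains n R" "card ` F = R"
    using assms(2) unfolding facets_rank_chains[OF assms(1)] by auto
  then show ?thesis
    using card_image[OF rank_chains_inj_on_card] by metis
qed

lemma pure_rank_chains:
  assumes "R \<subseteq> {1..<n}"
  shows "pure_of_dim (rank_chains n R) (int (card R) - 1)"
proof -
  have "{} \<in> rank_chains n R"
    by (simp add: rank_chains_def)
  then show ?thesis
    using card_facet_rank_chains[OF assms] abs_complex_rank_chains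
    by (auto simp: pure_of_dim_def face_dim_def)
qed

text \<open>
  When \<open>F\<close> is the facet of a permutation that increases on each block, the chain descents are the
  initial segments that end at a descent of the permutation.
\<close>

definition chain_descents :: "nat \<Rightarrow> nat set set \<Rightarrow> nat set set" where
  "chain_descents n F = {S \<in> F. \<exists>x\<in>S. \<exists>y\<in>{1..n} - S. y < x \<and>
     (\<forall>U\<in>F. U \<subset> S \<longrightarrow> x \<notin> U) \<and> (\<forall>U\<in>F. S \<subset> U \<longrightarrow> y \<in> U)}"

definition chain_weight :: "nat set set \<Rightarrow> nat" where
  "chain_weight F = (\<Sum>S\<in>F. \<Sum>S)"

text \<open>Walk upwards from the block of \<open>x\<close>. If its end \<open>S\<close> is no
  descent by way of \<open>x\<close>, then the next block lies entirely above \<open>x\<close>, so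
  it does not contain \<open>y\<close>, and any \<open>z\<close> in it can replace \<open>x\<close>.
  The number of members that separate \<open>x\<close> from \<open>y\<close> drops at each move, and
  a member that contains \<open>z\<close> also contains the old \<open>x\<close>.\<close>

lemma chain_descent_separates:
  assumes F: "F \<in> rank_chains n R" and "S \<in> F" "x \<in> S" "y \<in> {1..n} - S" "y < x"
  shows "\<exists>U\<in>chain_descents n F. x \<in> U \<and> y \<notin> U"
  using assms(2-)
proof (induction "card {U\<in>F. x \<in> U \<and> y \<notin> U}" arbitrary: S x rule: less_induct)
  case (less x S0)
  note fin = finite_rank_chain[OF F]
  have chain: "S \<subseteq> T \<or> T \<subseteq> S" if "S \<in> F" "T \<in> F" for S T
    using rank_chainsD[OF F] that by blast
  have "finite {U\<in>F. x \<in> U \<and> y \<notin> U}" "{U\<in>F. x \<in> U \<and> y \<notin> U} \<noteq> {}"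
    using less.prems fin by auto
  from finite_has_minimal[OF this]
  \<comment> \<open>Minimality makes \<open>S\<close> the end of the block that contains
    \<open>x\<close>.\<close>
  obtain S where S: "S \<in> F" "x \<in> S" "y \<notin> S" and "\<forall>U\<in>{U\<in>F. x \<in> U \<and> y \<notin> U}. U \<subseteq> S \<longrightarrow> S = U"
    by blast
  then have S_min: "\<forall>U\<in>F. U \<subset> S \<longrightarrow> x \<notin> U"
    by blast
  show ?case
  proof (cases "S \<in> chain_descents n F")
    case True
    then show ?thesis
      using S by blast
  next
    case False
    \<comment> \<open>The conditions on \<open>z\<close> say that it lies in the block after
      \<open>S\<close>, which is the last block if \<open>S\<close> is the largest member.\<close>
    have no_desc: "x < z" if "z \<in> {1..n} - S" "\<forall>U\<in>F. S \<subset> U \<longrightarrow> z \<in> U" for z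
    proof -
      have "\<not> z < x"
      proof
        assume "z < x"
        then have "S \<in> chain_descents n F"
          unfolding chain_descents_def using S(1,2) S_min that by blast
        with False show False ..
      qed
      moreover have "z \<noteq> x"
        using that(1) S(2) by auto
      ultimately show ?thesis
        by simp
    qed
    have y: "y \<in> {1..n} - S"
      using less.prems S(3) by auto
    have "\<not> (\<forall>U\<in>F. S \<subset> U \<longrightarrow> y \<in> U)"
      using no_desc[OF y] less.prems(4) by auto
    then have "finite {U\<in>F. S \<subset> U}" "{U\<in>F. S \<subset> U} \<noteq> {}"
      using fin by auto
    from finite_has_minimal[OF this]
    obtain T where T: "T \<in> F" "S \<subset> T" and T_min: "\<forall>U\<in>{U\<in>F. S \<subset> U}. U \<subseteq> T \<longrightarrow> T = U"
      by blast
    have T_le: "T \<subseteq> U" if "U \<in> F" "S \<subset> U" for U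
      using T_min that chain[OF T(1) that(1)] by blast
    obtain z where z: "z \<in> T" "z \<notin> S"
      using T(2) by blast
    have "z \<in> {1..n} - S"
      using rank_chainsD(1)[OF F T(1)] z by blast
    then have xz: "x < z"
      using no_desc z(1) T_le by blast
    have yT: "y \<notin> T"
      using no_desc[OF y] less.prems(4) T_le by fastforce
    \<comment> \<open>Every member that contains \<open>z\<close> contains \<open>S\<close>, hence
      \<open>x\<close>; the inclusion is strict because \<open>S\<close> itself misses
      \<open>z\<close>.\<close>
    have "{U\<in>F. z \<in> U \<and> y \<notin> U} \<subset> {U\<in>F. x \<in> U \<and> y \<notin> U}"
    proof
      show "{U\<in>F. z \<in> U \<and> y \<notin> U} \<subseteq> {U\<in>F. x \<in> U \<and> y \<notin> U}"
        using chain S(1,2) z(2) by blast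
      show "{U\<in>F. z \<in> U \<and> y \<notin> U} \<noteq> {U\<in>F. x \<in> U \<and> y \<notin> U}"
        using S z(2) by blast
    qed
    then have "card {U\<in>F. z \<in> U \<and> y \<notin> U} < card {U\<in>F. x \<in> U \<and> y \<notin> U}"
      using fin(1) by (intro psubset_card_mono) auto
    then obtain U where U: "U \<in> chain_descents n F" "z \<in> U" "y \<notin> U"
      using less.hyps[of z T] T(1) z(1) yT y xz less.prems(4) by auto
    then have "U \<in> F"
      by (simp add: chain_descents_def)
    then have "x \<in> U"
      using chain[OF S(1)] S(2) z(2) U(2) by blast
    then show ?thesis
      using U by blast
  qed
qed

text \<open>The common part cancels, and the two differences have equal size, so a bijection
  compares them term by term.\<close>

lemma sum_less_sum_if_diff_less:
  fixes S T :: "nat set"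
  assumes fin: "finite S" "finite T" and card: "card S = card T" and ne: "S \<noteq> T"
    and less: "\<And>x y. \<lbrakk>x \<in> S - T; y \<in> T - S\<rbrakk> \<Longrightarrow> x < y"
  shows "\<Sum>S < \<Sum>T"
proof -
  have "card (S - T) = card (T - S)"
    using fin card card_Diff_subset_Int[of S T] card_Diff_subset_Int[of T S] by (simp add: Int_commute)
  then obtain f where f: "bij_betw f (S - T) (T - S)"
    using fin finite_same_card_bij[of "S - T" "T - S"] by auto
  have "S - T \<noteq> {}"
    using card_subset_eq[OF fin(2), of S] card ne by blast
  then have "\<Sum>(S - T) < sum f (S - T)"
    using fin f less by (intro sum_strict_mono) (auto simp: bij_betw_def)
  also have "sum f (S - T) = \<Sum>(T - S)"
    using sum.reindex_bij_betw[OF f, of "\<lambda>x. x"] by simp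
  finally show ?thesis
    using sum.Int_Diff[of S "\<lambda>x. x" T] sum.Int_Diff[of T "\<lambda>x. x" S] fin by (simp add: Int_commute)
qed

text \<open>Compare the members of equal rank. If \<open>x\<close> belongs only to the member of
  \<open>F\<close> and a smaller \<open>y\<close> only to that of \<open>G\<close>, then a descent
  of \<open>F\<close> contains \<open>x\<close> and misses \<open>y\<close>. It is a member of
  \<open>G\<close> too, but it cannot be comparable with the member of \<open>G\<close> at this
  rank. So in every rank where the chains differ, \<open>F\<close> has the smaller sum.\<close>

lemma chain_weight_ascend:
  assumes R: "R \<subseteq> {1..<n}" and F: "F \<in> facets (rank_chains n R)" and G: "G \<in> facets (rank_chains n R)"
    and sub: "chain_descents n F \<subseteq> G" and ne: "F \<noteq> G"
  shows "chain_weight F < chain_weight G"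
proof -
  have F': "F \<in> rank_chains n R" "card ` F = R" and G': "G \<in> rank_chains n R" "card ` G = R"
    using F G unfolding facets_rank_chains[OF R] by auto
  have bF: "bij_betw card F R" and bG: "bij_betw card G R"
    using F' G' rank_chains_inj_on_card by (auto simp: bij_betw_def)
  define f where "f = the_inv_into F card"
  define g where "g = the_inv_into G card"
  have f: "bij_betw f R F" and g: "bij_betw g R G"
    unfolding f_def g_def using bF bG by (auto intro: bij_betw_the_inv_into)
  have fg: "card (f r) = r" "card (g r) = r" "f r \<in> F" "g r \<in> G" if "r \<in> R" for r
    using that bF bG f g unfolding f_def g_def
    by (auto simp: f_the_inv_into_f_bij_betw bij_betw_def)
  have lt: "\<Sum>(f r) < \<Sum>(g r)" if r: "r \<in> R" "f r \<noteq> g r" for r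
  proof (rule sum_less_sum_if_diff_less)
    show "finite (f r)" "finite (g r)" "card (f r) = card (g r)" "f r \<noteq> g r"
      using fg[OF r(1)] r(2) F'(1) G'(1) finite_rank_chain(2) by auto
    fix x y assume x: "x \<in> f r - g r" and y: "y \<in> g r - f r"
    show "x < y"
    proof (rule ccontr)
      assume "\<not> x < y"
      then have "y < x"
        using x y by (metis DiffE linorder_neqE_nat)
      moreover have "y \<in> {1..n} - f r"
        using rank_chainsD(1)[OF G'(1) fg(4)[OF r(1)]] y by blast
      ultimately obtain U where U: "U \<in> chain_descents n F" "x \<in> U" "y \<notin> U"
        using chain_descent_separates[OF F'(1) fg(3)[OF r(1)]] x by blast
      then have "U \<subseteq> g r \<or> g r \<subseteq> U"
        using rank_chainsD(3)[OF G'(1)] fg(4)[OF r(1)] sub by blast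
      then show False
        using U x y by blast
    qed
  qed
  have "\<exists>r\<in>R. f r \<noteq> g r"
    using ne f g by (metis bij_betw_imp_surj_on image_cong)
  then have "\<exists>r\<in>R. \<Sum>(f r) < \<Sum>(g r)"
    using lt by blast
  moreover have "\<forall>r\<in>R. \<Sum>(f r) \<le> \<Sum>(g r)"
    using lt by (metis less_imp_le order_refl)
  moreover have "finite R"
    using finite_subset[OF R] by simp
  ultimately have "(\<Sum>r\<in>R. \<Sum>(f r)) < (\<Sum>r\<in>R. \<Sum>(g r))"
    by (intro sum_strict_mono_ex1)
  also have "(\<Sum>r\<in>R. \<Sum>(g r)) = chain_weight G"
    unfolding chain_weight_def by (rule sum.reindex_bij_betw[OF g])
  also have "(\<Sum>r\<in>R. \<Sum>(f r)) = chain_weight F"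
    unfolding chain_weight_def by (rule sum.reindex_bij_betw[OF f])
  finally show ?thesis .
qed

lemma chain_weight_descend:
  assumes R: "R \<subseteq> {1..<n}" and F: "F \<in> facets (rank_chains n R)" and S: "S \<in> chain_descents n F"
  shows "\<exists>G\<in>facets (rank_chains n R). F - {S} \<subseteq> G \<and> chain_weight G < chain_weight F"
proof -
  have F': "F \<in> rank_chains n R" "card ` F = R"
    using F unfolding facets_rank_chains[OF R] by auto
  obtain x y where SF: "S \<in> F" and xy: "x \<in> S" "y \<in> {1..n} - S" "y < x"
    and x: "\<forall>U\<in>F. U \<subset> S \<longrightarrow> x \<notin> U" and y: "\<forall>U\<in>F. S \<subset> U \<longrightarrow> y \<in> U"
    using S by (auto simp: chain_descents_def)
  note fin = finite_rank_chain[OF F'(1)]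
  \<comment> \<open>Exchanging \<open>x\<close> for \<open>y\<close> keeps the rank. It also keeps
    comparability, since \<open>x\<close> lies in no smaller member and \<open>y\<close> in every
    larger one.\<close>
  define T where "T = insert y (S - {x})"
  define G where "G = insert T (F - {S})"
  have card_T: "card T = card S"
    using xy card.remove[OF fin(2)[OF SF] xy(1)] fin(2)[OF SF] by (simp add: T_def)
  have cmp: "U \<subseteq> T \<or> T \<subseteq> U" if "U \<in> F" "U \<noteq> S" for U
  proof -
    have "U \<subset> S \<or> S \<subset> U"
      using rank_chainsD(3)[OF F'(1) SF that(1)] that(2) by blast
    then show ?thesis
      using x y that(1) by (auto simp: T_def)
  qed
  have "T \<subseteq> {1..n}" "card T \<in> R"
    using F' SF xy(2) card_T by (auto simp: T_def rank_chains_def)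
  then have "G \<in> rank_chains n R"
    using F'(1) cmp by (auto simp: rank_chains_def G_def)
  moreover have "card ` G = R"
    using F'(2) SF card_T by (force simp: G_def)
  ultimately have G: "G \<in> facets (rank_chains n R)"
    by (simp add: facets_rank_chains[OF R])
  have "T \<notin> F - {S}"
    using rank_chains_inj_on_card[OF F'(1)] card_T SF by (auto dest: inj_onD)
  then have "chain_weight G = \<Sum>T + chain_weight (F - {S})"
    using fin by (simp add: G_def chain_weight_def)
  also have "\<Sum>T < \<Sum>S"
    using xy sum.remove[OF fin(2)[OF SF] xy(1), of "\<lambda>x. x"] fin(2)[OF SF] by (simp add: T_def)
  then have "\<Sum>T + chain_weight (F - {S}) < \<Sum>S + chain_weight (F - {S})"
    by simp
  also have "\<dots> = chain_weight F"
    unfolding chain_weight_def by (rule sum.remove[OF fin(1) SF, symmetric])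
  finally have "chain_weight G < chain_weight F" .
  moreover have "F - {S} \<subseteq> G"
    by (auto simp: G_def)
  ultimately show ?thesis
    using G by blast
qed

section \<open>Compositions and ordered set partitions\<close>

text \<open>The sums \<open>0\<close> and \<open>sum_list c\<close> are left out: what remains is
  the set of ranks of possible vertices, and also the descent set that a permutation with descent
  composition \<open>c\<close> must have.\<close>

definition partial_sums :: "nat list \<Rightarrow> nat set" where
  "partial_sums c = {sum_list (take i c) | i. 0 < i \<and> i < length c}"

lemma composition_pos:
  assumes "composition n c"
  shows "c \<noteq> []" "\<forall>x\<in>set c. 0 < x" "sum_list c = n"
proof -
  show c: "c \<noteq> []" and "sum_list c = n"
    using assms by (simp_all add: composition_def pointed_composition_def)
  have "set c = insert (last c) (set (butlast c))"
    using c by (metis append_butlast_last_id list.simps(15) rotate1.simps(2) set_rotate1)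
  then show "\<forall>x\<in>set c. 0 < x"
    using assms by (auto simp: composition_def pointed_composition_def Suc_le_eq)
qed

lemma sum_take_less:
  fixes c :: "nat list"
  assumes "\<forall>x\<in>set c. 0 < x" "i < j" "j \<le> length c"
  shows "sum_list (take i c) < sum_list (take j c)"
proof -
  have "c ! i > 0"
    using assms by simp
  then have "sum_list (take i c) < sum_list (take (Suc i) c)"
    using assms by (simp add: take_Suc_conv_app_nth)
  also have "take j c = take (Suc i) c @ take (j - Suc i) (drop (Suc i) c)"
    using assms(2) by (metis Suc_leI le_add_diff_inverse take_add)
  then have "sum_list (take (Suc i) c) \<le> sum_list (take j c)"
    by simp
  finally show ?thesis .
qed

lemma sum_take_inj:
  fixes c :: "nat list"
  assumes "\<forall>x\<in>set c. 0 < x"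
  shows "inj_on (\<lambda>i. sum_list (take i c)) {..length c}"
proof (rule linorder_inj_onI)
  fix i j assume "i < j" "j \<in> {..length c}"
  then show "sum_list (take i c) \<noteq> sum_list (take j c)"
    using sum_take_less[OF assms, of i j] by simp
qed auto

lemma partial_sums_subset:
  assumes "composition n c"
  shows "partial_sums c \<subseteq> {1..<n}"
proof
  fix r assume "r \<in> partial_sums c"
  then obtain i where "r = sum_list (take i c)" "0 < i" "i < length c"
    by (auto simp: partial_sums_def)
  then show "r \<in> {1..<n}"
    using sum_take_less[of c 0 i] sum_take_less[of c i "length c"] composition_pos[OF assms] by auto
qed

lemma card_partial_sums:
  assumes "composition n c"
  shows "card (partial_sums c) = length c - 1"
proof -
  have "partial_sums c = (\<lambda>i. sum_list (take i c)) ` {1..<length c}"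
    by (auto simp: partial_sums_def Suc_le_eq)
  moreover have "inj_on (\<lambda>i. sum_list (take i c)) {1..<length c}"
    by (rule inj_on_subset[OF sum_take_inj[OF composition_pos(2)[OF assms]]]) auto
  ultimately show ?thesis
    by (simp add: card_image)
qed

lemma sum_list_map_sum_list:
  "sum_list (map sum_list xss) = sum_list (concat xss :: nat list)"
  by (induction xss) simp_all

text \<open>A cut between two runs is a cut of \<open>c\<close>; it is a proper one because the runs
  on either side are nonempty.\<close>

lemma comp_le_imp_partial_sums:
  assumes "comp_le c d"
  shows "partial_sums d \<subseteq> partial_sums c"
proof
  fix r assume "r \<in> partial_sums d"
  then obtain i where i: "r = sum_list (take i d)" "0 < i" "i < length d"
    by (auto simp: partial_sums_def)
  obtain runs where runs: "[] \<notin> set runs" "c = concat runs" "d = map sum_list runs"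
    using assms by (auto simp: comp_le_def)
  define l where "l = length (concat (take i runs))"
  have c: "c = concat (take i runs) @ concat (drop i runs)"
    using runs(2) by (metis append_take_drop_id concat_append)
  then have "take l c = concat (take i runs)"
    by (simp add: l_def)
  then have "r = sum_list (take l c)"
    using i(1) runs(3) by (simp add: take_map sum_list_map_sum_list)
  moreover have "concat (take i runs) \<noteq> []" "concat (drop i runs) \<noteq> []"
  proof -
    have len: "i < length runs"
      using i(3) runs(3) by simp
    have "runs ! 0 \<in> set (take i runs)" "runs ! i \<in> set (drop i runs)"
      using i(2) len by (auto simp: in_set_conv_nth intro: exI[of _ 0])
    moreover have "runs ! 0 \<noteq> []" "runs ! i \<noteq> []"
      using runs(1) len by (metis nth_mem gr_implies_not0 gr0I)+
    ultimately show "concat (take i runs) \<noteq> []" "concat (drop i runs) \<noteq> []"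
      by auto
  qed
  moreover have "length c = l + length (concat (drop i runs))"
    unfolding l_def using c by (metis length_append)
  ultimately have "r = sum_list (take l c)" "0 < l" "l < length c"
    by (simp_all add: l_def)
  then show "r \<in> partial_sums c"
    by (auto simp: partial_sums_def)
qed

text \<open>The first part \<open>a\<close> of \<open>d\<close> is the sum of an initial stretch of
  \<open>c\<close>, which becomes the first run. Subtracting \<open>a\<close> from the later partial
  sums gives the same situation for the rest of \<open>c\<close> and \<open>d\<close>.\<close>

lemma partial_sums_imp_comp_le:
  assumes "\<forall>x\<in>set c. 0 < x" "\<forall>x\<in>set d. 0 < x" "d \<noteq> []" "sum_list c = sum_list d"
    "partial_sums d \<subseteq> partial_sums c"
  shows "comp_le c d"
  using assms
proof (induction d arbitrary: c)
  case (Cons a d)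
  show ?case
  proof (cases "d = []")
    case True
    then have "c \<noteq> []" "sum_list c = a"
      using Cons.prems by auto
    then show ?thesis
      unfolding comp_le_def using True by (intro exI[of _ "[c]"]) auto
  next
    case False
    have "a \<in> partial_sums (a # d)"
      unfolding partial_sums_def using False by (auto intro!: exI[of _ 1])
    then obtain j where j: "a = sum_list (take j c)" "0 < j" "j < length c"
      using Cons.prems(5) by (auto simp: partial_sums_def)
    have c_sum: "sum_list c = a + sum_list (drop j c)"
      using j(1) by (metis append_take_drop_id sum_list_append)
    have "partial_sums d \<subseteq> partial_sums (drop j c)"
    proof
      fix s assume "s \<in> partial_sums d"
      then obtain i where i: "s = sum_list (take i d)" "0 < i" "i < length d"
        by (auto simp: partial_sums_def)
      have "0 < s"
        using sum_take_less[of d 0 i] Cons.prems(2) i by auto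
      have "a + s \<in> partial_sums (a # d)"
        unfolding partial_sums_def using i by (intro CollectI exI[of _ "Suc i"]) auto
      then obtain l where l: "a + s = sum_list (take l c)" "0 < l" "l < length c"
        using Cons.prems(5) by (auto simp: partial_sums_def)
      have "j < l"
      proof (rule ccontr)
        assume "\<not> j < l"
        then have "sum_list (take l c) \<le> sum_list (take j c)"
          using sum_take_less[OF Cons.prems(1), of l j] j(3) by (cases "l = j") auto
        then show False
          using l(1) j(1) \<open>0 < s\<close> by simp
      qed
      then have "take l c = take j c @ take (l - j) (drop j c)"
        by (metis le_add_diff_inverse less_imp_le take_add)
      then have "s = sum_list (take (l - j) (drop j c))"
        using l(1) j(1) by simp
      then show "s \<in> partial_sums (drop j c)"
        unfolding partial_sums_def using \<open>j < l\<close> l(3) by (intro CollectI exI[of _ "l - j"]) auto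
    qed
    then have "comp_le (drop j c) d"
      using Cons.prems False c_sum by (intro Cons.IH) (auto dest: in_set_dropD)
    then obtain runs where runs: "[] \<notin> set runs" "drop j c = concat runs" "d = map sum_list runs"
      by (auto simp: comp_le_def)
    have "[] \<notin> set (take j c # runs)"
      using j(2,3) runs(1) by auto
    moreover have "c = concat (take j c # runs)"
      using runs(2) by (metis append_take_drop_id concat.simps(2))
    moreover have "a # d = map sum_list (take j c # runs)"
      using j(1) runs(3) by simp
    ultimately show ?thesis
      unfolding comp_le_def by (intro exI[of _ "take j c # runs"] conjI)
  qed
qed simp

section \<open>Ordered set partitions as chains\<close>

lemma card_Union_take:
  assumes "disjoint_family_on (\<lambda>i. C ! i) {..<length C}" "\<forall>B\<in>set C. finite B" "m \<le> length C"
  shows "card (\<Union>(set (take m C))) = sum_list (take m (map card C))"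
proof -
  have "set (take m C) = (\<lambda>i. C ! i) ` {..<m}"
    using nth_image[OF assms(3)] by (simp add: atLeast0LessThan)
  then have "card (\<Union>(set (take m C))) = card (\<Union>i<m. C ! i)"
    by simp
  also have "\<dots> = (\<Sum>i<m. card (C ! i))"
    using assms by (intro card_UN_disjoint) (auto simp: disjoint_family_on_def)
  also have "\<dots> = sum_list (take m (map card C))"
    using assms(3) by (simp add: sum_list_sum_nth atLeast0LessThan)
  finally show ?thesis .
qed

text \<open>This turns the order on types into a condition on the cardinalities of the members of
  the chain.\<close>

lemma partial_sums_osp_type:
  assumes "ordered_set_partition n C"
  shows "partial_sums (osp_type C) = card ` osp_chain C"
proof -
  have C: "disjoint_family_on (\<lambda>i. C ! i) {..<length C}" "\<Union>(set C) = {1..n}"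
    using assms by (simp_all add: ordered_set_partition_def)
  then have "\<forall>B\<in>set C. finite B"
    by (metis Sup_upper finite_atLeastAtMost finite_subset)
  then have sums: "sum_list (take i (osp_type C)) = card (\<Union>(set (take i C)))" if "i < length C" for i
    using card_Union_take[OF C(1), of i] that by (simp add: osp_type_def)
  have "partial_sums (osp_type C) = (\<lambda>i. sum_list (take i (osp_type C))) ` {i. 0 < i \<and> i < length C}"
    by (simp add: partial_sums_def osp_type_def setcompr_eq_image)
  also have "\<dots> = (\<lambda>i. card (\<Union>(set (take i C)))) ` {i. 0 < i \<and> i < length C}"
    by (rule image_cong[OF refl]) (simp add: sums)
  also have "\<dots> = card ` osp_chain C"
    by (simp add: osp_chain_def setcompr_eq_image image_image)
  finally show ?thesis .
qed

lemma osp_chain_snoc: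
  assumes "C \<noteq> []"
  shows "osp_chain (C @ [B]) = insert (\<Union>(set C)) (osp_chain C)"
proof (intro equalityI subsetI)
  fix S assume "S \<in> osp_chain (C @ [B])"
  then obtain i where i: "S = \<Union>(set (take i (C @ [B])))" "0 < i" "i \<le> length C"
    by (auto simp: osp_chain_def)
  then show "S \<in> insert (\<Union>(set C)) (osp_chain C)"
    by (cases "i = length C") (auto simp: osp_chain_def)
next
  fix S assume "S \<in> insert (\<Union>(set C)) (osp_chain C)"
  then consider "S = \<Union>(set C)" | i where "S = \<Union>(set (take i C))" "0 < i" "i < length C"
    by (auto simp: osp_chain_def)
  then show "S \<in> osp_chain (C @ [B])"
  proof cases
    case 1
    then show ?thesis
      unfolding osp_chain_def using assms by (intro CollectI exI[of _ "length C"]) auto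
  next
    case 2
    then show ?thesis
      unfolding osp_chain_def by (intro CollectI exI[of _ i]) auto
  qed
qed

text \<open>The last block is the complement of the largest member \<open>S\<close>, and the other
  members form a chain inside \<open>S\<close>. The ground set \<open>A\<close> is kept arbitrary so
  that it can shrink to \<open>S\<close> in the induction.\<close>

lemma chain_obtain_blocks:
  assumes "finite F" "A \<noteq> {}" "\<And>S. S \<in> F \<Longrightarrow> S \<noteq> {} \<and> S \<subset> A"
    "\<And>S T. \<lbrakk>S \<in> F; T \<in> F\<rbrakk> \<Longrightarrow> S \<subseteq> T \<or> T \<subseteq> S"
  shows "\<exists>C. C \<noteq> [] \<and> {} \<notin> set C \<and> disjoint_family_on (\<lambda>i. C ! i) {..<length C} \<and>
    \<Union>(set C) = A \<and> osp_chain C = F"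
  using assms
proof (induction "card F" arbitrary: F A)
  case 0
  then show ?case
    by (intro exI[of _ "[A]"]) (auto simp: osp_chain_def disjoint_family_on_def)
next
  case (Suc k)
  have "F \<noteq> {}"
    using Suc.hyps(2) by auto
  from finite_has_maximal[OF Suc.prems(1) this]
  obtain S where S: "S \<in> F" and S_max: "\<forall>T\<in>F. S \<subseteq> T \<longrightarrow> S = T"
    by blast
  have "k = card (F - {S})"
    using Suc.hyps(2) Suc.prems(1) S by simp
  moreover have "T \<noteq> {} \<and> T \<subset> S" if "T \<in> F - {S}" for T
    using that S S_max Suc.prems(3)[of T] Suc.prems(4)[of S T] by auto
  moreover have "finite (F - {S})" "S \<noteq> {}"
    using Suc.prems S by auto
  moreover have "T \<subseteq> U \<or> U \<subseteq> T" if "T \<in> F - {S}" "U \<in> F - {S}" for T U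
    using that Suc.prems(4) by simp
  ultimately obtain C where C: "C \<noteq> []" "{} \<notin> set C" "\<Union>(set C) = S" "osp_chain C = F - {S}"
    and disj: "disjoint_family_on (\<lambda>i. C ! i) {..<length C}"
    using Suc.hyps(1)[of "F - {S}" S] by blast
  have "A - S \<noteq> {}" "S \<union> (A - S) = A"
    using Suc.prems(3)[OF S] by auto
  moreover have "disjoint_family_on (\<lambda>i. (C @ [A - S]) ! i) {..<length (C @ [A - S])}"
  proof -
    have "C ! i \<subseteq> S" if "i < length C" for i
      using C(3) that nth_mem by blast
    then show ?thesis
      using disj by (fastforce simp: disjoint_family_on_def nth_append less_Suc_eq)
  qed
  moreover have "osp_chain (C @ [A - S]) = F"
    using osp_chain_snoc[OF C(1)] C(3,4) S by auto
  ultimately show ?case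
    using C(1-3) by (intro exI[of _ "C @ [A - S]"]) auto
qed

text \<open>For positive parts, \<open>comp_le\<close> is reverse inclusion of the sets of partial
  sums, and those of a type are the cardinalities in the chain. No empty last block is needed,
  because all ranks lie strictly between \<open>0\<close> and \<open>n\<close>.\<close>

lemma Delta_comp_eq_rank_chains:
  assumes "composition n c"
  shows "Delta_comp n c = rank_chains n (partial_sums c)"
proof (intro equalityI subsetI)
  fix F assume "F \<in> Delta_comp n c"
  then obtain C where C: "ordered_set_partition n C" "comp_le c (osp_type C)" "F = osp_chain C"
    by (auto simp: Delta_comp_def)
  have ranks: "card ` F \<subseteq> partial_sums c"
    using comp_le_imp_partial_sums[OF C(2)] partial_sums_osp_type[OF C(1)] C(3) by simp
  have initial: "\<exists>i. S = \<Union>(set (take i C))" if "S \<in> F" for S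
    using that unfolding C(3) osp_chain_def by blast
  have "S \<subseteq> {1..n}" if "S \<in> F" for S
  proof -
    have "S \<subseteq> \<Union>(set C)"
      using initial[OF that] by (auto dest: in_set_takeD)
    then show ?thesis
      using C(1) by (simp add: ordered_set_partition_def)
  qed
  moreover have "S \<subseteq> T \<or> T \<subseteq> S" if S: "S \<in> F" and T: "T \<in> F" for S T
  proof -
    obtain i j where "S = \<Union>(set (take i C))" "T = \<Union>(set (take j C))"
      using initial[OF S] initial[OF T] by blast
    then show ?thesis
      using set_take_subset_set_take[of i j C] set_take_subset_set_take[of j i C] Union_mono
      by (metis linear)
  qed
  ultimately show "F \<in> rank_chains n (partial_sums c)"
    using ranks
    by (auto simp: rank_chains_def)
next
  fix F assume F: "F \<in> rank_chains n (partial_sums c)"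
  note R = partial_sums_subset[OF assms]
  \<comment> \<open>The empty chain comes from the single block \<open>{1..n}\<close>, which has to
    be nonempty.\<close>
  have "0 < n"
    using composition_pos[OF assms] by (cases c) auto
  then have "{1..n} \<noteq> {}"
    by simp
  moreover have "S \<noteq> {} \<and> S \<subset> {1..n}" if S: "S \<in> F" for S
    using rank_chainsD(1,2)[OF F S] R by fastforce
  ultimately obtain C where C: "C \<noteq> []" "{} \<notin> set C" "disjoint_family_on (\<lambda>i. C ! i) {..<length C}"
    "\<Union>(set C) = {1..n}" and chain: "osp_chain C = F"
    using chain_obtain_blocks[of F "{1..n}"] rank_chainsD(3)[OF F] finite_rank_chain(1)[OF F] by metis
  have osp: "ordered_set_partition n C"
    using C by (auto simp: ordered_set_partition_def dest: in_set_butlastD)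
  have fin: "\<forall>B\<in>set C. finite B"
    using C(4) by (metis Sup_upper finite_atLeastAtMost finite_subset)
  have "comp_le c (osp_type C)"
  proof (rule partial_sums_imp_comp_le)
    show "\<forall>x\<in>set c. 0 < x"
      using composition_pos[OF assms] by blast
    show "\<forall>x\<in>set (osp_type C). 0 < x" "osp_type C \<noteq> []"
      using C fin by (auto simp: osp_type_def card_gt_0_iff)
    show "sum_list c = sum_list (osp_type C)"
      using card_Union_take[OF C(3) fin order_refl] C(4) composition_pos(3)[OF assms]
      by (simp add: osp_type_def)
    show "partial_sums (osp_type C) \<subseteq> partial_sums c"
      using partial_sums_osp_type[OF osp] chain rank_chainsD(2)[OF F] by auto
  qed
  then show "F \<in> Delta_comp n c"
    using osp chain by (auto simp: Delta_comp_def)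
qed

text \<open>The blocks are images of consecutive intervals of positions, so their unions telescope
  to images of initial segments.\<close>

lemma osp_chain_perm_osp:
  "osp_chain (perm_osp \<alpha> c) = (\<lambda>r. \<alpha> ` {1..r}) ` partial_sums c"
proof -
  have U: "\<Union>(set (take i (perm_osp \<alpha> c))) = \<alpha> ` {1..sum_list (take i c)}" if "i \<le> length c" for i
    using that
  proof (induction i)
    case (Suc i)
    let ?p = "\<lambda>i. sum_list (take i c)"
    have "?p i \<le> ?p (Suc i)"
      using Suc.prems by (simp add: take_Suc_conv_app_nth)
    then have "{1..?p (Suc i)} = {1..?p i} \<union> {?p i + 1..?p (Suc i)}"
      by auto
    moreover have "take (Suc i) (perm_osp \<alpha> c) = take i (perm_osp \<alpha> c) @ [\<alpha> ` {?p i + 1..?p (Suc i)}]"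
      using Suc.prems by (subst take_Suc_conv_app_nth) (auto simp: perm_osp_def)
    ultimately show ?case
      using Suc by (simp add: image_Un Un_commute)
  qed simp
  have len: "length (perm_osp \<alpha> c) = length c"
    by (simp add: perm_osp_def)
  have "osp_chain (perm_osp \<alpha> c) =
      (\<lambda>i. \<Union>(set (take i (perm_osp \<alpha> c)))) ` {i. 0 < i \<and> i < length c}"
    by (simp only: osp_chain_def len setcompr_eq_image)
  also have "\<dots> = (\<lambda>i. \<alpha> ` {1..sum_list (take i c)}) ` {i. 0 < i \<and> i < length c}"
    by (rule image_cong[OF refl]) (simp add: U)
  finally show ?thesis
    unfolding partial_sums_def setcompr_eq_image image_image .
qed

section \<open>Descent compositions and descent sets\<close>

lemma descent_composition_eq_iff:
  assumes c: "composition n c"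
  shows "descent_composition n \<alpha> = c \<longleftrightarrow> descent_set n \<alpha> = partial_sums c"
proof -
  define s where "s = sorted_list_of_set (descent_set n \<alpha>)"
  define P where "P i = sum_list (take i c)" for i
  have D: "descent_set n \<alpha> \<subseteq> {1..<n}"
    by (auto simp: descent_set_def)
  then have fin: "finite (descent_set n \<alpha>)"
    using finite_subset by blast
  then have s: "sorted s" "distinct s" "set s = descent_set n \<alpha>"
    by (simp_all add: s_def)
  have dc: "descent_composition n \<alpha> = map2 (-) (s @ [n]) (0 # s)"
    by (simp add: descent_composition_def s_def Let_def)
  have len: "length (descent_composition n \<alpha>) = Suc (length s)"
    by (simp add: dc)
  have dc_nth: "descent_composition n \<alpha> ! i = (s @ [n]) ! i - (0 # s) ! i" if "i \<le> length s" for i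
    using that by (simp add: dc)
  have P_Suc: "P (Suc i) = P i + c ! i" if "i < length c" for i
    using that by (simp add: P_def take_Suc_conv_app_nth)
  show ?thesis
  proof
    assume eq: "descent_composition n \<alpha> = c"
    have "sorted (0 # s @ [n])"
      using s D by (auto simp: sorted_append)
    \<comment> \<open>Subtraction on \<open>nat\<close> truncates; monotonicity of the extended list
      guarantees that adding a difference back recovers the next entry.\<close>
    then have le: "(0 # s) ! i \<le> (s @ [n]) ! i" if "i \<le> length s" for i
      using sorted_nth_mono[of "0 # s @ [n]" i "Suc i"] that by (auto simp: nth_append nth_Cons split: nat.splits)
    have "P i = (0 # s @ [n]) ! i" if "i \<le> Suc (length s)" for i
      using that
    proof (induction i)
      case (Suc i)
      then have "i < length c"
        using len eq by simp
      have "(0 # s @ [n]) ! i = (0 # s) ! i"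
        using Suc.prems by (auto simp: nth_append nth_Cons split: nat.splits)
      then show ?case
        using Suc P_Suc[OF \<open>i < length c\<close>] dc_nth[of i] eq le[of i] by simp
    qed (simp add: P_def)
    then have P_s: "P (Suc i) = s ! i" if "i < length s" for i
      using that by (simp add: nth_append)
    have "partial_sums c = P ` Suc ` {..<length s}"
      unfolding image_Suc_lessThan partial_sums_def P_def[symmetric] setcompr_eq_image
      using len eq by (intro arg_cong[of _ _ "(`) P"]) auto
    also have "\<dots> = (\<lambda>i. s ! i) ` {..<length s}"
      unfolding image_image by (rule image_cong[OF refl]) (simp add: P_s)
    also have "\<dots> = descent_set n \<alpha>"
      unfolding s(3)[symmetric] by (auto simp: set_conv_nth)
    finally show "descent_set n \<alpha> = partial_sums c"
      by (rule sym)
  next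
    assume eq: "descent_set n \<alpha> = partial_sums c"
    \<comment> \<open>\<open>t\<close> lists the partial sums of \<open>c\<close> in increasing
      order; it equals \<open>s\<close> since both are strictly sorted with the same
      elements.\<close>
    define t where "t = map (\<lambda>i. P (Suc i)) [0..<length c - 1]"
    have P_less: "P i < P j" if "i < j" "j \<le> length c" for i j
      using sum_take_less[OF composition_pos(2)[OF c] that] by (simp add: P_def)
    have "sorted_wrt (<) t"
      unfolding t_def sorted_wrt_map by (rule sorted_wrt_mono_rel[OF _ sorted_wrt_upt]) (auto intro!: P_less)
    moreover have "set t = partial_sums c"
    proof -
      have "{i. 0 < i \<and> i < length c} = Suc ` {..<length c - 1}"
        unfolding image_Suc_lessThan by auto
      then have "partial_sums c = P ` Suc ` {..<length c - 1}"
        by (simp add: partial_sums_def P_def setcompr_eq_image)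
      then show ?thesis
        by (simp add: t_def image_image atLeast0LessThan)
    qed
    ultimately have "s = t"
      using s eq by (intro sorted_distinct_set_unique) (simp_all add: strict_sorted_iff)
    have c0: "length c = Suc (length s)"
      using composition_pos(1)[OF c] by (simp add: \<open>s = t\<close> t_def)
    have s_nth: "s ! i = P (Suc i)" if "i < length s" for i
      using that by (simp add: \<open>s = t\<close> t_def)
    have "P (length c) = n"
      using composition_pos(3)[OF c] by (simp add: P_def)
    show "descent_composition n \<alpha> = c"
    proof (rule nth_equalityI)
      show "length (descent_composition n \<alpha>) = length c"
        using len c0 by simp
      fix i assume "i < length (descent_composition n \<alpha>)"
      then have i: "i \<le> length s" "i < length c"
        using len c0 by auto
      have "(s @ [n]) ! i = P (Suc i)"
        using i s_nth[of i] c0 \<open>P (length c) = n\<close> by (cases "i = length s") (auto simp: nth_append)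
      moreover have "(0 # s) ! i = P i"
        using i s_nth by (cases i) (auto simp: P_def)
      ultimately show "descent_composition n \<alpha> ! i = c ! i"
        using dc_nth[OF i(1)] P_Suc[OF i(2)] by simp
    qed
  qed
qed

section \<open>Permutations and chains all of whose members are descents\<close>

lemma sorting_permutation_exists:
  fixes K :: "nat \<Rightarrow> nat"
  assumes "inj_on K {1..n}"
  obtains \<alpha> where "\<alpha> permutes {1..n}" "\<And>i j. \<lbrakk>1 \<le> i; i < j; j \<le> n\<rbrakk> \<Longrightarrow> K (\<alpha> i) < K (\<alpha> j)"
proof -
  define xs where "xs = sort_key K [1..<Suc n]"
  have xs: "set xs = {1..n}" "distinct xs" "length xs = n"
    by (auto simp: xs_def)
  have "sorted (map K xs)"
    by (simp add: xs_def)
  moreover have "distinct (map K xs)"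
    using xs assms by (simp add: distinct_map)
  ultimately have less: "sorted_wrt (<) (map K xs)"
    by (simp add: strict_sorted_iff)
  \<comment> \<open>List positions start at \<open>0\<close> and permuted positions at
    \<open>1\<close>; \<open>permutes\<close> requires the identity outside
    \<open>{1..n}\<close>.\<close>
  define \<alpha> where "\<alpha> i = (if i \<in> {1..n} then xs ! (i - 1) else i)" for i
  have "bij_betw (\<lambda>i. xs ! (i - 1)) {1..n} {1..n}"
  proof (rule bij_betw_trans[unfolded o_def, of "\<lambda>i. i - 1" _ "{..<n}" "\<lambda>i. xs ! i"])
    show "bij_betw (\<lambda>i. i - 1) {1..n} {..<n}"
      by (rule bij_betw_byWitness[of _ Suc]) auto
    show "bij_betw (\<lambda>i. xs ! i) {..<n} {1..n}"
      using bij_betw_nth[OF xs(2), of "{..<n}" "{1..n}"] xs by simp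
  qed
  then have "bij_betw \<alpha> {1..n} {1..n}"
    by (rule bij_betw_cong[THEN iffD1, rotated]) (simp add: \<alpha>_def)
  then have "\<alpha> permutes {1..n}"
    by (rule bij_imp_permutes) (auto simp: \<alpha>_def)
  moreover have "K (\<alpha> i) < K (\<alpha> j)" if "1 \<le> i" "i < j" "j \<le> n" for i j
    using sorted_wrt_nth_less[OF less, of "i - 1" "j - 1"] that xs(3) by (simp add: \<alpha>_def)
  ultimately show thesis
    by (rule that)
qed

text \<open>Increase at neighbouring positions already makes the list of keys strictly sorted. Its
  set of entries does not depend on the permutation, so neither does the list.\<close>

lemma sorting_permutation_unique:
  fixes K :: "nat \<Rightarrow> nat"
  assumes K: "inj_on K {1..n}" and \<alpha>: "\<alpha> permutes {1..n}" and \<beta>: "\<beta> permutes {1..n}"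
    and K\<alpha>: "\<And>i. \<lbrakk>1 \<le> i; i < n\<rbrakk> \<Longrightarrow> K (\<alpha> i) < K (\<alpha> (Suc i))"
    and K\<beta>: "\<And>i. \<lbrakk>1 \<le> i; i < n\<rbrakk> \<Longrightarrow> K (\<beta> i) < K (\<beta> (Suc i))"
  shows "\<alpha> = \<beta>"
proof -
  define L where "L \<gamma> = map (\<lambda>i. K (\<gamma> i)) [1..<Suc n]" for \<gamma> :: "nat \<Rightarrow> nat"
  have sorted: "sorted_wrt (<) (L \<gamma>)"
    if "\<And>i. \<lbrakk>1 \<le> i; i < n\<rbrakk> \<Longrightarrow> K (\<gamma> i) < K (\<gamma> (Suc i))" for \<gamma>
  proof (subst sorted_wrt_iff_nth_Suc_transp)
    show "transp ((<) :: nat \<Rightarrow> _)"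
      by simp
    show "\<forall>i. Suc i < length (L \<gamma>) \<longrightarrow> L \<gamma> ! i < L \<gamma> ! Suc i"
      using that by (simp add: L_def del: upt_Suc)
  qed
  have set: "set (L \<gamma>) = K ` {1..n}" if "\<gamma> permutes {1..n}" for \<gamma>
  proof -
    have "set (L \<gamma>) = K ` \<gamma> ` {1..n}"
      by (auto simp: L_def)
    then show ?thesis
      using permutes_image[OF that] by simp
  qed
  have "sorted_wrt (<) (L \<alpha>)" "sorted_wrt (<) (L \<beta>)"
    by (rule sorted, rule K\<alpha>, assumption+, rule sorted, rule K\<beta>)
  then have "L \<alpha> = L \<beta>"
    using set[OF \<alpha>] set[OF \<beta>] by (intro sorted_distinct_set_unique) (simp_all add: strict_sorted_iff)
  have "\<alpha> i = \<beta> i" for i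
  proof (cases "i \<in> {1..n}")
    case True
    then have "K (\<alpha> i) = K (\<beta> i)"
      using \<open>L \<alpha> = L \<beta>\<close> by (auto simp: L_def simp del: upt_Suc)
    moreover have "\<alpha> i \<in> {1..n}" "\<beta> i \<in> {1..n}"
      using True permutes_in_image[OF \<alpha>] permutes_in_image[OF \<beta>] by auto
    ultimately show ?thesis
      using K by (simp add: inj_on_eq_iff)
  next
    case False
    then show ?thesis
      using \<alpha> \<beta> by (simp add: permutes_not_in)
  qed
  then show ?thesis
    by blast
qed

text \<open>
  Sorting by this key lists the elements block by block, increasingly within each block: the first
  summand determines the block of \<open>x\<close>.
\<close>

definition block_key :: "nat \<Rightarrow> nat set set \<Rightarrow> nat \<Rightarrow> nat" where
  "block_key n F x = card {U\<in>F. x \<notin> U} * Suc n + x"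

text \<open>The factor \<open>Suc n\<close> exceeds the second summand \<open>x\<close>, so the
  number of missed members decides first.\<close>

lemma block_key_lessI:
  assumes "x \<le> n" "card {U\<in>F. x \<notin> U} < card {U\<in>F. y \<notin> U}"
  shows "block_key n F x < block_key n F y"
proof -
  have "block_key n F x < Suc (card {U\<in>F. x \<notin> U}) * Suc n"
    using assms(1) by (simp add: block_key_def)
  also have "\<dots> \<le> card {U\<in>F. y \<notin> U} * Suc n"
    using assms(2) by (intro mult_le_mono1) simp
  also have "\<dots> \<le> block_key n F y"
    by (simp add: block_key_def)
  finally show ?thesis .
qed

lemma block_key_lessI2:
  assumes "x \<le> n" "card {U\<in>F. x \<notin> U} \<le> card {U\<in>F. y \<notin> U}" "x < y"
  shows "block_key n F x < block_key n F y"
  using assms block_key_lessI[OF assms(1), of F y] by (cases "card {U\<in>F. x \<notin> U} = card {U\<in>F. y \<notin> U}") (auto simp: block_key_def)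

lemma block_key_inj: "inj_on (block_key n F) {1..n}"
proof (rule inj_onI)
  fix x y assume x: "x \<in> {1..n}" and y: "y \<in> {1..n}" and eq: "block_key n F x = block_key n F y"
  have "card {U\<in>F. x \<notin> U} = card {U\<in>F. y \<notin> U}"
    using block_key_lessI[of x n F y] block_key_lessI[of y n F x] x y eq by fastforce
  then show "x = y"
    using eq by (simp add: block_key_def)
qed

text \<open>The positions of the elements of \<open>U\<close> are closed under passing to smaller
  positions, and a down-closed set of \<open>k\<close> positive integers is
  \<open>{1..k}\<close>.\<close>

lemma down_closed_image_eq:
  fixes K :: "nat \<Rightarrow> nat"
  assumes \<alpha>: "\<alpha> permutes {1..n}" and sorted: "\<And>i j. \<lbrakk>1 \<le> i; i < j; j \<le> n\<rbrakk> \<Longrightarrow> K (\<alpha> i) < K (\<alpha> j)"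
    and U: "U \<subseteq> {1..n}" and down: "\<And>x y. \<lbrakk>y \<in> U; x \<in> {1..n}; K x < K y\<rbrakk> \<Longrightarrow> x \<in> U"
  shows "U = \<alpha> ` {1..card U}"
proof -
  define I where "I = {i\<in>{1..n}. \<alpha> i \<in> U}"
  have U_I: "U = \<alpha> ` I"
  proof (intro equalityI subsetI)
    fix x assume x: "x \<in> U"
    then have "x \<in> \<alpha> ` {1..n}"
      using U permutes_image[OF \<alpha>] by auto
    then show "x \<in> \<alpha> ` I"
      using x by (auto simp: I_def)
  qed (auto simp: I_def)
  have "inj_on \<alpha> I"
    using permutes_inj_on[OF \<alpha>] .
  then have card: "card I = card U"
    by (simp add: U_I card_image)
  have fin: "finite I"
    by (simp add: I_def)
  have "I \<subseteq> {1..card I}"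
  proof
    fix i assume i: "i \<in> I"
    have "{1..i} \<subseteq> I"
    proof
      fix j assume j: "j \<in> {1..i}"
      show "j \<in> I"
      proof (cases "j = i")
        case False
        then have "K (\<alpha> j) < K (\<alpha> i)" "\<alpha> j \<in> {1..n}"
          using sorted[of j i] i j permutes_in_image[OF \<alpha>, of j] by (auto simp: I_def)
        then show ?thesis
          using down[of "\<alpha> i" "\<alpha> j"] i j by (auto simp: I_def)
      qed (use i in simp)
    qed
    then have "i \<le> card I"
      using card_mono[OF fin, of "{1..i}"] by simp
    then show "i \<in> {1..card I}"
      using i by (simp add: I_def)
  qed
  then have "I = {1..card I}"
    by (intro card_subset_eq) auto
  then show ?thesis
    using U_I card by simp
qed

lemma permutation_chain_full_descents:
  assumes R: "R \<subseteq> {1..<n}" and \<alpha>: "\<alpha> permutes {1..n}" and desc: "descent_set n \<alpha> = R"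
  defines "F \<equiv> (\<lambda>r. \<alpha> ` {1..r}) ` R"
  shows "F \<in> facets (rank_chains n R)" "chain_descents n F = F"
proof -
  have inj: "inj \<alpha>"
    using \<alpha> by (rule permutes_inj)
  have card: "card (\<alpha> ` {1..r}) = r" for r
    using inj by (simp add: card_image inj_on_subset)
  have mem: "\<alpha> i \<in> \<alpha> ` {1..r} \<longleftrightarrow> 1 \<le> i \<and> i \<le> r" for i r
    using inj by (auto simp: inj_eq)
  have in_n: "\<alpha> i \<in> {1..n}" if "1 \<le> i" "i \<le> n" for i
    using permutes_in_image[OF \<alpha>, of i] that by simp
  have sub: "\<alpha> ` {1..r} \<subseteq> {1..n}" if "r \<in> R" for r
    using that R in_n by fastforce
  have "\<alpha> ` {1..r} \<subseteq> \<alpha> ` {1..r'} \<or> \<alpha> ` {1..r'} \<subseteq> \<alpha> ` {1..r}" for r r'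
    using image_mono[of "{1..r}" "{1..r'}" \<alpha>] image_mono[of "{1..r'}" "{1..r}" \<alpha>] by (cases "r \<le> r'") auto
  then have "F \<in> rank_chains n R"
    using sub card unfolding rank_chains_def F_def by fastforce
  moreover have "card ` F = R"
    using card by (simp add: F_def image_image)
  ultimately show "F \<in> facets (rank_chains n R)"
    by (simp add: facets_rank_chains[OF R])
  \<comment> \<open>The witnesses are the neighbours at the descent: \<open>\<alpha> r\<close> lies
    in no shorter initial segment, and \<open>\<alpha> (Suc r)\<close> lies in every longer
    one.\<close>
  have "\<alpha> ` {1..r} \<in> chain_descents n F" if r: "r \<in> R" for r
  proof -
    have r': "1 \<le> r" "r < n" "\<alpha> (Suc r) < \<alpha> r"
      using r desc by (auto simp: descent_set_def)
    have "\<alpha> r \<notin> U" if "U \<in> F" "U \<subset> \<alpha> ` {1..r}" for U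
    proof -
      obtain r1 where "U = \<alpha> ` {1..r1}"
        using \<open>U \<in> F\<close> by (auto simp: F_def)
      moreover from this have "r1 < r"
        using psubset_card_mono[OF _ that(2)] card by simp
      ultimately show ?thesis
        using mem by simp
    qed
    moreover have "\<alpha> (Suc r) \<in> U" if "U \<in> F" "\<alpha> ` {1..r} \<subset> U" for U
    proof -
      obtain r1 where "U = \<alpha> ` {1..r1}"
        using \<open>U \<in> F\<close> by (auto simp: F_def)
      moreover from this have "r < r1"
        using psubset_card_mono[OF _ that(2)] card by simp
      ultimately show ?thesis
        using mem by simp
    qed
    moreover have "\<alpha> r \<in> \<alpha> ` {1..r}" "\<alpha> (Suc r) \<in> {1..n} - \<alpha> ` {1..r}"
      using mem in_n[of "Suc r"] r' by simp_all
    moreover have "\<alpha> ` {1..r} \<in> F"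
      using r by (simp add: F_def)
    ultimately show ?thesis
      unfolding chain_descents_def using r'(3) by blast
  qed
  then show "chain_descents n F = F"
    by (auto simp: F_def chain_descents_def)
qed

text \<open>This recovers \<open>\<alpha>\<close> from its chain as the permutation that sorts by
  the block key. A new block starts after each position in \<open>R\<close>; at the other positions
  \<open>\<alpha>\<close> ascends and the block number does not drop.\<close>

lemma permutation_chain_sorted:
  assumes \<alpha>: "\<alpha> permutes {1..n}" and desc: "descent_set n \<alpha> = R" and i: "1 \<le> i" "i < n"
  defines "F \<equiv> (\<lambda>r. \<alpha> ` {1..r}) ` R"
  shows "block_key n F (\<alpha> i) < block_key n F (\<alpha> (Suc i))"
proof -
  have inj: "inj \<alpha>"
    using \<alpha> by (rule permutes_inj)
  have mem: "\<alpha> i \<in> \<alpha> ` {1..r} \<longleftrightarrow> 1 \<le> i \<and> i \<le> r" for i r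
    using inj by (auto simp: inj_eq)
  have n: "\<alpha> i \<le> n"
    using permutes_in_image[OF \<alpha>, of i] i by simp
  have "finite R"
    using desc by (auto simp: descent_set_def)
  then have fin: "finite {U\<in>F. \<alpha> (Suc i) \<notin> U}"
    by (simp add: F_def)
  have sub: "{U\<in>F. \<alpha> i \<notin> U} \<subseteq> {U\<in>F. \<alpha> (Suc i) \<notin> U}"
  proof
    fix U assume "U \<in> {U\<in>F. \<alpha> i \<notin> U}"
    then obtain r where "U \<in> F" "U = \<alpha> ` {1..r}" "\<alpha> i \<notin> U"
      unfolding F_def by blast
    then show "U \<in> {U\<in>F. \<alpha> (Suc i) \<notin> U}"
      using mem[of i r] mem[of "Suc i" r] i(1) by simp
  qed
  show ?thesis
  proof (cases "i \<in> R")
    case True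
    have "\<alpha> ` {1..i} \<in> {U\<in>F. \<alpha> (Suc i) \<notin> U} - {U\<in>F. \<alpha> i \<notin> U}"
      using True mem[of i i] mem[of "Suc i" i] i(1) by (simp add: F_def)
    then have "{U\<in>F. \<alpha> i \<notin> U} \<subset> {U\<in>F. \<alpha> (Suc i) \<notin> U}"
      using sub by blast
    then show ?thesis
      by (intro block_key_lessI[OF n] psubset_card_mono[OF fin])
  next
    case False
    then have "\<not> \<alpha> (Suc i) < \<alpha> i"
      using desc i by (auto simp: descent_set_def)
    moreover have "\<alpha> i \<noteq> \<alpha> (Suc i)"
      using inj by (simp add: inj_eq)
    ultimately have "\<alpha> i < \<alpha> (Suc i)"
      by simp
    then show ?thesis
      using card_mono[OF fin sub] by (intro block_key_lessI2[OF n])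
  qed
qed

text \<open>Take the permutation that sorts by the block key. It increases inside blocks, so it can
  descend only at their ends. At the end of a block it does descend, because its value there is the
  greatest of the block and the next value is the least of the next block, while the descent of the
  chain provides a decreasing pair from these two blocks.\<close>

lemma full_descents_obtain_permutation:
  assumes R: "R \<subseteq> {1..<n}" and F: "F \<in> facets (rank_chains n R)" and full: "chain_descents n F = F"
  obtains \<alpha> where "\<alpha> permutes {1..n}" "descent_set n \<alpha> = R" "F = (\<lambda>r. \<alpha> ` {1..r}) ` R"
proof -
  let ?K = "block_key n F" and ?b = "\<lambda>x. {U\<in>F. x \<notin> U}"
  have F': "F \<in> rank_chains n R" "card ` F = R"
    using F unfolding facets_rank_chains[OF R] by auto
  have finF: "finite F"
    using finite_rank_chain(1)[OF F'(1)] .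
  obtain \<alpha> where \<alpha>: "\<alpha> permutes {1..n}"
    and sorted: "\<And>i j. \<lbrakk>1 \<le> i; i < j; j \<le> n\<rbrakk> \<Longrightarrow> ?K (\<alpha> i) < ?K (\<alpha> j)"
    using sorting_permutation_exists[OF block_key_inj] by metis
  have inj: "inj \<alpha>"
    using \<alpha> by (rule permutes_inj)
  have mem: "\<alpha> i \<in> \<alpha> ` {1..r} \<longleftrightarrow> 1 \<le> i \<and> i \<le> r" for i r
    using inj by (auto simp: inj_eq)
  have in_n: "\<alpha> i \<in> {1..n}" if "1 \<le> i" "i \<le> n" for i
    using permutes_in_image[OF \<alpha>, of i] that by simp
  have mono: "?K x < ?K y" if "x \<in> {1..n}" "?b x \<subset> ?b y" for x y
    using that finF by (intro block_key_lessI psubset_card_mono) auto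
  have U_eq: "U = \<alpha> ` {1..card U}" if U: "U \<in> F" for U
  proof (rule down_closed_image_eq[OF \<alpha>, where K = ?K])
    show "?K (\<alpha> i) < ?K (\<alpha> j)" if "1 \<le> i" "i < j" "j \<le> n" for i j
      using that by (rule sorted)
    show "U \<subseteq> {1..n}"
      by (rule rank_chainsD(1)[OF F'(1) U])
    fix x y assume y: "y \<in> U" and x: "x \<in> {1..n}" and less: "?K x < ?K y"
    show "x \<in> U"
    proof (rule ccontr)
      assume "x \<notin> U"
      then have "?b y \<subset> ?b x"
        using rank_chainsD(3)[OF F'(1) U] U y by blast
      then have "?K y < ?K x"
        using mono rank_chainsD(1)[OF F'(1) U] y by blast
      then show False
        using less by simp
    qed
  qed
  have F_eq: "F = (\<lambda>r. \<alpha> ` {1..r}) ` R"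
  proof -
    have "(\<lambda>r. \<alpha> ` {1..r}) ` card ` F = (\<lambda>U. U) ` F"
      unfolding image_image by (rule image_cong[OF refl]) (rule U_eq[symmetric])
    then show ?thesis
      by (simp add: F'(2))
  qed
  have "descent_set n \<alpha> = R"
  proof (intro equalityI subsetI)
    fix i assume "i \<in> descent_set n \<alpha>"
    then have i: "1 \<le> i" "i < n" "\<alpha> (Suc i) < \<alpha> i"
      by (auto simp: descent_set_def)
    have "\<not> ?K (\<alpha> (Suc i)) < ?K (\<alpha> i)"
      using sorted[of i "Suc i"] i by simp
    \<comment> \<open>The key increases although the value decreases, so the number of missed
      members must increase; a member that accounts for this ends exactly at position
      \<open>i\<close>.\<close>
    then have "\<not> ?b (\<alpha> (Suc i)) \<subseteq> ?b (\<alpha> i)"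
      using block_key_lessI2[of "\<alpha> (Suc i)" n F "\<alpha> i"] in_n[of "Suc i"] i finF
        card_mono[of "?b (\<alpha> i)" "?b (\<alpha> (Suc i))"] by auto
    then obtain U where "U \<in> F" "\<alpha> i \<in> U" "\<alpha> (Suc i) \<notin> U"
      by blast
    then have "i \<le> card U" "\<not> Suc i \<le> card U" "card U \<in> R"
      using U_eq[of U] mem[of _ "card U"] F'(2) by auto
    then show "i \<in> R"
      by (metis le_antisym not_less_eq_eq)
  next
    fix r assume r: "r \<in> R"
    then have r': "1 \<le> r" "r < n"
      using R by auto
    obtain U where U: "U \<in> F" "card U = r"
      using r F'(2) by auto
    then have U_r: "U = \<alpha> ` {1..r}"
      using U_eq by blast
    have "U \<in> chain_descents n F"
      using U(1) full by simp
    then obtain x y where x: "x \<in> U" and y: "y \<in> {1..n} - U" and yx: "y < x"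
      and x_min: "\<forall>V\<in>F. V \<subset> U \<longrightarrow> x \<notin> V" and y_min: "\<forall>V\<in>F. U \<subset> V \<longrightarrow> y \<in> V"
      unfolding chain_descents_def by blast
    \<comment> \<open>\<open>x\<close> occurs no later than position \<open>r\<close> and misses
      every member that \<open>\<alpha> r\<close> misses; a larger \<open>x\<close> would therefore
      have a larger key than \<open>\<alpha> r\<close>.\<close>
    have "x \<le> \<alpha> r"
    proof -
      have "\<alpha> r \<in> U"
        using mem[of r r] r'(1) U_r by simp
      then have "V \<subset> U" if "V \<in> F" "\<alpha> r \<notin> V" for V
        using rank_chainsD(3)[OF F'(1) U(1) that(1)] that(2) by blast
      then have "?b (\<alpha> r) \<subseteq> ?b x"
        using x_min by blast
      then have "card (?b (\<alpha> r)) \<le> card (?b x)"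
        using finF by (intro card_mono) auto
      moreover obtain j where "x = \<alpha> j" "1 \<le> j" "j \<le> r"
        using x U_r by auto
      then have "?K x \<le> ?K (\<alpha> r)"
        using sorted[of j r] r' by (cases "j = r") auto
      ultimately show ?thesis
        using block_key_lessI2[of "\<alpha> r" n F x] in_n[of r] r' by fastforce
    qed
    \<comment> \<open>The mirror image: \<open>y\<close> occurs after position \<open>r\<close>, and
      every member that it misses also misses \<open>\<alpha> (Suc r)\<close>.\<close>
    moreover have "\<alpha> (Suc r) \<le> y"
    proof -
      have "\<alpha> (Suc r) \<notin> U"
        using mem[of "Suc r" r] U_r by simp
      then have "?b y \<subseteq> ?b (\<alpha> (Suc r))"
        using rank_chainsD(3)[OF F'(1) U(1)] y_min by blast
      then have "card (?b y) \<le> card (?b (\<alpha> (Suc r)))"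
        using finF by (intro card_mono) auto
      moreover have "y \<in> \<alpha> ` {1..n}"
        using y permutes_image[OF \<alpha>] by simp
      then obtain j where j: "y = \<alpha> j" "1 \<le> j" "j \<le> n"
        by auto
      then have "\<not> j \<le> r"
        using y U_r by auto
      then have "?K (\<alpha> (Suc r)) \<le> ?K y"
        using sorted[of "Suc r" j] j by (cases "j = Suc r") auto
      ultimately show ?thesis
        using block_key_lessI2[of y n F "\<alpha> (Suc r)"] y by fastforce
    qed
    ultimately show "r \<in> descent_set n \<alpha>"
      using yx r' by (simp add: descent_set_def)
  qed
  then show thesis
    using that \<alpha> F_eq by blast
qed

lemma full_descents_bij:
  assumes R: "R \<subseteq> {1..<n}"
  shows "bij_betw (\<lambda>\<alpha>. (\<lambda>r. \<alpha> ` {1..r}) ` R) {\<alpha>. \<alpha> permutes {1..n} \<and> descent_set n \<alpha> = R}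
    {F \<in> facets (rank_chains n R). chain_descents n F = F}"
  unfolding bij_betw_def
proof
  let ?f = "\<lambda>\<alpha>. (\<lambda>r. \<alpha> ` {1..r}) ` R"
  show "inj_on ?f {\<alpha>. \<alpha> permutes {1..n} \<and> descent_set n \<alpha> = R}"
  proof (rule inj_onI)
    fix \<alpha> \<beta> assume \<alpha>: "\<alpha> \<in> {\<alpha>. \<alpha> permutes {1..n} \<and> descent_set n \<alpha> = R}"
      and \<beta>: "\<beta> \<in> {\<alpha>. \<alpha> permutes {1..n} \<and> descent_set n \<alpha> = R}" and eq: "?f \<alpha> = ?f \<beta>"
    show "\<alpha> = \<beta>"
    \<comment> \<open>Equal chains give equal keys, and both permutations sort by this common
      key.\<close>
    proof (rule sorting_permutation_unique[OF block_key_inj])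
      show "block_key n (?f \<alpha>) (\<alpha> i) < block_key n (?f \<alpha>) (\<alpha> (Suc i))" if "1 \<le> i" "i < n" for i
        using permutation_chain_sorted[of \<alpha> n R i] \<alpha> that by simp
      show "block_key n (?f \<alpha>) (\<beta> i) < block_key n (?f \<alpha>) (\<beta> (Suc i))" if "1 \<le> i" "i < n" for i
        using permutation_chain_sorted[of \<beta> n R i] \<beta> that unfolding eq by simp
    qed (use \<alpha> \<beta> in auto)
  qed
  show "?f ` {\<alpha>. \<alpha> permutes {1..n} \<and> descent_set n \<alpha> = R} =
      {F \<in> facets (rank_chains n R). chain_descents n F = F}"
  proof (intro equalityI subsetI)
    fix F assume "F \<in> ?f ` {\<alpha>. \<alpha> permutes {1..n} \<and> descent_set n \<alpha> = R}"
    then show "F \<in> {F \<in> facets (rank_chains n R). chain_descents n F = F}"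
      using permutation_chain_full_descents[OF R] by auto
  next
    fix F assume "F \<in> {F \<in> facets (rank_chains n R). chain_descents n F = F}"
    then obtain \<alpha> where "\<alpha> permutes {1..n}" "descent_set n \<alpha> = R" "F = ?f \<alpha>"
      using full_descents_obtain_permutation[OF R] by blast
    then show "F \<in> ?f ` {\<alpha>. \<alpha> permutes {1..n} \<and> descent_set n \<alpha> = R}"
      by blast
  qed
qed

section \<open>Collapsing a contractible subspace; wedges\<close>

lemma prod_top_of_set:
  "prod_topology (top_of_set S) (top_of_set T) = top_of_set (S \<times> T)"
  by (simp add: prod_topology_subtopology subtopology_subtopology Times_Int_Times
      flip: subtopology_Times)

text \<open>The end of \<open>H\<close> is constant on the fibres of \<open>q\<close>, so it factors
  as \<open>g \<circ> q\<close>, and \<open>H\<close> joins the identity of \<open>X\<close> to it.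
  Since \<open>H\<close> respects the fibres at all times, \<open>q \<circ> H\<close> descends to a
  homotopy \<open>K\<close> on \<open>W\<close> from the identity to
  \<open>q \<circ> g\<close>.\<close>

lemma quotient_homotopy_equivalence:
  assumes X: "compact_space X" and W: "Hausdorff_space W"
    and q: "continuous_map X W q" "q ` topspace X = topspace W"
    and H: "continuous_map (prod_topology (top_of_set {0..1::real}) X) X H"
    and H0: "\<And>x. x \<in> topspace X \<Longrightarrow> H (0, x) = x"
    and H1: "\<And>x y. \<lbrakk>x \<in> topspace X; y \<in> topspace X; q x = q y\<rbrakk> \<Longrightarrow> H (1, x) = H (1, y)"
    and Hq: "\<And>t x y. \<lbrakk>t \<in> {0..1}; x \<in> topspace X; y \<in> topspace X; q x = q y\<rbrakk>
      \<Longrightarrow> q (H (t, x)) = q (H (t, y))"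
  shows "X homotopy_equivalent_space W"
proof -
  let ?I = "top_of_set {0..1::real}"
  have quot: "quotient_map X W q"
    using q X W by (simp add: continuous_imp_quotient_map)
  have H1c: "continuous_map X X (\<lambda>x. H (1, x))"
    using continuous_map_compose[OF _ H, of X "\<lambda>x. (1, x)"]
    by (simp add: o_def continuous_map_pairwise)
  have "\<exists>g. continuous_map W X g \<and> (\<forall>x\<in>topspace X. g (q x) = H (1, x))"
    by (rule quotient_map_lift_exists[OF quot H1c]) (use H1 in blast)+
  then obtain g where g: "continuous_map W X g"
    and gq: "\<And>x. x \<in> topspace X \<Longrightarrow> g (q x) = H (1, x)"
    by blast
  let ?Q = "\<lambda>(t, x). (t, q x)"
  have Qc: "continuous_map (prod_topology ?I X) (prod_topology ?I W) ?Q"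
    using q(1) continuous_map_compose[OF continuous_map_snd q(1), of ?I]
    by (auto simp: continuous_map_pairwise o_def case_prod_unfold continuous_map_fst)
  \<comment> \<open>The product of a quotient map with the interval is again a quotient map here
    because it goes from a compact space onto a Hausdorff one.\<close>
  have Qq: "quotient_map (prod_topology ?I X) (prod_topology ?I W) ?Q"
  proof (rule continuous_imp_quotient_map[OF Qc])
    show "compact_space (prod_topology ?I X)"
      using X by (simp add: compact_space_prod_topology compact_space_subtopology)
    show "Hausdorff_space (prod_topology ?I W)"
      using W by (simp add: Hausdorff_space_prod_topology Hausdorff_space_subtopology)
    show "?Q ` topspace (prod_topology ?I X) = topspace (prod_topology ?I W)"
      using q(2) by force
  qed
  have qH: "continuous_map (prod_topology ?I X) W (\<lambda>p. q (H p))"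
    using continuous_map_compose[OF H q(1)] by (simp add: o_def)
  have fib: "q (H p) = q (H p')" if "p \<in> topspace (prod_topology ?I X)"
    "p' \<in> topspace (prod_topology ?I X)" "?Q p = ?Q p'" for p p'
  proof -
    obtain t x t' y where pp: "p = (t, x)" "p' = (t', y)"
      by (metis surj_pair)
    then have "t' = t" "q x = q y" "t \<in> {0..1}" "x \<in> topspace X" "y \<in> topspace X"
      using that by auto
    then show ?thesis
      using Hq[of t x y] pp by simp
  qed
  have "\<exists>K. continuous_map (prod_topology ?I W) W K \<and>
      (\<forall>p\<in>topspace (prod_topology ?I X). K (?Q p) = q (H p))"
    by (rule quotient_map_lift_exists[OF Qq qH]) (use fib in blast)+
  then obtain K where K: "continuous_map (prod_topology ?I W) W K"
    and Kq: "\<And>p. p \<in> topspace (prod_topology ?I X) \<Longrightarrow> K (?Q p) = q (H p)"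
    by blast
  have "homotopic_with (\<lambda>x. True) X X id (g \<circ> q)"
    unfolding homotopic_with[of X "\<lambda>x. True", simplified]
    using H H0 gq by (intro exI[of _ H]) auto
  moreover have "homotopic_with (\<lambda>x. True) W W id (q \<circ> g)"
  proof -
    have "K (0, w) = w \<and> K (1, w) = q (g w)" if "w \<in> topspace W" for w
    proof -
      have "w \<in> q ` topspace X"
        using that q(2) by simp
      then obtain x where x: "x \<in> topspace X" "w = q x"
        by blast
      then show ?thesis
        using Kq[of "(0, x)"] Kq[of "(1, x)"] H0 gq by simp
    qed
    then show ?thesis
      unfolding homotopic_with[of W "\<lambda>x. True", simplified]
      using K by (intro exI[of _ K]) auto
  qed
  ultimately have "homotopic_with (\<lambda>x. True) X X (g \<circ> q) id"
    "homotopic_with (\<lambda>x. True) W W (q \<circ> g) id"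
    by (simp_all add: homotopic_with_sym)
  then show ?thesis
    unfolding homotopy_equivalent_space_def using q(1) g by blast
qed

section \<open>Wedges of pointed spaces\<close>

lemma continuous_map_into_wedge:
  assumes "i \<in> I"
  shows "continuous_map (X i) (wedge I X p) (\<lambda>x. if x = p i then None else Some (i, x))"
proof -
  let ?q = "\<lambda>(i, x). if x = p i then None else Some (i, x)"
  have "continuous_map (X i) (quotient_topology (sum_topology X I) ?q) (?q \<circ> (\<lambda>x. (i, x)))"
    using assms quotient_map_quotient_topology
    by (intro continuous_map_compose[OF continuous_map_component_injection])
       (auto intro: quotient_imp_continuous_map)
  then show ?thesis
    using assms by (auto simp: wedge_def o_def)
qed

lemma continuous_map_from_wedge:
  assumes "I \<noteq> {}" and f: "\<And>i. i \<in> I \<Longrightarrow> continuous_map (X i) Y (f i)"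
    and "\<And>i. i \<in> I \<Longrightarrow> f i (p i) = b"
  shows "continuous_map (wedge I X p) Y (\<lambda>w. case w of None \<Rightarrow> b | Some (i, x) \<Rightarrow> f i x)"
    (is "continuous_map _ _ ?g")
proof -
  let ?q = "\<lambda>(i, x). if x = p i then None else Some (i, x)"
  let ?h = "\<lambda>(i, x). f i x"
  have h: "continuous_map (sum_topology X I) Y ?h"
    unfolding continuous_map_def
  proof (intro conjI allI impI)
    show "?h \<in> topspace (sum_topology X I) \<rightarrow> topspace Y"
      using f by (auto simp: continuous_map_def Pi_iff)
    fix U assume "openin Y U"
    then show "openin (sum_topology X I) {x \<in> topspace (sum_topology X I). ?h x \<in> U}"
      using f by (auto simp: openin_sum_topology continuous_map_def)
  qed
  have "continuous_map (sum_topology X I) Y (?g \<circ> ?q)"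
    by (rule continuous_map_eq[OF h]) (use assms(3) in \<open>auto split: if_splits\<close>)
  then show ?thesis
    using assms(1) continuous_compose_quotient_map[OF quotient_map_quotient_topology]
    by (auto simp: wedge_def)
qed

lemma topspace_wedge:
  assumes "I \<noteq> {}" "\<And>i. i \<in> I \<Longrightarrow> p i \<in> topspace (X i)"
  shows "topspace (wedge I X p) = insert None {Some (i, x) | i x. i \<in> I \<and> x \<in> topspace (X i) \<and> x \<noteq> p i}"
proof -
  let ?q = "\<lambda>(i, x). if x = p i then None else Some (i, x)"
  obtain j where j: "j \<in> I"
    using assms(1) by blast
  have "?q ` Sigma I (topspace \<circ> X) =
      insert None {Some (i, x) | i x. i \<in> I \<and> x \<in> topspace (X i) \<and> x \<noteq> p i}" (is "?A = ?B")
  proof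
    show "?A \<subseteq> ?B"
      by (auto split: if_splits)
    have "None = ?q (j, p j)" "(j, p j) \<in> Sigma I (topspace \<circ> X)"
      using j assms(2) by auto
    then have "None \<in> ?A"
      by blast
    moreover have "Some (i, x) \<in> ?A" if "i \<in> I" "x \<in> topspace (X i)" "x \<noteq> p i" for i x
      using that by (intro image_eqI[of _ _ "(i, x)"]) auto
    ultimately show "?B \<subseteq> ?A"
      by blast
  qed
  then show ?thesis
    using assms(1) by (simp add: wedge_def)
qed

text \<open>The wedge maps injectively and continuously into a power of the reals: each summand is
  translated so that its base point becomes the origin, and gets its own set of coordinate
  axes.\<close>

lemma Hausdorff_space_wedge:
  fixes X :: "'i \<Rightarrow> ('a \<Rightarrow> real) topology"
  assumes I: "I \<noteq> {}" and p: "\<And>i. i \<in> I \<Longrightarrow> p i \<in> topspace (X i)"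
    and X: "\<And>i j. i \<in> I \<Longrightarrow> continuous_map (X i) euclideanreal (\<lambda>x. x j)"
  shows "Hausdorff_space (wedge I X p)"
proof -
  let ?f = "\<lambda>i x. \<lambda>(i', j). if i' = i then x j - p i j else (0::real)"
  let ?g = "\<lambda>w. case w of None \<Rightarrow> (\<lambda>_. 0) | Some (i, x) \<Rightarrow> ?f i x"
  have "continuous_map (X i) (powertop_real UNIV) (?f i)" if "i \<in> I" for i
    unfolding continuous_map_componentwise_UNIV
  proof
    fix k :: "'i \<times> 'a"
    show "continuous_map (X i) euclideanreal (\<lambda>x. ?f i x k)"
      using X[OF that] by (cases k; cases "fst k = i") (auto intro!: continuous_map_diff)
  qed
  then have g: "continuous_map (wedge I X p) (powertop_real UNIV) ?g"
    by (intro continuous_map_from_wedge I) auto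
  have "inj_on ?g (topspace (wedge I X p))"
  proof -
    have None: "x = p i" if "?f i x = (\<lambda>_. 0)" for i x
    proof
      fix j show "x j = p i j"
        using fun_cong[OF that, of "(i, j)"] by simp
    qed
    have Some: "i = i' \<and> x = x'" if e: "?f i x = ?f i' x'" and "x \<noteq> p i" for i x i' x'
    proof -
      have i: "i = i'"
      proof (rule ccontr)
        assume "i \<noteq> i'"
        have "x j = p i j" for j
          using fun_cong[OF e, of "(i, j)"] \<open>i \<noteq> i'\<close> by simp
        then show False
          using \<open>x \<noteq> p i\<close> by blast
      qed
      have "x j = x' j" for j
        using fun_cong[OF e, of "(i, j)"] i by simp
      with i show ?thesis by blast
    qed
    have ts: "topspace (wedge I X p) =
        insert None {Some (i, x) | i x. i \<in> I \<and> x \<in> topspace (X i) \<and> x \<noteq> p i}"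
      by (rule topspace_wedge[OF I p])
    show ?thesis
      unfolding ts
    proof (rule inj_onI)
      fix w w'
      assume "w \<in> insert None {Some (i, x) | i x. i \<in> I \<and> x \<in> topspace (X i) \<and> x \<noteq> p i}"
        and "w' \<in> insert None {Some (i, x) | i x. i \<in> I \<and> x \<in> topspace (X i) \<and> x \<noteq> p i}"
        and e: "?g w = ?g w'"
      then consider "w = None" "w' = None" | i x where "w = None" "w' = Some (i, x)" "x \<noteq> p i"
        | i x where "w' = None" "w = Some (i, x)" "x \<noteq> p i"
        | i x i' x' where "w = Some (i, x)" "w' = Some (i', x')" "x \<noteq> p i"
        by blast
      then show "w = w'"
      proof cases
        case 2
        then show ?thesis using None[OF e[symmetric, unfolded 2 option.case prod.case]] by blast
      next
        case 3
        then show ?thesis using None[OF e[unfolded 3 option.case prod.case]] by blast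
      next
        case 4
        then show ?thesis using Some[OF e[unfolded 4(1,2) option.case prod.case] 4(3)] 4 by blast
      qed simp
    qed
  qed
  moreover have "Hausdorff_space (powertop_real (UNIV :: ('i \<times> 'a) set))"
    by (simp add: Hausdorff_space_product_topology)
  ultimately show ?thesis
    using g Hausdorff_space_injective_preimage by blast
qed

lemma continuous_on_Min:
  fixes f :: "'a::topological_space \<Rightarrow> 'b \<Rightarrow> real"
  assumes "finite F" "F \<noteq> {}" "\<And>v. v \<in> F \<Longrightarrow> continuous_on S (\<lambda>x. f x v)"
  shows "continuous_on S (\<lambda>x. Min (f x ` F))"
  using assms
proof (induction F rule: finite_ne_induct)
  case (insert v F)
  then have "continuous_on S (\<lambda>x. min (f x v) (Min (f x ` F)))"
    by (intro continuous_on_min) auto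
  with insert show ?case
    by simp
qed simp

section \<open>Simplices in barycentric coordinates\<close>

text \<open>This is the closed simplex: vertices of \<open>F\<close> may have coordinate
  \<open>0\<close>, whereas the realization sorts points by their exact support.\<close>

definition simplex_on :: "'v set \<Rightarrow> ('v \<Rightarrow> real) set" where
  "simplex_on F = {x. (\<forall>v. 0 \<le> x v) \<and> (\<forall>v. v \<notin> F \<longrightarrow> x v = 0) \<and> sum x F = 1}"

lemma continuous_on_coordinate:
  fixes f :: "'a::topological_space \<Rightarrow> 'v \<Rightarrow> real"
  shows "continuous_on S f \<Longrightarrow> continuous_on S (\<lambda>x. f x v)"
  by (rule continuous_on_product_then_coordinatewise)

lemma closed_simplex_on: "closed (simplex_on F)"
proof -
  have "simplex_on F = (\<Inter>v. {x. 0 \<le> x v}) \<inter> (\<Inter>v\<in>-F. {x. x v = 0}) \<inter> {x. sum x F = 1}"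
    by (auto simp: simplex_on_def)
  moreover have "closed {x :: 'a \<Rightarrow> real. 0 \<le> x v}" "closed {x :: 'a \<Rightarrow> real. x v = 0}" for v
    by (intro closed_Collect_le closed_Collect_eq continuous_on_const continuous_on_product_coordinates)+
  moreover have "closed {x :: 'a \<Rightarrow> real. sum x F = 1}"
    by (intro closed_Collect_eq continuous_on_const continuous_on_sum continuous_on_product_coordinates)
  ultimately show ?thesis
    by (simp add: closed_INT closed_Int)
qed

text \<open>It is a closed subset of a cube, which is compact by Tychonoff's theorem even if there
  are infinitely many coordinates.\<close>

lemma compact_simplex_on:
  assumes "finite F"
  shows "compact (simplex_on F)"
proof -
  have "x v \<le> 1" if "x \<in> simplex_on F" for x v
  proof (cases "v \<in> F")
    case True
    have "x v \<le> sum x F"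
      using that True assms by (intro member_le_sum) (auto simp: simplex_on_def)
    then show ?thesis
      using that by (simp add: simplex_on_def)
  qed (use that in \<open>simp add: simplex_on_def\<close>)
  then have "simplex_on F = PiE UNIV (\<lambda>_. {0..1}) \<inter> simplex_on F"
    by (auto simp: simplex_on_def)
  moreover have "compact (PiE UNIV (\<lambda>_::'a. {0..1::real}))"
    using compactin_PiE[of "\<lambda>_. euclideanreal" UNIV "\<lambda>_::'a. {0..1}"]
    by (simp add: euclidean_product_topology)
  ultimately show ?thesis
    using compact_Int_closed closed_simplex_on by metis
qed

lemma simplex_on_mono:
  assumes "finite G" "F \<subseteq> G"
  shows "simplex_on F \<subseteq> simplex_on G"
proof
  fix x assume x: "x \<in> simplex_on F"
  then have "sum x F = sum x G"
    using assms by (intro sum.mono_neutral_left) (auto simp: simplex_on_def)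
  then show "x \<in> simplex_on G"
    using x assms(2) by (auto simp: simplex_on_def)
qed

lemma simplex_on_support:
  assumes "x \<in> simplex_on F" "finite F"
  shows "{v. x v \<noteq> 0} \<subseteq> F" "x \<in> simplex_on {v. x v \<noteq> 0}"
proof -
  show s: "{v. x v \<noteq> 0} \<subseteq> F"
    using assms by (auto simp: simplex_on_def)
  have "sum x {v. x v \<noteq> 0} = sum x F"
    using assms s by (intro sum.mono_neutral_left) auto
  then show "x \<in> simplex_on {v. x v \<noteq> 0}"
    using assms by (simp add: simplex_on_def)
qed

lemma simplex_on_convex:
  assumes "x \<in> simplex_on F" "y \<in> simplex_on F" "t \<in> {0..1}"
  shows "(\<lambda>v. (1 - t) * x v + t * y v) \<in> simplex_on F"
proof -
  have "(\<Sum>v\<in>F. (1 - t) * x v + t * y v) = (1 - t) * sum x F + t * sum y F"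
    by (simp add: sum.distrib sum_distrib_left)
  then show ?thesis
    using assms by (simp add: simplex_on_def)
qed

lemma homotopic_straight_line:
  fixes f :: "('v \<Rightarrow> real) \<Rightarrow> 'v \<Rightarrow> real"
  assumes "continuous_on X f"
    and "\<And>t x. \<lbrakk>t \<in> {0..1}; x \<in> X\<rbrakk> \<Longrightarrow> (\<lambda>v. (1 - t) * x v + t * f x v) \<in> X"
  shows "homotopic_with_canon (\<lambda>x. True) X X id f"
proof -
  let ?h = "\<lambda>(t, x) v. (1 - t) * x v + t * f x v"
  have f: "continuous_on ({0..1} \<times> X) (\<lambda>p. f (snd p))"
    by (rule continuous_on_compose2[OF assms(1)]) (auto intro: continuous_on_snd continuous_on_id)
  have "continuous_on ({0..1} \<times> X) (\<lambda>p. ?h p v)" for v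
    unfolding case_prod_unfold
    by (intro continuous_on_add continuous_on_mult continuous_on_diff continuous_on_const
        continuous_on_fst continuous_on_id continuous_on_coordinate[OF f]
        continuous_on_coordinate[OF continuous_on_snd[OF continuous_on_id]])
  then have "continuous_on ({0..1} \<times> X) ?h"
    by (rule continuous_on_coordinatewise_then_product)
  moreover have "?h \<in> {0..1} \<times> X \<rightarrow> X"
    using assms(2) by auto
  ultimately have "continuous_map (prod_topology (top_of_set {0..1}) (top_of_set X)) (top_of_set X) ?h"
    by (simp add: prod_top_of_set)
  then show ?thesis
    by (subst homotopic_with) (auto intro!: exI[of _ ?h])
qed

lemma contractible_simplex_on:
  assumes "finite F" "F \<noteq> {}"
  shows "contractible (simplex_on F)"
proof -
  obtain u where u: "u \<in> F"
    using assms by blast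
  have e: "(\<lambda>v. if v = u then 1 else 0) \<in> simplex_on F"
    using assms u by (auto simp: simplex_on_def)
  have "homotopic_with_canon (\<lambda>x. True) (simplex_on F) (simplex_on F) id (\<lambda>x v. if v = u then 1 else 0)"
    by (rule homotopic_straight_line) (use simplex_on_convex[OF _ e] in auto)
  then show ?thesis
    unfolding contractible_def by blast
qed

lemma simplex_on_Min_eq_0:
  assumes "x \<in> simplex_on F" "finite R" "R \<noteq> {}"
  shows "Min (x ` R) = 0 \<longleftrightarrow> (\<exists>v\<in>R. x v = 0)" "0 \<le> Min (x ` R)"
proof -
  show 0: "0 \<le> Min (x ` R)"
    using assms by (simp add: simplex_on_def)
  show "Min (x ` R) = 0 \<longleftrightarrow> (\<exists>v\<in>R. x v = 0)"
  proof
    assume "Min (x ` R) = 0"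
    then show "\<exists>v\<in>R. x v = 0"
      using Min_in[of "x ` R"] assms by auto
  next
    assume "\<exists>v\<in>R. x v = 0"
    then have "Min (x ` R) \<le> 0"
      using assms by (metis Min_le finite_imageI image_eqI)
    with 0 show "Min (x ` R) = 0"
      by simp
  qed
qed

text \<open>
  The simplex on \<open>F\<close> is retracted onto the part of its boundary that lies in \<open>A\<close> by moving mass
  evenly from the vertices in \<open>R\<close> to the vertices in \<open>F - R\<close>, until the first of the former has
  no mass left.
\<close>

lemma contractible_Un_simplex_on:
  assumes A: "contractible A" "closed A" and F: "finite F" and R: "R \<subset> F" "R \<noteq> {}"
    and AF: "A \<inter> simplex_on F = {x \<in> simplex_on F. \<exists>v\<in>R. x v = 0}"
  shows "contractible (A \<union> simplex_on F)"
proof -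
  define \<mu> where "\<mu> x = Min (x ` R)" for x :: "'a \<Rightarrow> real"
  define \<rho> where "\<rho> x v = (if v \<in> R then x v - \<mu> x
      else if v \<in> F then x v + of_nat (card R) * \<mu> x / of_nat (card (F - R)) else x v)" for x v
  define r where "r x = (if x \<in> A then x else \<rho> x)" for x
  have fR: "finite R"
    using F R finite_subset by blast
  \<comment> \<open>Some vertex outside \<open>R\<close> must exist to receive the mass. This is
    what fails for a spanning facet.\<close>
  have card: "card (F - R) > 0"
    using F R by (metis card_gt_0_iff finite_Diff Diff_eq_empty_iff psubset_imp_subset psubset_eq subset_antisym)
  have \<rho>_eq: "\<rho> x = x" if "x \<in> A" "x \<in> simplex_on F" for x
  proof -
    have "\<mu> x = 0"
      using that AF simplex_on_Min_eq_0[of x F R] fR R by (auto simp: \<mu>_def)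
    then show ?thesis
      by (auto simp: \<rho>_def fun_eq_iff)
  qed
  have \<rho>_in: "\<rho> x \<in> simplex_on F \<inter> A" if x: "x \<in> simplex_on F" for x
  proof -
    have le: "\<mu> x \<le> x v" if "v \<in> R" for v
      using that fR by (simp add: \<mu>_def)
    have 0: "0 \<le> \<mu> x"
      using simplex_on_Min_eq_0[OF x fR R(2)] by (simp add: \<mu>_def)
    have "sum (\<rho> x) F = sum (\<rho> x) (F - R) + sum (\<rho> x) R"
      using F R by (intro sum.subset_diff) auto
    also have "sum (\<rho> x) R = sum x R - of_nat (card R) * \<mu> x"
      by (simp add: \<rho>_def sum_subtractf)
    also have "sum (\<rho> x) (F - R) = sum x (F - R) + of_nat (card R) * \<mu> x"
      using card by (simp add: \<rho>_def sum.distrib)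
    also have "sum x (F - R) + of_nat (card R) * \<mu> x + (sum x R - of_nat (card R) * \<mu> x) = sum x F"
      using sum.subset_diff[of R F x] F R by auto
    finally have "sum (\<rho> x) F = 1"
      using x by (simp add: simplex_on_def)
    moreover have "0 \<le> \<rho> x v" for v
      using x le[of v] 0 by (auto simp: \<rho>_def simplex_on_def)
    moreover have "\<rho> x v = 0" if "v \<notin> F" for v
      using x that R by (auto simp: \<rho>_def simplex_on_def)
    ultimately have in_F: "\<rho> x \<in> simplex_on F"
      by (simp add: simplex_on_def)
    obtain v where "v \<in> R" "x v = \<mu> x"
      using Min_in[of "x ` R"] fR R(2) unfolding \<mu>_def by fastforce
    then have "\<rho> x v = 0"
      by (simp add: \<rho>_def)
    with \<open>v \<in> R\<close> in_F AF show ?thesis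
      by blast
  qed
  have \<mu>_cont: "continuous_on (simplex_on F) \<mu>"
    unfolding \<mu>_def using fR R(2)
    by (intro continuous_on_Min continuous_on_coordinate[OF continuous_on_id])
  have "continuous_on (simplex_on F) \<rho>"
  proof (rule continuous_on_coordinatewise_then_product)
    fix v
    have c: "continuous_on (simplex_on F) (\<lambda>x. x v)"
      by (rule continuous_on_coordinate[OF continuous_on_id])
    consider "v \<in> R" | "v \<notin> R" "v \<in> F" | "v \<notin> R" "v \<notin> F"
      by blast
    then show "continuous_on (simplex_on F) (\<lambda>x. \<rho> x v)"
      by cases (use card in \<open>simp_all add: \<rho>_def c \<mu>_cont continuous_on_add continuous_on_diff
          continuous_on_divide continuous_on_mult continuous_on_const\<close>)
  qed
  \<comment> \<open>The two closed pieces fit together because \<open>\<mu>\<close> vanishes on the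
    overlap, where \<open>\<rho>\<close> is the identity.\<close>
  then have r_cont: "continuous_on (A \<union> simplex_on F) r"
    unfolding r_def using A(2) closed_simplex_on \<rho>_eq
    by (intro continuous_on_cases) (auto simp: continuous_on_id)
  \<comment> \<open>The segments from \<open>x\<close> to \<open>r x\<close> stay in the union: they
    are constant on \<open>A\<close>, and elsewhere they lie in the convex simplex.\<close>
  have "homotopic_with_canon (\<lambda>x. True) (A \<union> simplex_on F) (A \<union> simplex_on F) id r"
  proof (rule homotopic_straight_line[OF r_cont])
    fix t :: real and x assume t: "t \<in> {0..1}" and x: "x \<in> A \<union> simplex_on F"
    show "(\<lambda>v. (1 - t) * x v + t * r x v) \<in> A \<union> simplex_on F"
    proof (cases "x \<in> A")
      case True
      then show ?thesis
        by (simp add: r_def algebra_simps)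
    next
      case False
      then show ?thesis
        using x simplex_on_convex[OF _ _ t, of x F "\<rho> x"] \<rho>_in by (simp add: r_def)
    qed
  qed
  moreover have "retraction_maps (top_of_set (A \<union> simplex_on F)) (top_of_set A) r id"
    using r_cont \<rho>_in by (auto simp: retraction_maps_def r_def continuous_on_id)
  ultimately have "top_of_set (A \<union> simplex_on F) homotopy_equivalent_space top_of_set A"
    using deformation_retract_imp_homotopy_equivalent_space homotopic_with_sym by blast
  then show ?thesis
    using A(1) homotopy_equivalent_space_contractibility contractible_space_top_of_set by blast
qed

section \<open>A simplex with collapsed boundary\<close>

text \<open>With \<open>q\<close> the squared norm of a vector \<open>u\<close>, this is the
  equation of the unit sphere for the point
  \<open>(q - m\<^sup>2, 2 m u) / (q + m\<^sup>2)\<close>.\<close>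

lemma simplex_to_sphere_identity:
  fixes m q :: real
  assumes "q + m\<^sup>2 > 0"
  shows "((q - m\<^sup>2) / (q + m\<^sup>2))\<^sup>2 + 4 * m\<^sup>2 * q / (q + m\<^sup>2)\<^sup>2 = 1"
proof -
  have "((q - m\<^sup>2) / (q + m\<^sup>2))\<^sup>2 + 4 * m\<^sup>2 * q / (q + m\<^sup>2)\<^sup>2
      = ((q - m\<^sup>2)\<^sup>2 + 4 * m\<^sup>2 * q) / (q + m\<^sup>2)\<^sup>2"
    by (simp add: power_divide add_divide_distrib)
  also have "(q - m\<^sup>2)\<^sup>2 + 4 * m\<^sup>2 * q = (q + m\<^sup>2)\<^sup>2"
    by (simp add: power2_eq_square algebra_simps)
  finally show ?thesis
    using assms by simp
qed

lemma in_nsphere_iff: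
  "z \<in> topspace (nsphere d) \<longleftrightarrow> (z 0)\<^sup>2 + (\<Sum>i=1..d. (z i)\<^sup>2) = 1 \<and> (\<forall>i>d. z i = 0)"
proof -
  have "(\<Sum>i\<le>d. (z i)\<^sup>2) = (z 0)\<^sup>2 + (\<Sum>i=1..d. (z i)\<^sup>2)"
    by (simp add: atMost_atLeast0 sum.atLeast_Suc_atMost)
  then show ?thesis
    by (auto simp: nsphere)
qed

lemma nsphere_base_iff:
  assumes "z \<in> topspace (nsphere d)"
  shows "z = (\<lambda>j. if j = 0 then 1 else 0) \<longleftrightarrow> z 0 = 1"
proof
  assume z: "z 0 = 1"
  then have "(\<Sum>i=1..d. (z i)\<^sup>2) = 0" and gt: "\<forall>i>d. z i = 0"
    using assms by (auto simp: in_nsphere_iff)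
  then have "\<forall>i\<in>{1..d}. (z i)\<^sup>2 = 0"
    by (subst (asm) sum_nonneg_eq_0_iff) auto
  then have "z i = 0" if "i \<noteq> 0" for i
    using gt that by (cases "i \<le> d") auto
  with z show "z = (\<lambda>j. if j = 0 then 1 else 0)"
    by auto
qed simp

text \<open>
  With \<open>m\<close> the least coordinate of \<open>x\<close> and \<open>u\<close> the offset of \<open>x\<close> from the barycentre, written in
  linear coordinates, \<open>u / m\<close> maps the open simplex bijectively onto Euclidean space. The map is
  inverse stereographic projection after that, with the denominators cleared so that it extends
  to the boundary, where \<open>m = 0\<close>.
\<close>

lemma simplex_to_sphere:
  fixes F :: "'v set"
  assumes F: "finite F" "card F = Suc d"
  defines "base \<equiv> (\<lambda>j::nat. if j = 0 then 1 else 0 :: real)"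
  obtains \<psi> where "continuous_map (top_of_set (simplex_on F)) (nsphere d) \<psi>"
    and "\<And>x. x \<in> simplex_on F \<Longrightarrow> \<psi> x = base \<longleftrightarrow> (\<exists>v\<in>F. x v = 0)"
    and "\<And>x y. \<lbrakk>x \<in> simplex_on F; y \<in> simplex_on F; \<psi> x = \<psi> y; \<psi> x \<noteq> base\<rbrakk> \<Longrightarrow> x = y"
    and "\<And>z. \<lbrakk>z \<in> topspace (nsphere d); z \<noteq> base\<rbrakk> \<Longrightarrow> \<exists>x\<in>simplex_on F. \<psi> x = z"
proof -
  obtain e where e: "bij_betw e {..d} F"
    using F by (metis card_atMost finite_atMost finite_same_card_bij)
  have eF: "e i \<in> F" if "i \<le> d" for i
    using e that by (auto simp: bij_betw_def)
  have Fe: "\<exists>i\<le>d. v = e i" if "v \<in> F" for v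
    using e that by (auto simp: bij_betw_def)
  have sum_e: "sum f F = (\<Sum>i\<le>d. f (e i))" for f :: "'v \<Rightarrow> real"
    using sum.reindex_bij_betw[OF e, of f] by simp
  have Fne: "F \<noteq> {}"
    using F by auto
  define m where "m x = Min (x ` F)" for x :: "'v \<Rightarrow> real"
  define u where "u x i = x (e i) - x (e 0)" for x :: "'v \<Rightarrow> real" and i
  define q where "q x = (\<Sum>i=1..d. (u x i)\<^sup>2)" for x
  define \<psi> where "\<psi> x j = (if j = 0 then (q x - (m x)\<^sup>2) / (q x + (m x)\<^sup>2)
      else if j \<le> d then 2 * m x * u x j / (q x + (m x)\<^sup>2) else 0)" for x and j :: nat
  have m0: "0 \<le> m x" "m x = 0 \<longleftrightarrow> (\<exists>v\<in>F. x v = 0)" if "x \<in> simplex_on F" for x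
    using simplex_on_Min_eq_0[OF that F(1) Fne] by (auto simp: m_def)
  have m_le: "m x \<le> x (e i)" if "i \<le> d" for x i
    using F eF[OF that] by (simp add: m_def)
  have m_ex: "\<exists>i\<le>d. m x = x (e i)" for x
  proof -
    have "m x \<in> x ` F"
      unfolding m_def using F Fne by (intro Min_in) auto
    then show ?thesis
      using Fe by blast
  qed
  have q0: "0 \<le> q x" for x
    by (simp add: q_def sum_nonneg)
  \<comment> \<open>The denominator vanishes only if all coordinates are equal and the least is
    \<open>0\<close>, which contradicts their sum being \<open>1\<close>.\<close>
  have N: "q x + (m x)\<^sup>2 > 0" if x: "x \<in> simplex_on F" for x
  proof (rule ccontr)
    assume "\<not> ?thesis"
    then have "q x = 0" "m x = 0"
      using q0[of x] zero_le_power2[of "m x"] zero_eq_power2[of "m x"] by linarith+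
    then have "\<forall>i\<in>{1..d}. (u x i)\<^sup>2 = 0"
      unfolding q_def by (subst (asm) sum_nonneg_eq_0_iff) auto
    then have c: "x (e i) = x (e 0)" if "i \<le> d" for i
      using that by (cases "i = 0") (auto simp: u_def)
    with m_ex[of x] \<open>m x = 0\<close> have "x (e i) = 0" if "i \<le> d" for i
      using that by metis
    then have "sum x F = 0"
      by (simp add: sum_e)
    then show False
      using x by (simp add: simplex_on_def)
  qed
  have in_sphere: "\<psi> x \<in> topspace (nsphere d)" if x: "x \<in> simplex_on F" for x
  proof -
    have "(\<Sum>i=1..d. (\<psi> x i)\<^sup>2) = (\<Sum>i=1..d. 4 * (m x)\<^sup>2 / (q x + (m x)\<^sup>2)\<^sup>2 * (u x i)\<^sup>2)"
      by (intro sum.cong) (auto simp: \<psi>_def power_divide power_mult_distrib)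
    also have "\<dots> = 4 * (m x)\<^sup>2 * q x / (q x + (m x)\<^sup>2)\<^sup>2"
      unfolding sum_distrib_left[symmetric] q_def[symmetric] by simp
    finally show ?thesis
      using simplex_to_sphere_identity[OF N[OF x]] by (simp add: in_nsphere_iff) (simp add: \<psi>_def)
  qed
  have base_iff: "\<psi> x = base \<longleftrightarrow> m x = 0" if x: "x \<in> simplex_on F" for x
  proof -
    have "\<psi> x = base \<longleftrightarrow> \<psi> x 0 = 1"
      unfolding base_def by (rule nsphere_base_iff[OF in_sphere[OF x]])
    also have "\<dots> \<longleftrightarrow> q x - (m x)\<^sup>2 = q x + (m x)\<^sup>2"
      using N[OF x] by (simp add: \<psi>_def)
    also have "\<dots> \<longleftrightarrow> m x = 0"
      by simp
    finally show ?thesis .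
  qed
  show thesis
  proof
    have m_cont: "continuous_on (simplex_on F) m"
      unfolding m_def using F(1) Fne
      by (intro continuous_on_Min continuous_on_coordinate[OF continuous_on_id])
    have u_cont: "continuous_on (simplex_on F) (\<lambda>x. u x i)" for i
      unfolding u_def by (intro continuous_on_diff continuous_on_coordinate[OF continuous_on_id])
    have q_cont: "continuous_on (simplex_on F) q"
      unfolding q_def by (intro continuous_on_sum continuous_on_power u_cont)
    have "continuous_on (simplex_on F) (\<lambda>x. \<psi> x j)" for j
    proof -
      have nz: "\<forall>x\<in>simplex_on F. q x + (m x)\<^sup>2 \<noteq> 0"
        using N by fastforce
      consider "j = 0" | "j \<noteq> 0" "j \<le> d" | "j \<noteq> 0" "\<not> j \<le> d"
        by blast
      then show ?thesis
        by cases (use nz in \<open>simp_all add: \<psi>_def m_cont u_cont q_cont continuous_on_divide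
          continuous_on_diff continuous_on_add continuous_on_mult continuous_on_power continuous_on_const\<close>)
    qed
    then have "continuous_on (simplex_on F) \<psi>"
      by (rule continuous_on_coordinatewise_then_product)
    then show "continuous_map (top_of_set (simplex_on F)) (nsphere d) \<psi>"
      using in_sphere
      by (auto simp: nsphere continuous_map_in_subtopology euclidean_product_topology)
  next
    show "\<psi> x = base \<longleftrightarrow> (\<exists>v\<in>F. x v = 0)" if "x \<in> simplex_on F" for x
      using that base_iff m0 by simp
  next
    fix x y assume x: "x \<in> simplex_on F" and y: "y \<in> simplex_on F"
      and eq: "\<psi> x = \<psi> y" and nb: "\<psi> x \<noteq> base"
    have mx: "m x > 0" and my: "m y > 0"
      using x y eq nb base_iff m0(1) by (metis less_eq_real_def)+
    define w where "w x i = u x i / m x" for x i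
    \<comment> \<open>Stereographic projection from the base point: it recovers \<open>u / m\<close>
      from the image.\<close>
    have w_eq: "w x i = \<psi> x i / (1 - \<psi> x 0)" if "x \<in> simplex_on F" "m x > 0" "1 \<le> i" "i \<le> d" for x i
    proof -
      have "1 - \<psi> x 0 = 2 * (m x)\<^sup>2 / (q x + (m x)\<^sup>2)"
        using N[OF that(1)] by (simp add: \<psi>_def field_simps)
      then show ?thesis
        using N[OF that(1)] that by (simp add: \<psi>_def w_def power2_eq_square)
    qed
    have ww: "w x i = w y i" if "i \<le> d" for i
      using w_eq[OF x mx, of i] w_eq[OF y my, of i] eq that
      by (cases "i = 0") (auto simp: w_def u_def)
    have wx: "x (e i) / m x = x (e 0) / m x + w x i" for x i
      by (simp add: w_def u_def diff_divide_distrib)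
    \<comment> \<open>After division by \<open>m\<close> the least coordinate of either point is
      \<open>1\<close>. At an index where \<open>x\<close> attains its minimum, the scaled
      \<open>y\<close> is therefore at least as large, and equal offsets carry this over to index
      \<open>0\<close>.\<close>
    have le: "x (e 0) / m x \<le> y (e 0) / m y" if mx: "m x > 0" and my: "m y > 0"
      and ww: "\<And>i. i \<le> d \<Longrightarrow> w x i = w y i" for x y
    proof -
      obtain i where i: "i \<le> d" "m x = x (e i)"
        using m_ex by blast
      then have "x (e i) / m x \<le> y (e i) / m y"
        using mx my m_le[OF i(1), of y] by simp
      then show ?thesis
        using wx[of x i] wx[of y i] ww[OF i(1)] by simp
    qed
    have "x (e 0) / m x = y (e 0) / m y"
      using le[OF mx my ww] le[OF my mx] ww by force
    then have "x (e i) / m x = y (e i) / m y" if "i \<le> d" for i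
      using wx[of x i] wx[of y i] ww[OF that] by simp
    then have div_eq: "x v / m x = y v / m y" if "v \<in> F" for v
      using that Fe by blast
    \<comment> \<open>Both coordinate sums are \<open>1\<close>, so proportional points have the
      same scale.\<close>
    then have "sum x F / m x = sum y F / m y"
      by (simp add: sum_divide_distrib)
    then have "m x = m y"
      using x y by (simp add: simplex_on_def)
    then have "x v = y v" if "v \<in> F" for v
      using div_eq[OF that] mx by simp
    then have "x v = y v" for v
      using x y by (cases "v \<in> F") (auto simp: simplex_on_def)
    then show "x = y"
      by blast
  next
    fix z assume z: "z \<in> topspace (nsphere d)" and nb: "z \<noteq> base"
    have ss: "(z 0)\<^sup>2 + (\<Sum>i=1..d. (z i)\<^sup>2) = 1"
      using z by (simp add: in_nsphere_iff)
    then have "(z 0)\<^sup>2 \<le> 1"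
      by (metis le_add_same_cancel1 sum_nonneg zero_le_power2)
    then have "z 0 \<le> 1"
      by (simp add: abs_square_le_1)
    then have z0: "z 0 < 1"
      using nb nsphere_base_iff[OF z] by (simp add: base_def less_le)
    \<comment> \<open>To invert: \<open>w\<close> is the stereographic image of \<open>z\<close>,
      with \<open>w 0 = 0\<close> because offsets are taken from the vertex \<open>e 0\<close>.
      Shifting by \<open>1 - \<mu>\<close> makes the least entry \<open>1\<close>, and dividing by
      \<open>T\<close> makes the sum \<open>1\<close>, so the least coordinate becomes
      \<open>1 / T\<close>.\<close>
    define w where "w i = (if i = 0 then 0 else z i / (1 - z 0))" for i
    define \<mu> where "\<mu> = Min (w ` {..d})"
    define T where "T = (\<Sum>i\<le>d. 1 + w i - \<mu>)"
    have \<mu>_le: "\<mu> \<le> w i" if "i \<le> d" for i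
      using that by (simp add: \<mu>_def)
    have T: "T > 0"
      unfolding T_def by (rule sum_pos) (use \<mu>_le in \<open>force+\<close>)
    define x where "x v = (if v \<in> F then (1 + w (the_inv_into {..d} e v) - \<mu>) / T else 0)" for v
    have xe: "x (e i) = (1 + w i - \<mu>) / T" if "i \<le> d" for i
      using that e eF by (simp add: x_def the_inv_into_f_f bij_betw_def)
    have xS: "x \<in> simplex_on F"
    proof -
      have "sum x F = 1"
        using T by (simp add: sum_e xe T_def flip: sum_divide_distrib)
      moreover have "0 \<le> x v" for v
        using Fe[of v] xe \<mu>_le T by (cases "v \<in> F") (force simp: x_def)+
      ultimately show ?thesis
        by (simp add: simplex_on_def x_def)
    qed
    have m: "m x = 1 / T"
    proof (rule antisym)
      have "\<mu> \<in> w ` {..d}"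
        unfolding \<mu>_def by (intro Min_in) auto
      then obtain i where "i \<le> d" "w i = \<mu>"
        by auto
      then show "m x \<le> 1 / T"
        using m_le[of i x] xe[of i] by simp
      obtain j where "j \<le> d" "m x = x (e j)"
        using m_ex by blast
      then show "1 / T \<le> m x"
        using xe[of j] \<mu>_le[of j] T by (simp add: divide_right_mono)
    qed
    have u: "u x i = w i / T" if "i \<le> d" for i
      using that xe[of i] xe[of 0] by (simp add: u_def w_def diff_divide_distrib add_divide_distrib)
    define Q where "Q = (\<Sum>i=1..d. (w i)\<^sup>2)"
    have q: "q x = Q / T\<^sup>2"
      by (simp add: q_def Q_def u power_divide sum_divide_distrib)
    have "Q = (\<Sum>i=1..d. (z i)\<^sup>2) / (1 - z 0)\<^sup>2"
      by (simp add: Q_def w_def power_divide sum_divide_distrib)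
    also have "\<dots> = (1 - (z 0)\<^sup>2) / (1 - z 0)\<^sup>2"
      using ss by (simp add: algebra_simps)
    also have "1 - (z 0)\<^sup>2 = (1 + z 0) * (1 - z 0)"
      by (simp add: power2_eq_square algebra_simps)
    also have "(1 + z 0) * (1 - z 0) / (1 - z 0)\<^sup>2 = (1 + z 0) / (1 - z 0)"
      using z0 by (simp add: power2_eq_square)
    finally have Q: "Q = (1 + z 0) / (1 - z 0)" .
    have Q1: "Q + 1 = 2 / (1 - z 0)" "Q - 1 = 2 * z 0 / (1 - z 0)"
      using z0 by (simp_all add: Q field_simps)
    have "q x + (m x)\<^sup>2 = (Q + 1) / T\<^sup>2" "q x - (m x)\<^sup>2 = (Q - 1) / T\<^sup>2"
      by (simp_all add: q m power_divide add_divide_distrib diff_divide_distrib)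
    then have \<psi>_x: "\<psi> x j = (if j = 0 then (Q - 1) / (Q + 1) else if j \<le> d then 2 * w j / (Q + 1) else 0)" for j
      using T u by (simp add: \<psi>_def m power2_eq_square)
    have "\<psi> x j = z j" for j
      unfolding \<psi>_x Q1 using z0 z by (auto simp: in_nsphere_iff w_def)
    then show "\<exists>x\<in>simplex_on F. \<psi> x = z"
      using xS by blast
  qed
qed

section \<open>Attaching simplices along their boundaries\<close>

lemma closed_Times_compare:
  fixes f :: "('v \<Rightarrow> real) \<Rightarrow> real"
  assumes "closed C" "continuous_on UNIV f"
  shows "closed {p \<in> C. fst p \<le> f (snd p)}" "closed {p \<in> C. f (snd p) \<le> fst p}"
proof -
  have "continuous_on UNIV (\<lambda>p :: real \<times> ('v \<Rightarrow> real). f (snd p))"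
    by (rule continuous_on_compose2[OF assms(2)]) (auto intro: continuous_on_snd continuous_on_id)
  then have "closed {p :: real \<times> ('v \<Rightarrow> real). fst p \<le> f (snd p)}"
    "closed {p :: real \<times> ('v \<Rightarrow> real). f (snd p) \<le> fst p}"
    by (auto intro!: closed_Collect_le continuous_on_fst continuous_on_id)
  then show "closed {p \<in> C. fst p \<le> f (snd p)}" "closed {p \<in> C. f (snd p) \<le> fst p}"
    using assms(1) by (auto simp: Collect_conj_eq)
qed

lemma contractible_obtain_contraction:
  assumes "contractible A" "A \<noteq> {}"
  obtains h a where "continuous_on ({0..1::real} \<times> A) h" "h ` ({0..1} \<times> A) \<subseteq> A"
    "a \<in> A" "\<And>x. x \<in> A \<Longrightarrow> h (0, x) = x" "\<And>x. x \<in> A \<Longrightarrow> h (1, x) = a"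
proof -
  obtain a h where h: "continuous_map (prod_topology (top_of_set {0..1::real}) (top_of_set A)) (top_of_set A) h"
    "\<And>x. x \<in> A \<Longrightarrow> h (0, x) = x" "\<And>x. x \<in> A \<Longrightarrow> h (1, x) = a"
    using assms(1) unfolding contractible_def
    by (auto simp: homotopic_with)
  then have c: "continuous_on ({0..1} \<times> A) h" "h ` ({0..1} \<times> A) \<subseteq> A"
    by (auto simp: prod_top_of_set)
  obtain x where "x \<in> A"
    using assms(2) by blast
  then have "h (1, x) \<in> h ` ({0..1} \<times> A)"
    by auto
  then have "a \<in> A"
    using c(2) h(3)[OF \<open>x \<in> A\<close>] by auto
  then show thesis
    using that c h(2,3) by blast
qed

text \<open>
  The homotopy extension property, with an explicit collar. Here \<open>\<mu> F\<close> is twice the least coordinate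
  relative to that of the barycentre. At time \<open>t\<close>, the points with \<open>\<mu> F x \<ge> t\<close> are pushed radially
  outwards by \<open>\<alpha>\<close>, so that those with \<open>\<mu> F x = t\<close> arrive at the boundary; the points with
  \<open>\<mu> F x \<le> t\<close> are projected to the boundary by \<open>\<gamma>\<close> and then follow the contraction of \<open>A\<close> for
  time \<open>t - \<mu> F x\<close>.
\<close>

lemma contraction_extends:
  fixes A :: "('v \<Rightarrow> real) set" and \<S> :: "'v set set"
  assumes A: "contractible A" "closed A" "A \<noteq> {}"
    and S: "finite \<S>" "\<And>F. F \<in> \<S> \<Longrightarrow> finite F" "\<And>F. F \<in> \<S> \<Longrightarrow> F \<noteq> {}"
    and AF: "\<And>F. F \<in> \<S> \<Longrightarrow> A \<inter> simplex_on F = {x \<in> simplex_on F. \<exists>v\<in>F. x v = 0}"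
  defines "X \<equiv> A \<union> (\<Union>F\<in>\<S>. simplex_on F)"
  obtains H a where "continuous_on ({0..1::real} \<times> X) H" "H ` ({0..1} \<times> X) \<subseteq> X"
    "\<And>x. x \<in> X \<Longrightarrow> H (0, x) = x" "\<And>x. x \<in> A \<Longrightarrow> H (1, x) = a"
    "\<And>t x. \<lbrakk>t \<in> {0..1}; x \<in> A\<rbrakk> \<Longrightarrow> H (t, x) \<in> A"
proof -
  obtain h a where h: "continuous_on ({0..1::real} \<times> A) h" "h ` ({0..1} \<times> A) \<subseteq> A"
    and h0: "\<And>x. x \<in> A \<Longrightarrow> h (0, x) = x" and h1: "\<And>x. x \<in> A \<Longrightarrow> h (1, x) = a"
    using contractible_obtain_contraction[OF A(1,3)] by metis
  define \<mu> where "\<mu> F x = 2 * card F * Min (x ` F)" for F :: "'v set" and x :: "'v \<Rightarrow> real"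
  define \<alpha> where "\<alpha> F = (\<lambda>(t :: real, x :: 'v \<Rightarrow> real) v.
      if v \<in> F then (x v - t / (2 * card F)) / (1 - t / 2) else 0)" for F
  define \<gamma> where "\<gamma> F = (\<lambda>(t :: real, x :: 'v \<Rightarrow> real). (t - \<mu> F x,
      \<lambda>v. if v \<in> F then (x v - Min (x ` F)) / (1 - card F * Min (x ` F)) else 0))" for F
  \<comment> \<open>A point outside \<open>A\<close> is interior to the only attached simplex that
    contains it, and its support names that simplex.\<close>
  define H where "H p = (if snd p \<in> A then h p else
      let F = {v. snd p v \<noteq> 0} in if fst p \<le> \<mu> F (snd p) then \<alpha> F p else h (\<gamma> F p))" for p
  define P where "P F = {p \<in> {0..1} \<times> simplex_on F. fst p \<le> \<mu> F (snd p)}" for F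
  define Q where "Q F = {p \<in> {0..1} \<times> simplex_on F. \<mu> F (snd p) \<le> fst p}" for F
  have Min_0: "Min (x ` F) = 0 \<longleftrightarrow> x \<in> A" "0 \<le> Min (x ` F)" if "F \<in> \<S>" "x \<in> simplex_on F" for x F
    using simplex_on_Min_eq_0[OF that(2) S(2,3)[OF that(1)]] AF[OF that(1)] that(2) by auto
  have supp: "{v. x v \<noteq> 0} = F" if "F \<in> \<S>" "x \<in> simplex_on F" "x \<notin> A" for x F
    using AF[OF that(1)] that by (auto simp: simplex_on_def)
  have card: "0 < card F" if "F \<in> \<S>" for F
    using S that by (simp add: card_gt_0_iff)
  have \<alpha>_in: "\<alpha> F p \<in> simplex_on F" if F: "F \<in> \<S>" and p: "p \<in> P F" for p F
  proof -
    obtain t x where tx: "p = (t, x)" "t \<in> {0..1}" "x \<in> simplex_on F" "t \<le> \<mu> F x"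
      using p by (auto simp: P_def)
    have "t / (2 * card F) \<le> x v" if "v \<in> F" for v
    proof -
      have "t / (2 * card F) \<le> Min (x ` F)"
        using tx(4) card[OF F] by (simp add: \<mu>_def divide_le_eq mult.commute mult.left_commute)
      also have "\<dots> \<le> x v"
        using that S(2)[OF F] by simp
      finally show ?thesis .
    qed
    then have "0 \<le> \<alpha> F p v" for v
      using tx by (simp add: \<alpha>_def)
    moreover have "sum (\<alpha> F p) F = (\<Sum>v\<in>F. x v - t / (2 * card F)) / (1 - t / 2)"
      by (simp add: tx(1) \<alpha>_def sum_divide_distrib)
    moreover have "(\<Sum>v\<in>F. x v - t / (2 * card F)) = 1 - t / 2"
      using tx(3) card[OF F] by (simp add: sum_subtractf simplex_on_def)
    ultimately show ?thesis
      using tx by (simp add: simplex_on_def \<alpha>_def)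
  qed
  have \<gamma>_in: "\<gamma> F p \<in> {0..1} \<times> A" if F: "F \<in> \<S>" and p: "p \<in> Q F" for p F
  proof -
    obtain t x where tx: "p = (t, x)" "t \<in> {0..1}" "x \<in> simplex_on F" "\<mu> F x \<le> t"
      using p by (auto simp: Q_def)
    define m where "m = Min (x ` F)"
    have m: "0 \<le> m" "2 * card F * m \<le> t"
      using Min_0(2)[OF F tx(3)] tx(4) by (auto simp: m_def \<mu>_def)
    then have cm: "card F * m < 1"
      using tx(2) by simp
    define y where "y v = (if v \<in> F then (x v - m) / (1 - card F * m) else 0)" for v
    have "sum y F = (\<Sum>v\<in>F. x v - m) / (1 - card F * m)"
      by (simp add: y_def sum_divide_distrib)
    also have "(\<Sum>v\<in>F. x v - m) = 1 - card F * m"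
      using tx(3) by (simp add: sum_subtractf simplex_on_def)
    finally have "sum y F = 1"
      using cm by simp
    moreover have "0 \<le> y v" for v
      using cm S(2)[OF F] by (simp add: y_def m_def)
    ultimately have "y \<in> simplex_on F"
      by (simp add: simplex_on_def y_def)
    moreover have "\<exists>v\<in>F. y v = 0"
    proof -
      have "m \<in> x ` F"
        unfolding m_def using S(2,3)[OF F] by (intro Min_in) auto
      then show ?thesis
        by (auto simp: y_def)
    qed
    ultimately have "y \<in> A"
      using AF[OF F] by blast
    moreover have "\<gamma> F p = (t - 2 * card F * m, y)"
      by (auto simp: tx(1) \<gamma>_def \<mu>_def y_def m_def)
    moreover have "0 \<le> 2 * card F * m"
      using m(1) by simp
    moreover have "0 \<le> t" "t \<le> 1"
      using tx(2) by auto
    ultimately have "\<gamma> F p = (t - 2 * card F * m, y)" "y \<in> A"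
      "0 \<le> t - 2 * card F * m" "t - 2 * card F * m \<le> 1"
      using m(2) by linarith+
    then show ?thesis
      by (simp only: mem_Times_iff fst_conv snd_conv atLeastAtMost_iff simp_thms)
  qed
  have H_A: "H p = h p" if "p \<in> {0..1} \<times> A" for p
    using that by (auto simp: H_def)
  have H_P: "H p = \<alpha> F p" if F: "F \<in> \<S>" and p: "p \<in> P F" for p F
  proof (cases "snd p \<in> A")
    case True
    obtain t x where tx: "p = (t, x)" "t \<in> {0..1}" "x \<in> simplex_on F" "t \<le> \<mu> F x"
      using p by (auto simp: P_def)
    have "\<mu> F x = 0"
      using Min_0(1)[OF F tx(3)] True tx(1) by (simp add: \<mu>_def)
    then have "p = (0, x)"
      using tx by simp
    moreover have "\<alpha> F (0, x) = x"
      using tx(3) by (auto simp: \<alpha>_def simplex_on_def)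
    ultimately show ?thesis
      using True h0 by (simp add: H_def)
  next
    case False
    then show ?thesis
      using supp[OF F _ False] p by (auto simp: H_def P_def)
  qed
  have H_Q: "H p = h (\<gamma> F p)" if F: "F \<in> \<S>" and p: "p \<in> Q F" for p F
  proof -
    obtain t x where tx: "p = (t, x)" "t \<in> {0..1}" "x \<in> simplex_on F" "\<mu> F x \<le> t"
      using p by (auto simp: Q_def)
    consider "x \<in> A" | "x \<notin> A" "t = \<mu> F x" | "x \<notin> A" "\<mu> F x < t"
      using tx(4) by fastforce
    then show ?thesis
    proof cases
      case 1
      then have "Min (x ` F) = 0"
        using Min_0(1)[OF F tx(3)] by simp
      then have "\<gamma> F p = p"
        using tx(1,3) by (auto simp: \<gamma>_def \<mu>_def simplex_on_def)
      then show ?thesis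
        using 1 tx(1) by (simp add: H_def)
    next
      \<comment> \<open>On the interface \<open>t = \<mu> F x\<close> both formulas give the radial
        projection to the boundary, since \<open>h\<close> is the identity at time
        \<open>0\<close>.\<close>
      case 2
      have pP: "p \<in> P F"
        using tx 2 by (simp add: P_def)
      have t: "t / 2 = card F * Min (x ` F)" "t / (2 * card F) = Min (x ` F)"
        using 2(2) card[OF F] by (simp_all add: \<mu>_def)
      have "\<alpha> F p = snd (\<gamma> F p)"
        unfolding tx(1) \<alpha>_def \<gamma>_def prod.case snd_conv t by (rule refl)
      moreover have "fst (\<gamma> F p) = 0"
        using 2(2) by (simp add: tx(1) \<gamma>_def)
      ultimately have "\<alpha> F p = snd (\<gamma> F p)" "fst (\<gamma> F p) = 0"
        by blast+
      then show ?thesis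
        using H_P[OF F pP] \<gamma>_in[OF F p] h0 by (cases "\<gamma> F p") auto
    next
      case 3
      then show ?thesis
        using supp[OF F tx(3)] by (simp add: H_def tx(1))
    qed
  qed
  have coord: "continuous_on C (\<lambda>p. snd p v)" for C :: "(real \<times> ('v \<Rightarrow> real)) set" and v
    by (rule continuous_on_coordinate[OF continuous_on_snd[OF continuous_on_id]])
  have Min_cont: "continuous_on UNIV (\<lambda>x :: 'v \<Rightarrow> real. Min (x ` F))" if "F \<in> \<S>" for F
    using S(2,3)[OF that] by (intro continuous_on_Min continuous_on_coordinate[OF continuous_on_id])
  have \<mu>_cont: "continuous_on UNIV (\<mu> F)" if "F \<in> \<S>" for F
    unfolding \<mu>_def by (intro continuous_on_mult continuous_on_const Min_cont[OF that])
  have Min_cont2: "continuous_on C (\<lambda>p. Min (snd p ` F))" if "F \<in> \<S>"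
    for C :: "(real \<times> ('v \<Rightarrow> real)) set" and F
    by (rule continuous_on_compose2[OF Min_cont[OF that]]) (auto intro: continuous_on_snd continuous_on_id)
  have \<alpha>_cont: "continuous_on (P F) (\<alpha> F)" if F: "F \<in> \<S>" for F
  proof (rule continuous_on_coordinatewise_then_product)
    fix v
    have "\<forall>p\<in>P F. 1 - fst p / 2 \<noteq> 0"
      by (auto simp: P_def)
    then have "continuous_on (P F) (\<lambda>p. (snd p v - fst p / (2 * card F)) / (1 - fst p / 2))"
      using card[OF F]
      by (intro continuous_on_divide continuous_on_diff continuous_on_const coord
          continuous_on_fst continuous_on_id) auto
    then show "continuous_on (P F) (\<lambda>p. \<alpha> F p v)"
      by (cases "v \<in> F") (simp_all add: \<alpha>_def case_prod_unfold continuous_on_const)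
  qed
  have \<gamma>_cont: "continuous_on (Q F) (\<gamma> F)" if F: "F \<in> \<S>" for F
  proof -
    have "1 - real (card F) * Min (snd p ` F) \<noteq> 0" if "p \<in> Q F" for p
    proof -
      have "2 * real (card F) * Min (snd p ` F) \<le> 1"
        using that by (auto simp: Q_def \<mu>_def)
      then show ?thesis
        by linarith
    qed
    then have "continuous_on (Q F)
        (\<lambda>p. (snd p v - Min (snd p ` F)) / (1 - real (card F) * Min (snd p ` F)))" for v
      by (intro continuous_on_divide continuous_on_diff continuous_on_const coord
          continuous_on_mult Min_cont2[OF F]) auto
    then have "continuous_on (Q F) (\<lambda>p. if v \<in> F
        then (snd p v - Min (snd p ` F)) / (1 - real (card F) * Min (snd p ` F)) else 0)" for v
      by (cases "v \<in> F") (simp_all add: continuous_on_const)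
    then have "continuous_on (Q F) (\<lambda>p v. if v \<in> F
        then (snd p v - Min (snd p ` F)) / (1 - real (card F) * Min (snd p ` F)) else 0)"
      by (rule continuous_on_coordinatewise_then_product)
    then show ?thesis
      unfolding \<gamma>_def \<mu>_def case_prod_unfold
      by (intro continuous_on_Pair continuous_on_diff continuous_on_mult continuous_on_const
          continuous_on_fst continuous_on_id Min_cont2[OF F])
  qed
  let ?\<C> = "insert ({0..1} \<times> A) (P ` \<S> \<union> Q ` \<S>)"
  have cover: "{0..1} \<times> X = (\<Union>C\<in>?\<C>. C)"
  proof -
    have "P F \<union> Q F = {0..1} \<times> simplex_on F" for F
      by (auto simp: P_def Q_def)
    moreover have "(\<Union>C\<in>?\<C>. C) = {0..1} \<times> A \<union> (\<Union>F\<in>\<S>. P F \<union> Q F)"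
      by auto
    ultimately show ?thesis
      by (auto simp: X_def)
  qed
  \<comment> \<open>The three formulas hold on finitely many closed pieces that cover
    \<open>{0..1} \<times> X\<close>, so continuity may be checked on each piece.\<close>
  have "continuous_on (\<Union>C\<in>?\<C>. C) H"
  proof (rule continuous_on_closed_Union)
    show "finite ?\<C>"
      using S(1) by simp
  next
    fix C assume C: "C \<in> ?\<C>"
    have "closed ({0..1::real} \<times> simplex_on F)" for F :: "'v set"
      by (intro closed_Times closed_simplex_on) simp
    then have "closed (P F)" "closed (Q F)" if "F \<in> \<S>" for F
      unfolding P_def Q_def using that by (blast intro: closed_Times_compare \<mu>_cont)+
    moreover have "closed ({0..1::real} \<times> A)"
      using A(2) by (intro closed_Times) simp
    ultimately show "closed C"
      using C by blast
    have "continuous_on ({0..1} \<times> A) H"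
      using h(1) H_A by (simp cong: continuous_on_cong)
    moreover have "continuous_on (P F) H" if "F \<in> \<S>" for F
      using \<alpha>_cont H_P that by (simp cong: continuous_on_cong)
    moreover have "continuous_on (Q F) H" if "F \<in> \<S>" for F
    proof -
      have "continuous_on (Q F) (\<lambda>p. h (\<gamma> F p))"
        by (rule continuous_on_compose2[OF h(1) \<gamma>_cont[OF that]]) (use \<gamma>_in[OF that] in blast)
      then show ?thesis
        using H_Q that by (simp cong: continuous_on_cong)
    qed
    ultimately show "continuous_on C H"
      using C by blast
  qed
  then have Hc: "continuous_on ({0..1} \<times> X) H"
    by (simp only: cover)
  have "H p \<in> X" if p: "p \<in> C" and "C \<in> ?\<C>" for p C
  proof -
    consider "C = {0..1} \<times> A" | F where "F \<in> \<S>" "C = P F" | F where "F \<in> \<S>" "C = Q F"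
      using \<open>C \<in> ?\<C>\<close> by blast
    then show ?thesis
    proof cases
      case 1
      then have "H p \<in> A"
        using H_A h(2) p by auto
      then show ?thesis
        by (simp add: X_def)
    next
      case 2
      then have "H p \<in> simplex_on F"
        using H_P \<alpha>_in p by simp
      with 2 show ?thesis
        by (auto simp: X_def)
    next
      case 3
      then have "\<gamma> F p \<in> {0..1} \<times> A"
        using \<gamma>_in p by simp
      then have "h (\<gamma> F p) \<in> A"
        using h(2) by (rule image_subset_iff[THEN iffD1, rule_format, rotated])
      then show ?thesis
        using 3 H_Q p by (simp add: X_def)
    qed
  qed
  then have "H ` ({0..1} \<times> X) \<subseteq> X"
    unfolding cover by blast
  moreover have "H (0, x) = x" if "x \<in> X" for x
  proof (cases "x \<in> A")
    case True
    then show ?thesis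
      using h0 by (simp add: H_def)
  next
    case False
    then obtain F where F: "F \<in> \<S>" "x \<in> simplex_on F"
      using \<open>x \<in> X\<close> by (auto simp: X_def)
    then have "(0, x) \<in> P F"
      using Min_0(2) by (simp add: P_def \<mu>_def)
    then show ?thesis
      using H_P[OF F(1)] F(2) by (auto simp: \<alpha>_def simplex_on_def)
  qed
  moreover have "H (1, x) = a" if "x \<in> A" for x
    using that h1 by (simp add: H_def)
  moreover have "H (t, x) \<in> A" if "t \<in> {0..1}" "x \<in> A" for t x
    using that h(2) by (auto simp: H_def)
  ultimately show thesis
    using that Hc by blast
qed

text \<open>The map \<open>q\<close> sends \<open>A\<close> to the base point and the interior of
  each simplex bijectively onto a punctured sphere. Its only fibre with possibly more than one point
  is \<open>A\<close>, which the extended contraction keeps inside itself and finally moves to one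
  point.\<close>

lemma contractible_Un_simplices_wedge:
  fixes A :: "('v \<Rightarrow> real) set" and \<S> :: "'v set set"
  assumes A: "contractible A" "closed A" "compact A" "A \<noteq> {}"
    and S: "finite \<S>" "\<S> \<noteq> {}" "\<And>F. F \<in> \<S> \<Longrightarrow> finite F" "\<And>F. F \<in> \<S> \<Longrightarrow> card F = Suc d"
    and AF: "\<And>F. F \<in> \<S> \<Longrightarrow> A \<inter> simplex_on F = {x \<in> simplex_on F. \<exists>v\<in>F. x v = 0}"
  shows "top_of_set (A \<union> (\<Union>F\<in>\<S>. simplex_on F)) homotopy_equivalent_space
    wedge_of_spheres (card \<S>) (int d)"
proof -
  define base :: "nat \<Rightarrow> real" where "base = (\<lambda>j. if j = 0 then 1 else 0)"
  define X where "X = A \<union> (\<Union>F\<in>\<S>. simplex_on F)"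
  define W where "W = wedge {..<card \<S>} (\<lambda>_. nsphere d) (\<lambda>_. base)"
  have W: "wedge_of_spheres (card \<S>) (int d) = W"
    by (simp add: wedge_of_spheres_def W_def base_def sphere_of_dim_def)
  have I: "{..<card \<S>} \<noteq> {}"
    using S(1,2) by (simp add: card_gt_0_iff lessThan_empty_iff)
  have base_in: "base \<in> topspace (nsphere d)"
    unfolding base_def by (rule in_topspace_nsphere)
  have W_space: "topspace W = insert None {Some (i, z) | i z. i \<in> {..<card \<S>} \<and> z \<in> topspace (nsphere d) \<and> z \<noteq> base}"
    unfolding W_def by (rule topspace_wedge[OF I base_in])
  obtain idx where idx: "bij_betw idx \<S> {..<card \<S>}"
    using ex_bij_betw_finite_nat[OF S(1)] by (auto simp: atLeast0LessThan)
  have Fne: "F \<noteq> {}" if "F \<in> \<S>" for F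
    using S(4)[OF that] by auto
  \<comment> \<open>Bundling the properties lets one choice provide a sphere map for all facets at
    once.\<close>
  define good where "good F \<psi> \<longleftrightarrow> continuous_map (top_of_set (simplex_on F)) (nsphere d) \<psi> \<and>
      (\<forall>x\<in>simplex_on F. \<psi> x = base \<longleftrightarrow> (\<exists>v\<in>F. x v = 0)) \<and>
      (\<forall>x\<in>simplex_on F. \<forall>y\<in>simplex_on F. \<psi> x = \<psi> y \<longrightarrow> \<psi> x \<noteq> base \<longrightarrow> x = y) \<and>
      (\<forall>z\<in>topspace (nsphere d). z \<noteq> base \<longrightarrow> (\<exists>x\<in>simplex_on F. \<psi> x = z))"
    for F :: "'v set" and \<psi>
  have "\<forall>F\<in>\<S>. \<exists>\<psi>. good F \<psi>"
  proof
    fix F assume "F \<in> \<S>"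
    then have F: "finite F" "card F = Suc d"
      using S by auto
    show "\<exists>\<psi>. good F \<psi>"
    proof (rule simplex_to_sphere[OF F, folded base_def])
      fix \<psi>
      assume 1: "continuous_map (top_of_set (simplex_on F)) (nsphere d) \<psi>"
        and 2: "\<And>x. x \<in> simplex_on F \<Longrightarrow> \<psi> x = base \<longleftrightarrow> (\<exists>v\<in>F. x v = 0)"
        and 3: "\<And>x y. \<lbrakk>x \<in> simplex_on F; y \<in> simplex_on F; \<psi> x = \<psi> y; \<psi> x \<noteq> base\<rbrakk> \<Longrightarrow> x = y"
        and 4: "\<And>z. \<lbrakk>z \<in> topspace (nsphere d); z \<noteq> base\<rbrakk> \<Longrightarrow> \<exists>x\<in>simplex_on F. \<psi> x = z"
      show "\<exists>\<psi>. good F \<psi>"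
        unfolding good_def
        by (intro exI[of _ \<psi>] conjI ballI impI)
           (rule 1, rule 2, assumption, rule 3, assumption+, rule 4, assumption+)
    qed
  qed
  from bchoice[OF this] obtain \<psi> where \<psi>: "\<And>F. F \<in> \<S> \<Longrightarrow> good F (\<psi> F)"
    by blast
  have \<psi>_cont: "continuous_map (top_of_set (simplex_on F)) (nsphere d) (\<psi> F)" if "F \<in> \<S>" for F
    using \<psi>[OF that] unfolding good_def by (elim conjE)
  have \<psi>_base: "\<psi> F x = base \<longleftrightarrow> (\<exists>v\<in>F. x v = 0)" if "F \<in> \<S>" "x \<in> simplex_on F" for F x
    using \<psi>[OF that(1)] that(2) unfolding good_def by (elim conjE) blast
  have \<psi>_inj: "x = y" if "F \<in> \<S>" "x \<in> simplex_on F" "y \<in> simplex_on F" "\<psi> F x = \<psi> F y" "\<psi> F x \<noteq> base" for F x y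
    using \<psi>[OF that(1)] that(2-) unfolding good_def by (elim conjE) blast
  have \<psi>_surj: "\<exists>x\<in>simplex_on F. \<psi> F x = z" if "F \<in> \<S>" "z \<in> topspace (nsphere d)" "z \<noteq> base" for F z
    using \<psi>[OF that(1)] that(2-) unfolding good_def by (elim conjE) blast
  have \<psi>_A: "\<psi> F x = base \<longleftrightarrow> x \<in> A" if "F \<in> \<S>" "x \<in> simplex_on F" for F x
    using \<psi>_base[OF that] AF[OF that(1)] that(2) by blast
  have supp: "{v. x v \<noteq> 0} = F" if "F \<in> \<S>" "x \<in> simplex_on F" "x \<notin> A" for x F
    using AF[OF that(1)] that by (auto simp: simplex_on_def)
  define q where "q x = (if x \<in> A then None else Some (idx {v. x v \<noteq> 0}, \<psi> {v. x v \<noteq> 0} x))" for x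
  have q_eq: "q x = (if \<psi> F x = base then None else Some (idx F, \<psi> F x))"
    if "F \<in> \<S>" "x \<in> simplex_on F" for x F
    using \<psi>_A[OF that] supp[OF that] by (simp add: q_def)
  have q_inj: "x = y \<or> x \<in> A \<and> y \<in> A" if xy: "x \<in> X" "y \<in> X" and "q x = q y" for x y
  proof (cases "x \<in> A \<or> y \<in> A")
    case True
    then show ?thesis
      using \<open>q x = q y\<close> by (auto simp: q_def split: if_splits)
  next
    case False
    then obtain F G where F: "F \<in> \<S>" "x \<in> simplex_on F" and G: "G \<in> \<S>" "y \<in> simplex_on G"
      using xy by (auto simp: X_def)
    have "Some (idx F, \<psi> F x) = Some (idx G, \<psi> G y)"
      using \<open>q x = q y\<close> q_eq[OF F] q_eq[OF G] \<psi>_A[OF F] \<psi>_A[OF G] False by simp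
    moreover from this have "F = G"
      using idx F(1) G(1) by (auto simp: bij_betw_def inj_on_def)
    ultimately show ?thesis
      using \<psi>_inj[OF F(1,2)] G \<psi>_A[OF F] False by simp
  qed
  \<comment> \<open>\<open>A\<close> and the attached simplices are finitely many closed pieces; on
    a simplex, \<open>q\<close> is its sphere map followed by the inclusion into the wedge.\<close>
  have q_cont: "continuous_map (top_of_set X) W q"
  proof (rule pasting_lemma_closed[where I = "insert A (simplex_on ` \<S>)" and T = "\<lambda>T. T" and f = "\<lambda>_. q"])
    show "finite (insert A (simplex_on ` \<S>))"
      using S(1) by simp
    show "closedin (top_of_set X) T" if "T \<in> insert A (simplex_on ` \<S>)" for T
      using that A(2) closed_simplex_on by (intro closed_subset) (auto simp: X_def)
    show "\<exists>T. T \<in> insert A (simplex_on ` \<S>) \<and> x \<in> T \<and> q x = q x" if "x \<in> topspace (top_of_set X)" for x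
      using that by (auto simp: X_def)
    fix T assume T: "T \<in> insert A (simplex_on ` \<S>)"
    have "continuous_map (top_of_set A) W q"
    proof (rule continuous_map_eq)
      show "continuous_map (top_of_set A) W (\<lambda>x. None)"
        using W_space by simp
    qed (simp add: q_def)
    moreover have "continuous_map (top_of_set (simplex_on F)) W q" if F: "F \<in> \<S>" for F
    proof -
      have i: "idx F \<in> {..<card \<S>}"
        using idx F by (auto simp: bij_betw_def)
      have "continuous_map (top_of_set (simplex_on F)) W
          ((\<lambda>z. if z = base then None else Some (idx F, z)) \<circ> \<psi> F)"
        unfolding W_def
        by (rule continuous_map_compose[OF \<psi>_cont[OF F] continuous_map_into_wedge[OF i]])
      then show ?thesis
        by (rule continuous_map_eq) (use q_eq[OF F] in simp)
    qed
    moreover have "X \<inter> T = T"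
      using T by (auto simp: X_def)
    ultimately show "continuous_map (subtopology (top_of_set X) T) W q"
      using T by (auto simp: subtopology_subtopology)
  qed simp
  have q_surj: "q ` X = topspace W"
  proof
    show "q ` X \<subseteq> topspace W"
      using continuous_map_image_subset_topspace[OF q_cont] by simp
    show "topspace W \<subseteq> q ` X"
    proof
      fix w assume "w \<in> topspace W"
      then consider "w = None" | i z where "w = Some (i, z)" "i < card \<S>" "z \<in> topspace (nsphere d)" "z \<noteq> base"
        by (auto simp: W_space)
      then show "w \<in> q ` X"
      proof cases
        case 1
        obtain x where "x \<in> A"
          using A(4) by blast
        then have "x \<in> X" "q x = w"
          using 1 by (auto simp: X_def q_def)
        then show ?thesis
          by blast
      next
        case 2
        then have "i \<in> idx ` \<S>"
          using idx by (simp add: bij_betw_def)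
        then obtain F where F: "F \<in> \<S>" "idx F = i"
          by blast
        obtain x where x: "x \<in> simplex_on F" "\<psi> F x = z"
          using \<psi>_surj[OF F(1) 2(3,4)] by blast
        then have "q x = w" "x \<in> X"
          using q_eq[OF F(1) x(1)] 2 F by (auto simp: X_def)
        then show ?thesis
          by blast
      qed
    qed
  qed
  obtain H a where H: "continuous_on ({0..1::real} \<times> X) H" "H ` ({0..1} \<times> X) \<subseteq> X"
    and H0: "\<And>x. x \<in> X \<Longrightarrow> H (0, x) = x" and H1: "\<And>x. x \<in> A \<Longrightarrow> H (1, x) = a"
    and HA: "\<And>t x. \<lbrakk>t \<in> {0..1}; x \<in> A\<rbrakk> \<Longrightarrow> H (t, x) \<in> A"
    using contraction_extends[OF A(1,2,4) S(1,3) Fne AF] unfolding X_def by metis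
  have "top_of_set X homotopy_equivalent_space W"
  proof (rule quotient_homotopy_equivalence[where q = q and H = H])
    have "compact (\<Union>F\<in>\<S>. simplex_on F)"
      using S by (intro compact_UN) (auto intro: compact_simplex_on)
    then have "compact X"
      unfolding X_def using A(3) by (intro compact_Un)
    then show "compact_space (top_of_set X)"
      by (simp add: compact_space_subtopology)
    show "Hausdorff_space W"
      unfolding W_def
      by (rule Hausdorff_space_wedge[OF I base_in continuous_map_nsphere_projection])
    show "continuous_map (top_of_set X) W q" "q ` topspace (top_of_set X) = topspace W"
      using q_cont q_surj by simp_all
    show "continuous_map (prod_topology (top_of_set {0..1}) (top_of_set X)) (top_of_set X) H"
      using H by (auto simp: prod_top_of_set)
    show "H (0, x) = x" if "x \<in> topspace (top_of_set X)" for x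
      using that H0 by simp
    show "H (1, x) = H (1, y)" if "x \<in> topspace (top_of_set X)" "y \<in> topspace (top_of_set X)" "q x = q y" for x y
      using q_inj[of x y] that H1 by auto
    show "q (H (t, x)) = q (H (t, y))" if t: "t \<in> {0..1}" and x: "x \<in> topspace (top_of_set X)"
      and y: "y \<in> topspace (top_of_set X)" and eq: "q x = q y" for t x y
    proof -
      consider "x = y" | "x \<in> A" "y \<in> A"
        using q_inj[OF _ _ eq] x y by auto
      then show ?thesis
        by cases (use HA[OF t] in \<open>simp_all add: q_def\<close>)
    qed
  qed
  then show ?thesis
    by (simp add: W X_def)
qed

section \<open>The homotopy type of a shellable complex\<close>

lemma geom_realization_eq:
  assumes "abs_complex K"
  shows "geom_realization K = top_of_set (\<Union>F\<in>K. simplex_on F)"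
proof -
  have "{x. (\<forall>v. 0 \<le> x v) \<and> {v. x v \<noteq> 0} \<in> K \<and> (\<Sum>v | x v \<noteq> 0. x v) = 1} = (\<Union>F\<in>K. simplex_on F)"
    (is "?S = ?T")
  proof
    show "?S \<subseteq> ?T"
    proof
      fix x assume "x \<in> ?S"
      then have "x \<in> simplex_on {v. x v \<noteq> 0}" "{v. x v \<noteq> 0} \<in> K"
        by (auto simp: simplex_on_def)
      then show "x \<in> ?T"
        by blast
    qed
    show "?T \<subseteq> ?S"
    proof
      fix x assume "x \<in> ?T"
      then obtain F where F: "F \<in> K" "x \<in> simplex_on F"
        by blast
      then have "finite F" "Pow F \<subseteq> K"
        using assms by (auto simp: abs_complex_def)
      then have "{v. x v \<noteq> 0} \<in> K" "x \<in> simplex_on {v. x v \<noteq> 0}"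
        using simplex_on_support[OF F(2)] by auto
      then show "x \<in> ?S"
        by (auto simp: simplex_on_def)
    qed
  qed
  then show ?thesis
    by (simp add: geom_realization_def euclidean_product_topology)
qed

lemma abs_complex_facet_above:
  assumes "abs_complex K" "F \<in> K"
  obtains G where "G \<in> facets K" "F \<subseteq> G"
proof -
  obtain G where G: "G \<in> K" "F \<subseteq> G" "\<forall>H\<in>K. G \<subseteq> H \<longrightarrow> G = H"
    using finite_has_maximal2[of K F] assms by (auto simp: abs_complex_def)
  then have "G \<in> facets K"
    by (auto simp: facets_def)
  with G(2) show thesis
    by (rule that[rotated])
qed

lemma Union_simplex_on_facets:
  assumes "abs_complex K"
  shows "(\<Union>F\<in>K. simplex_on F) = (\<Union>F\<in>facets K. simplex_on F)"
proof
  show "(\<Union>F\<in>facets K. simplex_on F) \<subseteq> (\<Union>F\<in>K. simplex_on F)"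
    by (auto simp: facets_def)
  show "(\<Union>F\<in>K. simplex_on F) \<subseteq> (\<Union>F\<in>facets K. simplex_on F)"
  proof
    fix x assume "x \<in> (\<Union>F\<in>K. simplex_on F)"
    then obtain F where F: "F \<in> K" "x \<in> simplex_on F"
      by blast
    then obtain G where G: "G \<in> facets K" "F \<subseteq> G"
      using abs_complex_facet_above assms by metis
    then have "finite G"
      using assms by (auto simp: facets_def abs_complex_def)
    then show "x \<in> (\<Union>F\<in>facets K. simplex_on F)"
      using simplex_on_mono G F(2) by blast
  qed
qed

text \<open>
  The restriction of a facet is its smallest face that belongs to no earlier facet.
\<close>

definition shelling_restriction :: "'v set list \<Rightarrow> nat \<Rightarrow> 'v set" where
  "shelling_restriction Fs i = {v \<in> Fs ! i. Fs ! i - {v} \<in> shelling_intersection Fs i}"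

text \<open>By purity, every face of the intersection lies in one of the form
  \<open>Fs ! i - {v}\<close>, and the restriction collects exactly these \<open>v\<close>. For the
  first facet both sides are empty.\<close>

lemma shelling_intersection_restriction:
  assumes "is_shelling K Fs" "i < length Fs"
  shows "shelling_intersection Fs i = {G. G \<subseteq> Fs ! i \<and> \<not> shelling_restriction Fs i \<subseteq> G}"
proof (cases "i = 0")
  case True
  then show ?thesis
    by (auto simp: shelling_restriction_def shelling_intersection_def)
next
  case False
  let ?F = "Fs ! i" and ?J = "shelling_intersection Fs i"
  have pure: "pure_of_dim ?J (face_dim ?F - 1)"
    using assms False by (simp add: is_shelling_def)
  then have J: "abs_complex ?J"
    by (simp add: pure_of_dim_def)
  have "?F \<in> facets K"
    using assms by (metis is_shelling_def nth_mem)
  then have fin: "finite ?F"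
    using assms(1) by (auto simp: is_shelling_def pure_of_dim_def abs_complex_def facets_def)
  show ?thesis
  proof (intro equalityI subsetI CollectI)
    fix G assume G: "G \<in> ?J"
    then obtain M where M: "M \<in> facets ?J" "G \<subseteq> M"
      using abs_complex_facet_above[OF J] by metis
    then have "M \<subseteq> ?F" "M \<in> ?J"
      by (auto simp: facets_def shelling_intersection_def)
    have "face_dim M = face_dim ?F - 1"
      using pure M(1) by (simp add: pure_of_dim_def)
    then have "card (?F - M) = 1"
      using fin \<open>M \<subseteq> ?F\<close> by (simp add: face_dim_def card_Diff_subset finite_subset)
    then obtain v where v: "?F - M = {v}"
      by (rule card_1_singletonE)
    then have "M = ?F - {v}" "v \<in> ?F"
      using \<open>M \<subseteq> ?F\<close> by auto
    then have "v \<in> shelling_restriction Fs i" "v \<notin> G"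
      using \<open>M \<in> ?J\<close> M(2) by (auto simp: shelling_restriction_def)
    then show "G \<subseteq> ?F \<and> \<not> shelling_restriction Fs i \<subseteq> G"
      using \<open>M \<subseteq> ?F\<close> M(2) by blast
  next
    fix G assume "G \<in> {G. G \<subseteq> ?F \<and> \<not> shelling_restriction Fs i \<subseteq> G}"
    then obtain v where "G \<subseteq> ?F - {v}" "?F - {v} \<in> ?J"
      by (auto simp: shelling_restriction_def)
    then show "G \<in> ?J"
      using J by (auto simp: abs_complex_def)
  qed
qed

lemma homotopy_equivalent_contractible_spaces:
  assumes "contractible_space X" "contractible_space Y" "a \<in> topspace X" "b \<in> topspace Y"
  shows "X homotopy_equivalent_space Y"
proof -
  have f: "continuous_map X Y (\<lambda>_. b)" and g: "continuous_map Y X (\<lambda>_. a)"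
    using assms(3,4) by simp_all
  have "homotopic_with (\<lambda>x. True) X X ((\<lambda>_. a) \<circ> (\<lambda>_. b)) id"
    by (intro homotopic_into_contractible_space conjI continuous_map_compose[OF f g]
        continuous_map_id assms(1))
  moreover have "homotopic_with (\<lambda>x. True) Y Y ((\<lambda>_. b) \<circ> (\<lambda>_. a)) id"
    by (intro homotopic_into_contractible_space conjI continuous_map_compose[OF g f]
        continuous_map_id assms(2))
  ultimately show ?thesis
    unfolding homotopy_equivalent_space_def using f g by blast
qed

lemma shelling_homotopy_equivalent_wedge_aux:
  fixes Fs :: "'v set list"
  assumes shelling: "is_shelling K Fs" and pure: "pure_of_dim K (int d)"
  shows "geom_realization K homotopy_equivalent_space
    wedge_of_spheres (card (spanning_facets Fs)) (int d)"
proof -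
  let ?R = "shelling_restriction Fs"
  have K: "abs_complex K" "K \<noteq> {}"
    using pure by (auto simp: pure_of_dim_def)
  have dist: "distinct Fs" and facets: "set Fs = facets K"
    using shelling by (auto simp: is_shelling_def)
  have facet: "finite (Fs ! i)" "card (Fs ! i) = Suc d" if "i < length Fs" for i
  proof -
    have "Fs ! i \<in> facets K"
      using that facets nth_mem by blast
    then show "finite (Fs ! i)" "card (Fs ! i) = Suc d"
      using pure by (auto simp: pure_of_dim_def abs_complex_def facets_def face_dim_def)
  qed
  have R_sub: "?R i \<subseteq> Fs ! i" for i
    by (auto simp: shelling_restriction_def)
  have inter: "shelling_intersection Fs i = {G. G \<subseteq> Fs ! i \<and> \<not> ?R i \<subseteq> G}" if "i < length Fs" for i
    by (rule shelling_intersection_restriction[OF shelling that])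
  have R_0: "?R 0 = {}"
    by (simp add: shelling_restriction_def shelling_intersection_def)
  have ne: "0 < length Fs"
    using K facets abs_complex_facet_above[OF K(1)] by (metis ex_in_conv length_greater_0_conv set_empty2)
  \<comment> \<open>In the first facet that contains \<open>G\<close>, the face \<open>G\<close> is
    new, so it contains the restriction.\<close>
  have first: "\<exists>j\<le>i. G \<subseteq> Fs ! j \<and> ?R j \<subseteq> G" if i: "i < length Fs" and G: "G \<subseteq> Fs ! i" for G i
  proof -
    define j where "j = (LEAST j. G \<subseteq> Fs ! j)"
    have j: "G \<subseteq> Fs ! j" "j \<le> i"
      unfolding j_def using G by (rule LeastI, rule Least_le)
    have "\<not> G \<subseteq> Fs ! k" if "k < j" for k
      using not_less_Least that unfolding j_def by blast
    then have "G \<notin> shelling_intersection Fs j"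
      by (auto simp: shelling_intersection_def)
    moreover have "j < length Fs"
      using j(2) i by simp
    ultimately have "?R j \<subseteq> G"
      using inter[of j] j(1) by simp
    with j show ?thesis
      by blast
  qed
  define N where "N = {i. i < length Fs \<and> ?R i \<noteq> Fs ! i}"
  \<comment> \<open>If that first facet were spanning, then \<open>G\<close> would be the whole
    facet, which is impossible for a proper subset of a facet of the same size.\<close>
  have first_N: "\<exists>j\<in>N. j \<le> i \<and> G \<subseteq> Fs ! j \<and> ?R j \<subseteq> G" if i: "i < length Fs" and G: "G \<subset> Fs ! i" for G i
  proof -
    obtain j where j: "j \<le> i" "G \<subseteq> Fs ! j" "?R j \<subseteq> G"
      using first[of i G] i G by auto
    have "?R j \<noteq> Fs ! j"
    proof
      assume "?R j = Fs ! j"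
      then have "G = Fs ! j"
        using j by auto
      then have "card G = card (Fs ! i)"
        using facet(2) i j(1) by simp
      then show False
        using psubset_card_mono[OF facet(1)[OF i] G] by simp
    qed
    then have "j \<in> N"
      using j(1) i by (simp add: N_def)
    with j show ?thesis
      by blast
  qed
  define A where "A m = (\<Union>j\<in>{j\<in>N. j < m}. simplex_on (Fs ! j))" for m
  have fin_N: "finite {j\<in>N. j < m}" for m
    by (rule finite_subset[of _ "{..<m}"]) auto
  have A_closed: "closed (A m)" for m
    unfolding A_def using fin_N closed_simplex_on by (intro closed_UN) auto
  have A_compact: "compact (A m)" for m
    unfolding A_def using fin_N facet(1) by (intro compact_UN) (auto simp: N_def intro!: compact_simplex_on)
  have supp: "\<exists>v\<in>R. x v = 0" if "x \<in> simplex_on F" "finite F" "\<not> R \<subseteq> {v. x v \<noteq> 0}" for x :: "'v \<Rightarrow> real" and F R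
    using that by auto
  have A_contr: "contractible (A m)" if "1 \<le> m" "m \<le> length Fs" for m
    using that
  proof (induction m rule: dec_induct)
    case base
    have "?R 0 \<noteq> Fs ! 0"
      using R_0 facet(2)[OF ne] by auto
    then have "{j\<in>N. j < 1} = {0}"
      using ne by (auto simp: N_def)
    then have "A 1 = simplex_on (Fs ! 0)"
      by (simp add: A_def)
    then show ?case
      using contractible_simplex_on[OF facet(1)[OF ne]] facet(2)[OF ne] by force
  next
    case (step m)
    then have m: "m < length Fs" and IH: "contractible (A m)"
      by auto
    show ?case
    proof (cases "m \<in> N")
      case False
      then have "{j\<in>N. j < Suc m} = {j\<in>N. j < m}"
        by (auto simp: less_Suc_eq)
      then show ?thesis
        using IH by (simp add: A_def)
    next
      case True
      then have "{j\<in>N. j < Suc m} = insert m {j\<in>N. j < m}"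
        by (auto simp: less_Suc_eq)
      then have A_Suc: "A (Suc m) = A m \<union> simplex_on (Fs ! m)"
        by (auto simp: A_def)
      have "contractible (A m \<union> simplex_on (Fs ! m))"
      proof (rule contractible_Un_simplex_on[OF IH A_closed facet(1)[OF m]])
        show "?R m \<subset> Fs ! m"
          using True R_sub[of m] by (auto simp: N_def)
        have "shelling_intersection Fs m \<noteq> {}"
          using shelling m step.hyps by (auto simp: is_shelling_def pure_of_dim_def)
        then show "?R m \<noteq> {}"
          using inter[OF m] by auto
        \<comment> \<open>By \<open>first_N\<close>, the non-spanning earlier facets already cover
          the intersection with all earlier facets.\<close>
        show "A m \<inter> simplex_on (Fs ! m) = {x \<in> simplex_on (Fs ! m). \<exists>v\<in>?R m. x v = 0}"
        proof (intro equalityI subsetI)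
          fix x assume "x \<in> A m \<inter> simplex_on (Fs ! m)"
          then obtain j where j: "j \<in> N" "j < m" "x \<in> simplex_on (Fs ! j)" and xm: "x \<in> simplex_on (Fs ! m)"
            by (auto simp: A_def)
          have "{v. x v \<noteq> 0} \<in> shelling_intersection Fs m"
            using j(2) simplex_on_support(1)[OF xm facet(1)[OF m]]
              simplex_on_support(1)[OF j(3) facet(1)] m by (auto simp: shelling_intersection_def)
          then show "x \<in> {x \<in> simplex_on (Fs ! m). \<exists>v\<in>?R m. x v = 0}"
            using inter[OF m] xm by auto
        next
          fix x assume "x \<in> {x \<in> simplex_on (Fs ! m). \<exists>v\<in>?R m. x v = 0}"
          then obtain v where xm: "x \<in> simplex_on (Fs ! m)" and v: "v \<in> ?R m" "x v = 0"
            by blast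
          have G: "{v. x v \<noteq> 0} \<subset> Fs ! m" "\<not> ?R m \<subseteq> {v. x v \<noteq> 0}"
            using simplex_on_support(1)[OF xm facet(1)[OF m]] v R_sub[of m] by auto
          then obtain j where j: "j \<in> N" "j \<le> m" "{v. x v \<noteq> 0} \<subseteq> Fs ! j" "?R j \<subseteq> {v. x v \<noteq> 0}"
            using first_N[OF m G(1)] by blast
          then have "j < m"
            using G(2) by (metis le_neq_implies_less)
          moreover have "x \<in> simplex_on (Fs ! j)"
            using simplex_on_mono[OF facet(1) j(3)] simplex_on_support(2)[OF xm facet(1)[OF m]] j(2) m
            by (meson le_less_trans subsetD)
          ultimately show "x \<in> A m \<inter> simplex_on (Fs ! m)"
            using xm j(1) by (auto simp: A_def)
        qed
      qed
      then show ?thesis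
        by (simp add: A_Suc)
    qed
  qed
  let ?A = "A (length Fs)"
  have contr: "contractible ?A"
    using A_contr[of "length Fs"] ne by simp
  have "0 \<in> N"
    using R_0 facet(2)[OF ne] ne by (auto simp: N_def)
  moreover have "simplex_on (Fs ! 0) \<noteq> {}"
  proof -
    obtain u where "u \<in> Fs ! 0"
      using facet(2)[OF ne] by fastforce
    then have "(\<lambda>v. if v = u then 1 else 0) \<in> simplex_on (Fs ! 0)"
      using facet(1)[OF ne] by (auto simp: simplex_on_def)
    then show ?thesis
      by blast
  qed
  ultimately have A_ne: "?A \<noteq> {}"
    using ne by (auto simp: A_def)
  have spanning: "spanning_facets Fs = {Fs ! i | i. i < length Fs \<and> ?R i = Fs ! i}"
  proof -
    have sp: "shelling_intersection Fs i = {G. G \<subset> Fs ! i} \<longleftrightarrow> ?R i = Fs ! i" if i: "i < length Fs" for i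
    proof
      assume eq: "shelling_intersection Fs i = {G. G \<subset> Fs ! i}"
      have "?R i \<notin> shelling_intersection Fs i"
        using inter[OF i] by simp
      then show "?R i = Fs ! i"
        using eq R_sub[of i] by blast
    next
      assume "?R i = Fs ! i"
      then show "shelling_intersection Fs i = {G. G \<subset> Fs ! i}"
        using inter[OF i] by auto
    qed
    show ?thesis
      unfolding spanning_facets_def by (intro Collect_cong iff_exI conj_cong refl sp)
  qed
  have "(\<Union>F\<in>facets K. simplex_on F) = (\<Union>i<length Fs. simplex_on (Fs ! i))"
    unfolding facets[symmetric] by (auto simp: set_conv_nth)
  also have "\<dots> = ?A \<union> (\<Union>F\<in>spanning_facets Fs. simplex_on F)"
    unfolding spanning A_def N_def by blast
  finally have real: "geom_realization K = top_of_set (?A \<union> (\<Union>F\<in>spanning_facets Fs. simplex_on F))"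
    using geom_realization_eq[OF K(1)] Union_simplex_on_facets[OF K(1)] by simp
  show ?thesis
  proof (cases "spanning_facets Fs = {}")
    case True
    obtain a where "a \<in> ?A"
      using A_ne by blast
    then have "top_of_set ?A homotopy_equivalent_space
        discrete_topology {None :: (nat \<times> (nat \<Rightarrow> real)) option}"
      using contr by (intro homotopy_equivalent_contractible_spaces[of _ _ a None]) simp_all
    moreover have "geom_realization K = top_of_set ?A"
      by (simp add: real True)
    moreover have "wedge_of_spheres (card (spanning_facets Fs)) (int d) = discrete_topology {None}"
      by (simp add: True wedge_of_spheres_def wedge_def)
    ultimately show ?thesis
      by simp
  next
    case False
    show ?thesis
      unfolding real
    proof (rule contractible_Un_simplices_wedge[OF contr A_closed A_compact A_ne _ False])
      show "finite (spanning_facets Fs)"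
        unfolding spanning by simp
      fix F assume "F \<in> spanning_facets Fs"
      then obtain i where i: "i < length Fs" "F = Fs ! i" "?R i = F"
        unfolding spanning by blast
      show F: "finite F" "card F = Suc d"
        using facet i by auto
      \<comment> \<open>Distinct facets have equal size, so a point shared with another facet misses
        a vertex of \<open>F\<close>. Conversely, every proper face of \<open>F\<close> lies in some
        non-spanning facet, even if that facet comes after spanning ones.\<close>
      show "?A \<inter> simplex_on F = {x \<in> simplex_on F. \<exists>v\<in>F. x v = 0}"
      proof (intro equalityI subsetI)
        fix x assume "x \<in> ?A \<inter> simplex_on F"
        then obtain j where j: "j \<in> N" "j < length Fs" "x \<in> simplex_on (Fs ! j)" and xF: "x \<in> simplex_on F"
          by (auto simp: A_def)
        have "Fs ! j \<noteq> F"
          using i j by (auto simp: N_def nth_eq_iff_index_eq[OF dist])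
        then have "\<not> F \<subseteq> Fs ! j"
          using card_subset_eq[OF facet(1)[OF j(2)]] facet(2)[OF j(2)] F(2) by auto
        then show "x \<in> {x \<in> simplex_on F. \<exists>v\<in>F. x v = 0}"
          using simplex_on_support(1)[OF j(3) facet(1)[OF j(2)]] xF by blast
      next
        fix x assume "x \<in> {x \<in> simplex_on F. \<exists>v\<in>F. x v = 0}"
        then obtain v where xF: "x \<in> simplex_on F" and v: "v \<in> F" "x v = 0"
          by blast
        have "{v. x v \<noteq> 0} \<subset> Fs ! i"
          using simplex_on_support(1)[OF xF F(1)] v i(2) by blast
        then obtain j where j: "j \<in> N" "{v. x v \<noteq> 0} \<subseteq> Fs ! j"
          using first_N[OF i(1)] by blast
        then have "j < length Fs"
          by (simp add: N_def)
        then have "x \<in> simplex_on (Fs ! j)"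
          using simplex_on_mono[OF facet(1) j(2)] simplex_on_support(2)[OF xF F(1)] by blast
        then show "x \<in> ?A \<inter> simplex_on F"
          using xF j(1) \<open>j < length Fs\<close> by (auto simp: A_def)
      qed
    qed
  qed
qed

text \<open>In negative dimension the empty face is the only facet. It is spanning, since its
  intersection with earlier facets and its boundary are both void, and one empty sphere matches the
  empty realization.\<close>

theorem shelling_homotopy_equivalent_wedge:
  assumes shelling: "is_shelling K Fs" and pure: "pure_of_dim K d"
  shows "geom_realization K homotopy_equivalent_space wedge_of_spheres (card (spanning_facets Fs)) d"
proof (cases "0 \<le> d")
  case True
  then show ?thesis
    using shelling_homotopy_equivalent_wedge_aux[OF shelling, of "nat d"] pure by simp
next
  case False
  have K: "abs_complex K" "K \<noteq> {}"
    using pure by (auto simp: pure_of_dim_def)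
  have facet: "F = {}" if "F \<in> facets K" for F
  proof -
    have fin: "finite F"
      using that K(1) by (auto simp: abs_complex_def facets_def)
    have "face_dim F = d"
      using that pure by (simp add: pure_of_dim_def)
    then have "card F = 0"
      using False by (simp add: face_dim_def)
    with fin show ?thesis
      by simp
  qed
  obtain F where "F \<in> facets K"
    using K(2) abs_complex_facet_above[OF K(1)] by (metis ex_in_conv)
  then have facets: "facets K = {{}}"
    using facet by auto
  then have "set Fs = {{}}" "distinct Fs"
    using shelling by (auto simp: is_shelling_def)
  then have "length Fs = 1"
    using distinct_card[of Fs] by simp
  then have Fs: "Fs = [{}]"
    using \<open>set Fs = {{}}\<close> by (cases Fs) simp_all
  have "spanning_facets Fs = {{}}"
    by (auto simp: Fs spanning_facets_def shelling_intersection_def)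
  moreover have "geom_realization K = top_of_set (simplex_on {})"
    unfolding geom_realization_eq[OF K(1)] Union_simplex_on_facets[OF K(1)] facets by simp
  then have "topspace (geom_realization K) = {}"
    by (simp only: topspace_euclidean_subtopology) (simp add: simplex_on_def)
  \<comment> \<open>The base point is not a point of the empty sphere, so the quotient does not
    contain \<open>None\<close> either.\<close>
  moreover have "topspace (wedge_of_spheres 1 d) = {}"
  proof -
    have "wedge_of_spheres 1 d = quotient_topology (sum_topology (\<lambda>_. discrete_topology {}) {..<1})
        (\<lambda>(i, x). if x = (\<lambda>j. if j = 0 then 1 else 0) then None else Some (i, x))"
      using False by (simp add: wedge_of_spheres_def wedge_def sphere_of_dim_def lessThan_Suc)
    then show ?thesis
      by (simp only: topspace_quotient_topology topspace_sum_topology) simp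
  qed
  ultimately show ?thesis
    by (intro homeomorphic_imp_homotopy_equivalent_space) (simp add: homeomorphic_empty_space_eq)
qed

theorem theorem4p2:
  fixes n :: nat and c :: "nat list"
  assumes "composition n c"
  shows "shellable (Delta_comp n c) \<and>
    (\<exists>Fs. is_shelling (Delta_comp n c) Fs \<and>
       spanning_facets Fs =
         {osp_chain (perm_osp \<alpha> c) | \<alpha>. \<alpha> permutes {1..n} \<and> descent_composition n \<alpha> = c}) \<and>
    geom_realization (Delta_comp n c) homotopy_equivalent_space
      wedge_of_spheres (beta n c) (int (length c) - 2)"
proof -
  let ?K = "Delta_comp n c" and ?R = "partial_sums c"
  note R = partial_sums_subset[OF assms]
  note K = Delta_comp_eq_rank_chains[OF assms]
  have "0 < length c"
    using composition_pos(1)[OF assms] by simp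
  \<comment> \<open>A composition with \<open>k\<close> parts has \<open>k - 1\<close> proper
    partial sums, hence facets with \<open>k - 1\<close> vertices; a positive length keeps the
    subtraction on \<open>nat\<close> from truncating.\<close>
  then have dim: "int (card ?R) - 1 = int (length c) - 2"
    unfolding card_partial_sums[OF assms] by linarith
  have pure: "pure_of_dim ?K (int (length c) - 2)"
    using pure_rank_chains[OF R] unfolding K dim .
  obtain Fs where Fs: "is_shelling ?K Fs"
    and spanning: "spanning_facets Fs = {F \<in> facets ?K. chain_descents n F = F}"
  proof (rule shelling_by_weight[OF pure])
    show "chain_descents n F \<subseteq> F" for F
      by (auto simp: chain_descents_def)
    show "\<exists>G\<in>facets ?K. F - {S} \<subseteq> G \<and> chain_weight G < chain_weight F"
      if "F \<in> facets ?K" "S \<in> chain_descents n F" for F S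
      using chain_weight_descend[OF R] that unfolding K by blast
    show "chain_weight F < chain_weight G"
      if "F \<in> facets ?K" "G \<in> facets ?K" "chain_descents n F \<subseteq> G" "F \<noteq> G" for F G
      using chain_weight_ascend[OF R] that unfolding K by blast
  qed
  let ?P = "{\<alpha>. \<alpha> permutes {1..n} \<and> descent_composition n \<alpha> = c}"
  \<comment> \<open>The bijection serves twice: its image describes the spanning facets, and its
    injectivity makes their number \<open>beta n c\<close>.\<close>
  have bij: "bij_betw (\<lambda>\<alpha>. osp_chain (perm_osp \<alpha> c)) ?P (spanning_facets Fs)"
    unfolding osp_chain_perm_osp descent_composition_eq_iff[OF assms] spanning K
    by (rule full_descents_bij[OF R])
  have "spanning_facets Fs = {osp_chain (perm_osp \<alpha> c) | \<alpha>. \<alpha> permutes {1..n} \<and> descent_composition n \<alpha> = c}"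
    using bij_betw_imp_surj_on[OF bij] unfolding setcompr_eq_image by (rule sym)
  moreover have "beta n c = card (spanning_facets Fs)"
    using bij_betw_same_card[OF bij] by (simp add: beta_def descent_perms_def)
  then have "geom_realization ?K homotopy_equivalent_space wedge_of_spheres (beta n c) (int (length c) - 2)"
    using shelling_homotopy_equivalent_wedge[OF Fs pure] by simp
  moreover have "shellable ?K"
    unfolding shellable_def using pure Fs by blast
  ultimately show ?thesis
    using Fs by blast
qed

end
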